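(* There is an absolute constant $C>0$ such that the following holds. Let $n$ be a positive integer and let $G$ be a graph on vertex set $\{0,1,\ldots,n\}$. Suppose that for every edge $ij$ of $G$ with $i<j$ we are given an integer $x_{ij}\in\{0,1,\ldots,n/2-9(n\log n)^{1/2}\}$, and let $\mathbf{x}=(x_{ij})$. Then every $(G,\mathbf{x})$-Sperner family $\mathcal{A}\subset\mathcal{P}[n]$ satisfies \[ |\mathcal{A}|\le w(G)+\frac{C}{n^{2/3}}2^n=(1+o(1))\,w(G). \]
   Context: $[n]=\{1,\ldots,n\}$, $\mathcal{P}[n]$ is its power set, $[n]^{(i)}$ is the set of $i$-element subsets of $[n]$, and for $\mathcal{A}\subset\mathcal{P}[n]$, $\mathcal{A}^{(i)}=\{A\in\mathcal{A}:|A|=i\}$. Given a graph $G$ on $\{0,\ldots,n\}$ and integers $x_{ij}$ indexed by the edges $ij$ of $G$ (with $i<j$), a family $\mathcal{A}\subset\mathcal{P}[n]$ is a $(G,\mathbf{x})$-Sperner family if for every edge $ij$ of $G$ with $i<j$, $|A\setminus B|\neq x_{ij}$ for all $A\in\mathcal{A}^{(i)}$ and $B\in\mathcal{A}^{(j)}$. The weight of $G$ is $w(G)=\max_I\sum_{i\in I}\binom{n}{i}$, the maximum over all independent sets $I$ of $G$. Here $\log$ is the natural logarithm and $o(1)$ denotes a quantity tending to $0$ as $n\to\infty$. *)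

theory Defs
  imports Complex_Main
begin

definition is_graph_on :: "nat \<Rightarrow> (nat \<Rightarrow> nat \<Rightarrow> bool) \<Rightarrow> bool" where
  "is_graph_on n E \<longleftrightarrow>
     (\<forall>i j. E i j \<longrightarrow> E j i) \<and> (\<forall>i. \<not> E i i) \<and> (\<forall>i j. E i j \<longrightarrow> i \<le> n \<and> j \<le> n)"

definition independent_set :: "nat \<Rightarrow> (nat \<Rightarrow> nat \<Rightarrow> bool) \<Rightarrow> nat set \<Rightarrow> bool" where
  "independent_set n E I \<longleftrightarrow> I \<subseteq> {0..n} \<and> (\<forall>i\<in>I. \<forall>j\<in>I. \<not> E i j)"

definition weight :: "nat \<Rightarrow> (nat \<Rightarrow> nat \<Rightarrow> bool) \<Rightarrow> nat" where
  "weight n E = Max {\<Sum>i\<in>I. n choose i | I. independent_set n E I}"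

definition GX_sperner :: "(nat \<Rightarrow> nat \<Rightarrow> bool) \<Rightarrow> (nat \<Rightarrow> nat \<Rightarrow> nat) \<Rightarrow> nat set set \<Rightarrow> bool" where
  "GX_sperner E x \<A> \<longleftrightarrow>
     (\<forall>i j. E i j \<and> i < j \<longrightarrow>
        (\<forall>A\<in>\<A>. \<forall>B\<in>\<A>. card A = i \<longrightarrow> card B = j \<longrightarrow> card (A - B) \<noteq> x i j))"

end

(*
A random permutation sigma of [n] gives the random chain sigma{1..i}, one uniform set per layer.
If the layers i with sigma{1..i} in A formed an independent set of G, then averaging the sum of
the binomials (n choose i) over these layers would give |A| <= w(G). They need not: an edge ij only
forbids the difference x_ij, not the chain. So the chain is embedded in a random "code", a family
of configurations in which layer i receives a uniform set for each codeword and in which the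
difference between a set of layer i and a set of layer j is the distance of the two codewords.
For each layer a small proportion of codewords is declared exceptional; if the codeword of the
chain is exceptional neither for i nor for j while both sets belong to A, then every distance x of
the range handled by the code occurs between members of A, so ij is not an edge with x_ij = x.

The codes are products of a cube {0,1}^k with a small space of words under the Hamming distance.
In a cube, two families of density n^(-O(1)) contain members whose distance is within
O(sqrt(k log n)) of any prescribed value, and repeating this on cubes of rapidly decreasing size
makes the error smaller than about n^(1/8). The remaining exact correction by r comes from
members that can be moved by exactly r inside the family; almost all members can be moved,
since suitable translates of the set of immovable ones are disjoint.

Differences up to n/2 - O(sqrt(n log n)) leave no room for the wasteful large-alphabet words, so
there the corrections are made inside the cube, on a block of coordinates on which the two members
agree: among more than 14 log(1/d) disjoint blocks, one has a content that keeps the density of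
both families. Such moves preserve parity, which is adjusted beforehand on a few ternary letters.
Only a bounded number of codes is needed, each costing O(n^(-2/3)).
*)
theory Submission
  imports Defs "HOL-Library.FuncSet" "HOL-Library.Disjoint_Sets" "HOL-Combinatorics.Permutations" "HOL-Real_Asymp.Real_Asymp"
begin

section \<open>Isoperimetry in the cube\<close>

definition sdist :: "'a set \<Rightarrow> 'a set \<Rightarrow> nat" where
  "sdist a b = card (sym_diff a b)"

lemma sdist_commute: "sdist a b = sdist b a"
  by (simp add: sdist_def Un_commute)

lemma sdist_le_card: "finite K \<Longrightarrow> a \<subseteq> K \<Longrightarrow> b \<subseteq> K \<Longrightarrow> sdist a b \<le> card K"
  unfolding sdist_def by (rule card_mono) auto

lemma sdist_triangle:
  assumes "finite a" "finite b" "finite c"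
  shows "sdist a c \<le> sdist a b + sdist b c"
proof -
  have "card (sym_diff a c) \<le> card (sym_diff a b \<union> sym_diff b c)"
    using assms by (intro card_mono) auto
  also have "\<dots> \<le> card (sym_diff a b) + card (sym_diff b c)" by (rule card_Un_le)
  finally show ?thesis by (simp add: sdist_def)
qed

lemma sdist_Un:
  assumes "finite A" "finite B" "A \<inter> B = {}" "a \<subseteq> A" "a' \<subseteq> A" "b \<subseteq> B" "b' \<subseteq> B"
  shows "sdist (a \<union> b) (a' \<union> b') = sdist a a' + sdist b b'"
proof -
  have "sym_diff (a \<union> b) (a' \<union> b') = sym_diff a a' \<union> sym_diff b b'" using assms by blast
  moreover have "sym_diff a a' \<inter> sym_diff b b' = {}" using assms by blast
  moreover have "finite a" "finite a'" "finite b" "finite b'" using assms finite_subset by blast+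
  ultimately show ?thesis unfolding sdist_def by (simp add: card_Un_disjoint)
qed

lemma card_subfamily_insert:
  assumes "finite K" "x \<notin> K" "U \<subseteq> Pow (insert x K)"
  shows "card U = card {a \<in> Pow K. a \<in> U} + card {a \<in> Pow K. insert x a \<in> U}"
proof -
  have U: "U = {a \<in> Pow K. a \<in> U} \<union> insert x ` {a \<in> Pow K. insert x a \<in> U}" (is "_ = ?A \<union> _ ` ?B")
  proof
    show "U \<subseteq> ?A \<union> insert x ` ?B"
    proof
      fix a assume a: "a \<in> U"
      show "a \<in> ?A \<union> insert x ` ?B"
      proof (cases "x \<in> a")
        case True
        then have "a = insert x (a - {x})" by blast
        moreover have "a - {x} \<in> ?B" using a True assms(3) by (auto simp: insert_absorb)
        ultimately show ?thesis by blast
      qed (use a assms(3) in auto)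
    qed
  qed auto
  have "inj_on (insert x) ?B" using assms(2) by (auto simp: inj_on_def)
  moreover have "?A \<inter> insert x ` ?B = {}" using assms(2) by auto
  moreover have "finite ?A" "finite ?B" using assms(1) by auto
  ultimately have "card (?A \<union> insert x ` ?B) = card ?A + card ?B"
    by (simp add: card_Un_disjoint card_image)
  then show ?thesis using U by simp
qed

text \<open>The cross products \<open>P = u0 * v1\<close> and \<open>Q = u1 * v0\<close> satisfy
  \<open>P * Q \<le> F * F\<close>, because their product is also that of the same-side products.
  Together with \<open>(e * F - P) * (e * F - Q) \<ge> 0\<close> this bounds \<open>P + Q\<close> by
  \<open>e * F + F / e\<close>.\<close>

lemma real_square_split:
  fixes u0 u1 v0 v1 F e :: real
  assumes "u0 \<ge> 0" "u1 \<ge> 0" "v0 \<ge> 0" "v1 \<ge> 0" "e > 0" "F > 0"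
    and "u0 * v0 \<le> F" "u1 * v1 \<le> F" "u0 * v1 \<le> e * F" "u1 * v0 \<le> e * F"
  shows "(u0 + u1) * (v0 + v1) \<le> (1 + e) * (1 + inverse e) * F"
proof -
  let ?P = "u0 * v1" and ?Q = "u1 * v0"
  have "0 \<le> (e * F - ?P) * (e * F - ?Q)" using assms by (intro mult_nonneg_nonneg) auto
  moreover have "?P * ?Q \<le> F * F"
  proof -
    have "?P * ?Q = (u0 * v0) * (u1 * v1)" by (simp add: algebra_simps)
    also have "\<dots> \<le> F * F" using assms by (intro mult_mono) auto
    finally show ?thesis .
  qed
  ultimately have "e * F * (?P + ?Q) \<le> e * F * (e * F) + F * F" by (simp add: algebra_simps)
  also have "\<dots> = e * F * (e * F + inverse e * F)" using assms by (simp add: field_simps)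
  finally have "?P + ?Q \<le> e * F + inverse e * F"
    using assms by (simp add: mult_le_cancel_left_pos)
  moreover have "(u0 + u1) * (v0 + v1) = u0 * v0 + u1 * v1 + (?P + ?Q)" by (simp add: algebra_simps)
  moreover have "(1 + e) * (1 + inverse e) * F = F + F + (e * F + inverse e * F)"
    using assms by (simp add: field_simps)
  ultimately show ?thesis using assms by linarith
qed

text \<open>Isoperimetry in exponential-moment form, by induction on the dimension: split both
  families at a new coordinate. Halves on the same side stay \<open>D\<close> apart, halves on
  opposite sides at least \<open>D - 1\<close>, which costs a factor \<open>exp l\<close>.
  \<open>D\<close> is real so that \<open>D - 1\<close> does not truncate.\<close>

lemma separated_families_exp:
  fixes D l :: real
  assumes "finite K" "U \<subseteq> Pow K" "V \<subseteq> Pow K" "l \<ge> 0"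
    and "\<And>a b. a \<in> U \<Longrightarrow> b \<in> V \<Longrightarrow> D \<le> real (sdist a b)"
  shows "real (card U) * real (card V) \<le> ((1 + exp l) * (1 + inverse (exp l))) ^ card K * exp (- (l * D))"
  using assms
proof (induction K arbitrary: U V D rule: finite_induct)
  case empty
  show ?case
  proof (cases "U = {} \<or> V = {}")
    case False
    then have "U = {{}}" "V = {{}}" using empty by auto
    then have "D \<le> 0" using empty(4)[of "{}" "{}"] by (simp add: sdist_def)
    then have "l * D \<le> 0" using empty by (simp add: mult_nonneg_nonpos)
    then show ?thesis using \<open>U = {{}}\<close> \<open>V = {{}}\<close> by simp
  qed auto
next
  case (insert x K)
  define U0 V0 U1 V1 where defs: "U0 = {a \<in> Pow K. a \<in> U}" "V0 = {a \<in> Pow K. a \<in> V}"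
    "U1 = {a \<in> Pow K. insert x a \<in> U}" "V1 = {a \<in> Pow K. insert x a \<in> V}"
  have sub: "U0 \<subseteq> Pow K" "U1 \<subseteq> Pow K" "V0 \<subseteq> Pow K" "V1 \<subseteq> Pow K" by (auto simp: defs)
  have card: "card U = card U0 + card U1" "card V = card V0 + card V1"
    using card_subfamily_insert[OF insert(1,2)] insert(4,5) by (auto simp: defs)
  define F where "F = ((1 + exp l) * (1 + inverse (exp l))) ^ card K * exp (- (l * D))"
  have F: "F > 0" unfolding F_def by (intro mult_pos_pos zero_less_power) (auto intro: add_pos_pos)
  have eF: "exp l * F = ((1 + exp l) * (1 + inverse (exp l))) ^ card K * exp (- (l * (D - 1)))"
    by (simp add: F_def algebra_simps exp_diff exp_minus exp_add field_simps)
  have fin: "finite a" if "a \<subseteq> K" for a using that insert(1) finite_subset by blast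
  have same: "sdist (insert x a) (insert x b) = sdist a b" if "a \<subseteq> K" "b \<subseteq> K" for a b
  proof -
    have "sym_diff (insert x a) (insert x b) = sym_diff a b" using that insert(2) by auto
    then show ?thesis by (simp add: sdist_def)
  qed
  have diff: "sdist a (insert x b) = Suc (sdist a b)" if "a \<subseteq> K" "b \<subseteq> K" for a b
  proof -
    have "sym_diff a (insert x b) = insert x (sym_diff a b)" using that insert(2) by auto
    moreover have "x \<notin> sym_diff a b" using that insert(2) by auto
    moreover have "finite (sym_diff a b)" using fin that by auto
    ultimately show ?thesis by (simp add: sdist_def)
  qed
  have diff': "sdist (insert x a) b = Suc (sdist a b)" if "a \<subseteq> K" "b \<subseteq> K" for a b
    using diff[OF that(2,1)] by (simp add: sdist_commute)
  have "real (card U0) * real (card V0) \<le> F"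
    unfolding F_def by (rule insert.IH[OF sub(1,3) insert.prems(3)]) (use insert.prems(4) in \<open>auto simp: defs\<close>)
  moreover have "real (card U1) * real (card V1) \<le> F"
    unfolding F_def
  proof (rule insert.IH[OF sub(2,4) insert.prems(3)])
    fix a b assume "a \<in> U1" "b \<in> V1"
    then show "D \<le> real (sdist a b)" using insert.prems(4)[of "insert x a" "insert x b"] same[of a b]
      by (auto simp: defs)
  qed
  moreover have "real (card U0) * real (card V1) \<le> exp l * F"
    unfolding eF
  proof (rule insert.IH[OF sub(1,4) insert.prems(3)])
    fix a b assume "a \<in> U0" "b \<in> V1"
    then show "D - 1 \<le> real (sdist a b)" using insert.prems(4)[of a "insert x b"] diff[of a b]
      by (auto simp: defs)
  qed
  moreover have "real (card U1) * real (card V0) \<le> exp l * F"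
    unfolding eF
  proof (rule insert.IH[OF sub(2,3) insert.prems(3)])
    fix a b assume "a \<in> U1" "b \<in> V0"
    then show "D - 1 \<le> real (sdist a b)" using insert.prems(4)[of "insert x a" b] diff'[of a b]
      by (auto simp: defs)
  qed
  ultimately have "(real (card U0) + real (card U1)) * (real (card V0) + real (card V1))
      \<le> (1 + exp l) * (1 + inverse (exp l)) * F"
    using F by (intro real_square_split) auto
  then show ?case using insert(1,2) by (simp add: card F_def algebra_simps)
qed

text \<open>The left side is \<open>4 * (cosh (l / 2))^2\<close>. The crude estimate
  \<open>cosh m \<le> 1 + m^2 \<le> exp (m^2)\<close> at \<open>m = l / 2\<close> suffices; it
  affects only constants.\<close>

lemma cosh_type_bound:
  fixes l :: real
  assumes "0 \<le> l" "l \<le> 1"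
  shows "(1 + exp l) * (1 + inverse (exp l)) \<le> 4 * exp (l\<^sup>2 / 2)"
proof -
  define m where "m = l / 2"
  have m: "0 \<le> m" "m \<le> 1" using assms by (auto simp: m_def)
  have 1: "exp m \<le> 1 + m + m\<^sup>2" using exp_bound[OF m] .
  have 2: "exp (- m) \<le> 1 - m + m\<^sup>2"
  proof -
    have "exp (- m) = inverse (exp m)" by (simp add: exp_minus)
    also have "\<dots> \<le> inverse (1 + m)" using exp_ge_add_one_self[of m] m by (intro le_imp_inverse_le) auto
    also have "\<dots> \<le> 1 - m + m\<^sup>2"
    proof -
      have "1 \<le> (1 - m + m\<^sup>2) * (1 + m)" using m by (simp add: algebra_simps power2_eq_square)
      then show ?thesis using m by (simp add: field_simps)
    qed
    finally show ?thesis .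
  qed
  have "exp m + exp (- m) \<le> 2 * (1 + m\<^sup>2)" using 1 2 by simp
  also have "\<dots> \<le> 2 * exp (m\<^sup>2)"
    by (intro mult_left_mono exp_ge_add_one_self) auto
  finally have 3: "exp m + exp (- m) \<le> 2 * exp (m\<^sup>2)" .
  have "(1 + exp l) * (1 + inverse (exp l)) = (exp m + exp (- m))\<^sup>2"
  proof -
    have "exp l = exp m * exp m" by (simp add: m_def flip: exp_add)
    then show ?thesis by (simp add: power2_eq_square exp_minus field_simps)
  qed
  also have "\<dots> \<le> (2 * exp (m\<^sup>2))\<^sup>2" using 3 by (intro power_mono) auto
  also have "\<dots> = 4 * exp (2 * m\<^sup>2)"
    by (simp add: power_mult_distrib flip: exp_double)
  also have "2 * m\<^sup>2 = l\<^sup>2 / 2" by (simp add: m_def power2_eq_square)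
  finally show ?thesis .
qed

lemma separated_families:
  assumes "finite K" "U \<subseteq> Pow K" "V \<subseteq> Pow K"
    and D: "\<And>a b. a \<in> U \<Longrightarrow> b \<in> V \<Longrightarrow> D \<le> sdist a b"
  shows "real (card U) * real (card V) \<le> 4 ^ card K * exp (- ((real D)\<^sup>2 / (2 * real (card K))))"
proof (cases "U = {} \<or> V = {}")
  case False
  then obtain a b where ab: "a \<in> U" "b \<in> V" by blast
  have le: "D \<le> card K"
    using D[OF ab] sdist_le_card[OF assms(1), of a b] ab assms(2,3) by fastforce
  \<comment> \<open>The minimiser of \<open>card K * l^2 / 2 - l * D\<close>;
    \<open>D \<le> card K\<close> puts it in the range of the quadratic bound. For
    \<open>card K = 0\<close> the quotient is 0.\<close>
  define l where "l = real D / real (card K)"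
  have l: "0 \<le> l" "l \<le> 1" using le by (auto simp: l_def divide_le_eq_1)
  have "real (card U) * real (card V)
      \<le> ((1 + exp l) * (1 + inverse (exp l))) ^ card K * exp (- (l * real D))"
    using separated_families_exp[OF assms(1-3) l(1), of "real D"] D by auto
  also have "\<dots> \<le> (4 * exp (l\<^sup>2 / 2)) ^ card K * exp (- (l * real D))"
    using cosh_type_bound[OF l] by (intro mult_right_mono power_mono) (auto intro!: mult_nonneg_nonneg add_nonneg_nonneg)
  also have "\<dots> = 4 ^ card K * exp (real (card K) * (l\<^sup>2 / 2) - l * real D)"
    by (simp add: power_mult_distrib exp_diff exp_minus field_simps exp_of_nat_mult[symmetric] del: times_divide_eq_right)
  also have "real (card K) * (l\<^sup>2 / 2) - l * real D = - ((real D)\<^sup>2 / (2 * real (card K)))"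
    by (cases "card K = 0") (auto simp: l_def field_simps power2_eq_square)
  finally show ?thesis .
qed auto

section \<open>Approximating a prescribed distance\<close>

text \<open>\<open>d\<close> is a density threshold and \<open>g\<close> the error. The error is
  one-sided: the distance never exceeds the target, so the shortfall is a natural number that a
  further cube or a move can add.\<close>

definition near :: "'a set \<Rightarrow> real \<Rightarrow> nat set \<Rightarrow> nat \<Rightarrow> bool" where
  "near K d X g \<longleftrightarrow> (\<forall>U V. U \<subseteq> Pow K \<longrightarrow> V \<subseteq> Pow K \<longrightarrow>
     d * 2 ^ card K \<le> real (card U) \<longrightarrow> d * 2 ^ card K \<le> real (card V) \<longrightarrow>
     (\<forall>x\<in>X. \<exists>a\<in>U. \<exists>b\<in>V. sdist a b \<le> x \<and> x \<le> sdist a b + g))"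

lemma nearD:
  assumes "near K d X g" "U \<subseteq> Pow K" "V \<subseteq> Pow K" "d * 2 ^ card K \<le> real (card U)"
    "d * 2 ^ card K \<le> real (card V)" "x \<in> X"
  shows "\<exists>a\<in>U. \<exists>b\<in>V. sdist a b \<le> x \<and> x \<le> sdist a b + g"
  using assms unfolding near_def by simp

text \<open>Translating \<open>V\<close> by a fixed set \<open>w\<close> of size
  \<open>x - R\<close> reduces the claim to finding members within distance \<open>R\<close>. If
  there were none, isoperimetry would bound the product of the densities by
  \<open>exp (- (R + 1)^2 / (2 * card K)) < d^2\<close>. Undoing the translation puts the distance
  within \<open>R\<close> of \<open>x - R\<close>, hence between \<open>x - 2 * R\<close> and
  \<open>x\<close>.\<close>

lemma near_cube:
  assumes "finite K" "0 < d" and R: "4 * real (card K) * ln (1 / d) < (real (R + 1))\<^sup>2"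
  shows "near K d {R..card K + R} (2 * R)"
  unfolding near_def
proof (intro allI impI ballI)
  fix U V x
  assume U: "U \<subseteq> Pow K" "d * 2 ^ card K \<le> real (card U)"
    and V: "V \<subseteq> Pow K" "d * 2 ^ card K \<le> real (card V)" and x: "x \<in> {R..card K + R}"
  obtain w where w: "w \<subseteq> K" "card w = x - R"
    using x obtain_subset_with_card_n[of "x - R" K] by (metis atLeastAtMost_iff le_diff_conv)
  define V' where "V' = (\<lambda>b. sym_diff b w) ` V"
  have inj: "inj_on (\<lambda>b. sym_diff b w) V" by (rule inj_on_inverseI[of _ "\<lambda>b. sym_diff b w"]) blast
  have V': "V' \<subseteq> Pow K" "card V' = card V" using V w inj by (auto simp: V'_def card_image)
  have "\<exists>a\<in>U. \<exists>b\<in>V'. sdist a b < R + 1"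
  proof (rule ccontr)
    assume "\<not> ?thesis"
    then have *: "R + 1 \<le> sdist a b" if "a \<in> U" "b \<in> V'" for a b using that by force
    let ?k = "real (card K)"
    have "(d * 2 ^ card K) * (d * 2 ^ card K) \<le> real (card U) * real (card V')"
      using U V V'(2) assms(2) by (intro mult_mono) auto
    also have "\<dots> \<le> 4 ^ card K * exp (- ((real (R + 1))\<^sup>2 / (2 * ?k)))"
      by (rule separated_families[OF assms(1) U(1) V'(1) *])
    finally have "d * d * 4 ^ card K \<le> exp (- ((real (R + 1))\<^sup>2 / (2 * ?k))) * 4 ^ card K"
      by (simp add: algebra_simps flip: power_mult_distrib)
    then have dd: "d * d \<le> exp (- ((real (R + 1))\<^sup>2 / (2 * ?k)))" by simp
    have k0: "?k > 0"
    proof (rule ccontr)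
      assume "\<not> ?k > 0"
      then have "K = {}" using assms(1) by auto
      then have "U = {{}}" "V' = {{}}" using U V V' assms(2) by (auto simp: subset_singleton_iff)
      then show False using *[of "{}" "{}"] by (simp add: sdist_def)
    qed
    have "ln (d * d) \<le> - ((real (R + 1))\<^sup>2 / (2 * ?k))"
      using dd assms(2) by (metis ln_exp ln_le_cancel_iff exp_gt_zero mult_pos_pos)
    then have "(real (R + 1))\<^sup>2 / (2 * ?k) \<le> 2 * ln (1 / d)"
      using assms(2) by (simp add: ln_mult ln_div)
    then have "(real (R + 1))\<^sup>2 \<le> 4 * ?k * ln (1 / d)" using k0 by (simp add: field_simps)
    then show False using R by simp
  qed
  then obtain a b where ab: "a \<in> U" "b \<in> V" "sdist a (sym_diff b w) \<le> R" by (auto simp: V'_def)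
  have fin: "finite a" "finite b" "finite w" using ab U V w assms(1) by (meson PowD finite_subset subsetD)+
  have bw: "sdist (sym_diff b w) b = x - R"
  proof -
    have "sym_diff (sym_diff b w) b = w" by blast
    then show ?thesis using w by (simp add: sdist_def)
  qed
  have 1: "sdist a b \<le> R + (x - R)"
    using sdist_triangle[of a "sym_diff b w" b] fin bw ab(3) by auto
  have "sdist (sym_diff b w) b \<le> sdist (sym_diff b w) a + sdist a b"
    using fin by (intro sdist_triangle) auto
  then have 2: "x - R \<le> R + sdist a b" using ab(3) bw by (simp add: sdist_commute)
  show "\<exists>a\<in>U. \<exists>b\<in>V. sdist a b \<le> x \<and> x \<le> sdist a b + 2 * R"
    using ab 1 2 x by (intro bexI[of _ a] bexI[of _ b]) auto
qed

text \<open>A one-point cube has only the distance 0; it is the cube part of the code in which the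
  smallest differences come from changes of letters alone.\<close>

lemma near_empty:
  assumes "0 < d"
  shows "near {} d {..g} g"
proof -
  have "W = {{}}" if "W \<subseteq> Pow {}" "d * 2 ^ card {} \<le> real (card W)" "0 < d" for W :: "'a set set" and d :: real
    using that by (cases "W = {}") auto
  note single = this
  show ?thesis
    unfolding near_def
  proof (intro allI impI ballI)
    fix U V :: "'a set set" and x
    assume "U \<subseteq> Pow {}" "V \<subseteq> Pow {}" "d * 2 ^ card {} \<le> real (card U)"
      "d * 2 ^ card {} \<le> real (card V)" "x \<in> {..g}"
    then have "U = {{}}" "V = {{}}" using single[OF _ _ assms] by blast+
    then show "\<exists>a\<in>U. \<exists>b\<in>V. sdist a b \<le> x \<and> x \<le> sdist a b + g"
      using \<open>x \<in> {..g}\<close> by (simp add: sdist_def)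
  qed
qed

lemma card_subfamily_Un:
  assumes "finite A" "finite B" "A \<inter> B = {}" "U \<subseteq> Pow (A \<union> B)"
  shows "card U = (\<Sum>a\<in>Pow A. card {b \<in> Pow B. a \<union> b \<in> U})"
proof -
  let ?S = "SIGMA a:Pow A. {b \<in> Pow B. a \<union> b \<in> U}"
  have "bij_betw (\<lambda>(a, b). a \<union> b) ?S U"
  proof (rule bij_betw_byWitness[where f' = "\<lambda>u. (u \<inter> A, u \<inter> B)"])
    show "\<forall>p\<in>?S. (\<lambda>u. (u \<inter> A, u \<inter> B)) ((\<lambda>(a, b). a \<union> b) p) = p" using assms(3) by auto
    show "\<forall>u\<in>U. (\<lambda>(a, b). a \<union> b) (u \<inter> A, u \<inter> B) = u" using assms(4) by auto
    show "(\<lambda>(a, b). a \<union> b) ` ?S \<subseteq> U" by auto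
    have "u \<inter> A \<union> u \<inter> B = u" if "u \<in> U" for u using that assms(4) by auto
    then show "(\<lambda>u. (u \<inter> A, u \<inter> B)) ` U \<subseteq> ?S" by auto
  qed
  from bij_betw_same_card[OF this] have "card U = card ?S" by (rule sym)
  also have "\<dots> = (\<Sum>a\<in>Pow A. card {b \<in> Pow B. a \<union> b \<in> U})"
    using assms by (intro card_SigmaI) auto
  finally show ?thesis .
qed

text \<open>Averaging: fibres below \<open>t * M\<close> contribute at most
  \<open>t * M * card S\<close> in total, so the excess \<open>s * M * card S\<close> has to come
  from the dense fibres, each of size at most \<open>M\<close>.\<close>

lemma card_dense_fibres:
  fixes f :: "'a \<Rightarrow> nat" and t M :: real
  assumes "finite S" "\<And>a. a \<in> S \<Longrightarrow> real (f a) \<le> M" "t \<ge> 0" "M > 0"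
    and "(t + s) * M * real (card S) \<le> real (sum f S)"
  shows "s * real (card S) \<le> real (card {a \<in> S. t * M \<le> real (f a)})"
proof -
  let ?G = "{a \<in> S. t * M \<le> real (f a)}"
  have "real (sum f S) = (\<Sum>a\<in>S. real (f a))" by simp
  also have "\<dots> \<le> (\<Sum>a\<in>S. t * M + (if a \<in> ?G then M else 0))"
    using assms by (intro sum_mono) (auto simp: add_increasing)
  also have "\<dots> = t * M * real (card S) + M * real (card ?G)"
  proof -
    have "(\<Sum>a\<in>S. if a \<in> ?G then M else 0) = (\<Sum>a\<in>?G. M)"
      using assms(1) by (intro sum.mono_neutral_cong_right) auto
    then show ?thesis by (simp add: sum.distrib mult.commute)
  qed
  finally have "M * (s * real (card S)) \<le> M * real (card ?G)" using assms(5) by (simp add: algebra_simps)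
  then show ?thesis using assms(4) by simp
qed

text \<open>Refinement: members of \<open>A\<close> with dense fibres realise the target up to
  \<open>g\<close>, and the fibres in \<open>B\<close> then make up the residue up to
  \<open>g'\<close>. Averaging splits \<open>2 * d\<close> into a share \<open>d\<close> of such
  members and a density \<open>d\<close> of their fibres.\<close>

lemma near_Un:
  assumes fin: "finite A" "finite B" "A \<inter> B = {}" and d: "0 < d"
    and A: "near A d X g" and B: "near B d {l..h} g'" and g: "l + g \<le> h"
  shows "near (A \<union> B) (2 * d) ((\<lambda>x. x + l) ` X) g'"
  unfolding near_def
proof (intro allI impI ballI)
  fix U V x
  assume U: "U \<subseteq> Pow (A \<union> B)" "2 * d * 2 ^ card (A \<union> B) \<le> real (card U)"
    and V: "V \<subseteq> Pow (A \<union> B)" "2 * d * 2 ^ card (A \<union> B) \<le> real (card V)"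
    and "x \<in> (\<lambda>x. x + l) ` X"
  then obtain x1 where x: "x1 \<in> X" "x = x1 + l" by auto
  define F where "F W = {a \<in> Pow A. d * 2 ^ card B \<le> real (card {b \<in> Pow B. a \<union> b \<in> W})}" for W
  have F: "F W \<subseteq> Pow A" "d * 2 ^ card A \<le> real (card (F W))"
    if "W \<subseteq> Pow (A \<union> B)" "2 * d * 2 ^ card (A \<union> B) \<le> real (card W)" for W
  proof -
    show "F W \<subseteq> Pow A" by (auto simp: F_def)
    have "d * real (card (Pow A)) \<le> real (card (F W))"
      unfolding F_def
    proof (rule card_dense_fibres)
      fix a assume "a \<in> Pow A"
      have "card {b \<in> Pow B. a \<union> b \<in> W} \<le> card (Pow B)" using fin by (intro card_mono) auto
      then have "real (card {b \<in> Pow B. a \<union> b \<in> W}) \<le> real (card (Pow B))" by (rule of_nat_mono)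
      then show "real (card {b \<in> Pow B. a \<union> b \<in> W}) \<le> 2 ^ card B" using fin by (simp add: card_Pow)
    next
      have "card (A \<union> B) = card A + card B" using fin by (simp add: card_Un_disjoint)
      then have "(d + d) * 2 ^ card B * real (card (Pow A)) = 2 * d * 2 ^ card (A \<union> B)"
        using fin(1) by (simp add: card_Pow power_add)
      then show "(d + d) * 2 ^ card B * real (card (Pow A))
          \<le> real (\<Sum>a\<in>Pow A. card {b \<in> Pow B. a \<union> b \<in> W})"
        unfolding card_subfamily_Un[OF fin that(1), symmetric] using that(2) by linarith
    qed (use fin d in auto)
    then show "d * 2 ^ card A \<le> real (card (F W))" using fin by (simp add: card_Pow)
  qed
  obtain a a' where a: "a \<in> F U" "a' \<in> F V" "sdist a a' \<le> x1" "x1 \<le> sdist a a' + g"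
    using nearD[OF A F(1)[OF U] F(1)[OF V] F(2)[OF U] F(2)[OF V] x(1)] by blast
  \<comment> \<open>The shift by \<open>l\<close> puts this residue between \<open>l\<close> and
    \<open>l + g\<close>, within the range of \<open>B\<close>.\<close>
  define y where "y = x - sdist a a'"
  have y: "y \<in> {l..h}" using a x g by (auto simp: y_def)
  have "{b \<in> Pow B. a \<union> b \<in> U} \<subseteq> Pow B" "{b \<in> Pow B. a' \<union> b \<in> V} \<subseteq> Pow B"
    "d * 2 ^ card B \<le> real (card {b \<in> Pow B. a \<union> b \<in> U})"
    "d * 2 ^ card B \<le> real (card {b \<in> Pow B. a' \<union> b \<in> V})"
    using a by (auto simp: F_def)
  from nearD[OF B this y] obtain b b' where b: "b \<subseteq> B" "b' \<subseteq> B" "a \<union> b \<in> U" "a' \<union> b' \<in> V"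
    "sdist b b' \<le> y" "y \<le> sdist b b' + g'"
    by auto
  have "sdist (a \<union> b) (a' \<union> b') = sdist a a' + sdist b b'"
    using a b fin by (intro sdist_Un) (auto simp: F_def)
  moreover have "sdist a a' \<le> x" using a x by simp
  ultimately have "sdist (a \<union> b) (a' \<union> b') \<le> x \<and> x \<le> sdist (a \<union> b) (a' \<union> b') + g'"
    using b(5,6) unfolding y_def by linarith
  then show "\<exists>a\<in>U. \<exists>b\<in>V. sdist a b \<le> x \<and> x \<le> sdist a b + g'"
    using b(3,4) by blast
qed

section \<open>Parity of Hamming distances of ternary words\<close>

definition ham :: "'i set \<Rightarrow> ('i \<Rightarrow> nat) \<Rightarrow> ('i \<Rightarrow> nat) \<Rightarrow> nat" where
  "ham I f h = card {i \<in> I. f i \<noteq> h i}"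

lemma ham_insert:
  assumes "finite I" "i \<notin> I"
  shows "ham (insert i I) (f(i := c)) (h(i := d)) = ham I f h + (if c = d then 0 else 1)"
proof -
  have "{j \<in> insert i I. (f(i := c)) j \<noteq> (h(i := d)) j}
      = {j \<in> I. f j \<noteq> h j} \<union> (if c = d then {} else {i})"
    using assms(2) by auto
  then show ?thesis using assms by (auto simp: ham_def)
qed

lemma sum_PiE_insert:
  assumes "i \<notin> I"
  shows "(\<Sum>f\<in>PiE (insert i I) (\<lambda>_. S). F f) = (\<Sum>c\<in>S. \<Sum>f\<in>PiE I (\<lambda>_. S). F (f(i := c)))"
proof -
  have "(\<Sum>f\<in>PiE (insert i I) (\<lambda>_. S). F f)
      = (\<Sum>p\<in>S \<times> PiE I (\<lambda>_. S). F ((\<lambda>(y, g). g(i := y)) p))"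
    unfolding PiE_insert_eq by (rule sum.reindex[OF inj_combinator[OF assms], unfolded o_def])
  also have "\<dots> = (\<Sum>c\<in>S. \<Sum>f\<in>PiE I (\<lambda>_. S). F (f(i := c)))"
    by (simp add: sum.cartesian_product split_def)
  finally show ?thesis .
qed

text \<open>Cauchy-Schwarz for \<open>(sqrt a, sqrt a')\<close> and
  \<open>(sqrt b, sqrt b')\<close>.\<close>

lemma square_add_le:
  fixes x y a b a' b' :: real
  assumes "x\<^sup>2 \<le> a * b" "y\<^sup>2 \<le> a' * b'" "a \<ge> 0" "b \<ge> 0" "a' \<ge> 0" "b' \<ge> 0"
  shows "(x + y)\<^sup>2 \<le> (a + a') * (b + b')"
proof -
  have "(2 * (x * y))\<^sup>2 = 4 * (x\<^sup>2 * y\<^sup>2)" by (simp add: power_mult_distrib)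
  also have "\<dots> \<le> 4 * ((a * b) * (a' * b'))"
    using assms by (intro mult_left_mono mult_mono) auto
  also have "\<dots> \<le> (a * b' + a' * b)\<^sup>2"
  proof -
    have "0 \<le> (a * b' - a' * b)\<^sup>2" by simp
    then show ?thesis by (simp add: power2_eq_square algebra_simps)
  qed
  finally have "2 * (x * y) \<le> a * b' + a' * b"
    using assms by (intro power2_le_imp_le[of "2 * (x * y)"] add_nonneg_nonneg mult_nonneg_nonneg)
  then show ?thesis using assms by (simp add: power2_eq_square algebra_simps)
qed

text \<open>For one ternary letter the signs form the matrix \<open>2 I - J\<close> with
  \<open>J\<close> all ones, of eigenvalues 2, 2, -1 and norm 2. Several letters give its tensor
  power, of norm \<open>2 ^ card I\<close>; the induction splits off one letter. Over a binary
  alphabet the norm would equal the alphabet size and nothing would be gained.\<close>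

lemma parity_form_bound:
  fixes u v :: "('i \<Rightarrow> nat) \<Rightarrow> real"
  assumes "finite I"
  shows "(\<Sum>f\<in>PiE I (\<lambda>_. {..<3}). \<Sum>h\<in>PiE I (\<lambda>_. {..<3}). u f * v h * (- 1) ^ ham I f h)\<^sup>2
    \<le> 4 ^ card I * ((\<Sum>f\<in>PiE I (\<lambda>_. {..<3}). (u f)\<^sup>2) * (\<Sum>f\<in>PiE I (\<lambda>_. {..<3}). (v f)\<^sup>2))"
  using assms
proof (induction I arbitrary: u v rule: finite_induct)
  case empty
  show ?case by (simp add: ham_def power_mult_distrib)
next
  case (insert i I)
  let ?S = "{..<3::nat}"
  let ?P = "PiE I (\<lambda>_. ?S)"
  define Q where "Q u v = (\<Sum>f\<in>?P. \<Sum>h\<in>?P. u f * v h * (- 1) ^ ham I f h)" for u v :: "('i \<Rightarrow> nat) \<Rightarrow> real"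
  define L where "L u = (\<Sum>f\<in>?P. (u f)\<^sup>2)" for u :: "('i \<Rightarrow> nat) \<Rightarrow> real"
  have IH: "(Q u v)\<^sup>2 \<le> 4 ^ card I * L u * L v" for u v
    using insert.IH by (simp add: Q_def L_def mult.assoc)
  have L0: "L u \<ge> 0" for u by (auto simp: L_def intro: sum_nonneg)
  define p where "p c f = u (f(i := c))" for c f
  define q where "q c f = v (f(i := c))" for c f
  \<comment> \<open>Row \<open>c\<close> of \<open>2 I - J\<close> applied to the slices
    \<open>q\<close>.\<close>
  define s where "s c f = 2 * q c f - (q 0 f + q 1 f + q 2 f)" for c f
  have three: "?S = {0, 1, 2}" by auto
  have Qlin: "Q u (\<lambda>f. 2 * v1 f - (v2 f + v3 f + v4 f)) = 2 * Q u v1 - (Q u v2 + Q u v3 + Q u v4)"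
    for u v1 v2 v3 v4
    unfolding Q_def sum_distrib_left sum.distrib[symmetric] sum_subtractf[symmetric]
    by (intro sum.cong refl) (simp add: algebra_simps)
  have Qs: "Q u (s c) = 2 * Q u (q c) - (Q u (q 0) + Q u (q 1) + Q u (q 2))" for u c
  proof -
    have "s c = (\<lambda>f. 2 * q c f - (q 0 f + q 1 f + q 2 f))" by (simp add: s_def fun_eq_iff)
    then show ?thesis by (simp only: Qlin)
  qed
  have "(\<Sum>f\<in>PiE (insert i I) (\<lambda>_. ?S). \<Sum>h\<in>PiE (insert i I) (\<lambda>_. ?S).
        u f * v h * (- 1) ^ ham (insert i I) f h)
      = (\<Sum>c\<in>?S. \<Sum>f\<in>?P. \<Sum>d\<in>?S. \<Sum>h\<in>?P. p c f * q d h * ((- 1) ^ ham I f h * (if c = d then 1 else -1)))"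
    unfolding sum_PiE_insert[OF insert(2)] ham_insert[OF insert(1,2)] p_def q_def
    by (intro sum.cong refl) auto
  also have "\<dots> = (\<Sum>c\<in>?S. \<Sum>d\<in>?S. (if c = d then 1 else -1) * Q (p c) (q d))"
    unfolding Q_def by (subst sum.swap) (simp add: sum_distrib_left algebra_simps)
  also have "\<dots> = Q (p 0) (s 0) + Q (p 1) (s 1) + Q (p 2) (s 2)"
    by (simp add: three Qs)
  finally have eq: "(\<Sum>f\<in>PiE (insert i I) (\<lambda>_. ?S). \<Sum>h\<in>PiE (insert i I) (\<lambda>_. ?S).
        u f * v h * (- 1) ^ ham (insert i I) f h) = Q (p 0) (s 0) + Q (p 1) (s 1) + Q (p 2) (s 2)" .
  have "(Q (p 0) (s 0) + Q (p 1) (s 1) + Q (p 2) (s 2))\<^sup>2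
      \<le> (4 ^ card I * L (p 0) + 4 ^ card I * L (p 1) + 4 ^ card I * L (p 2)) * (L (s 0) + L (s 1) + L (s 2))"
    using L0 IH by (intro square_add_le) auto
  also have "\<dots> \<le> (4 ^ card I * L (p 0) + 4 ^ card I * L (p 1) + 4 ^ card I * L (p 2)) * (4 * (L (q 0) + L (q 1) + L (q 2)))"
  proof (rule mult_left_mono)
    have "L (s 0) + L (s 1) + L (s 2) = (\<Sum>f\<in>?P. (s 0 f)\<^sup>2 + (s 1 f)\<^sup>2 + (s 2 f)\<^sup>2)"
      by (simp add: L_def sum.distrib)
    also have "\<dots> \<le> (\<Sum>f\<in>?P. 4 * ((q 0 f)\<^sup>2 + (q 1 f)\<^sup>2 + (q 2 f)\<^sup>2))"
    proof (rule sum_mono)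
      \<comment> \<open>The two sides differ by exactly the square of
        \<open>q 0 f + q 1 f + q 2 f\<close>.\<close>
      fix f
      have "0 \<le> (q 0 f + q 1 f + q 2 f)\<^sup>2" by simp
      then show "(s 0 f)\<^sup>2 + (s 1 f)\<^sup>2 + (s 2 f)\<^sup>2 \<le> 4 * ((q 0 f)\<^sup>2 + (q 1 f)\<^sup>2 + (q 2 f)\<^sup>2)"
        by (simp add: s_def power2_eq_square algebra_simps)
    qed
    also have "\<dots> = 4 * (L (q 0) + L (q 1) + L (q 2))"
      by (simp add: L_def sum.distrib sum_distrib_left)
    finally show "L (s 0) + L (s 1) + L (s 2) \<le> 4 * (L (q 0) + L (q 1) + L (q 2))" .
  qed (auto intro!: add_nonneg_nonneg mult_nonneg_nonneg L0)
  also have "\<dots> = 4 ^ card (insert i I) * ((L (p 0) + L (p 1) + L (p 2)) * (L (q 0) + L (q 1) + L (q 2)))"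
    using insert by (simp add: algebra_simps)
  also have "L (p 0) + L (p 1) + L (p 2) = (\<Sum>f\<in>PiE (insert i I) (\<lambda>_. ?S). (u f)\<^sup>2)"
    unfolding sum_PiE_insert[OF insert(2)] three by (simp add: L_def p_def three add.assoc)
  also have "L (q 0) + L (q 1) + L (q 2) = (\<Sum>f\<in>PiE (insert i I) (\<lambda>_. ?S). (v f)\<^sup>2)"
    unfolding sum_PiE_insert[OF insert(2)] three by (simp add: L_def q_def three add.assoc)
  finally show ?case unfolding eq .
qed

text \<open>If one parity never occurred, the sign form on the indicators of \<open>X\<close> and
  \<open>Y\<close> would be \<open>card X * card Y\<close> up to sign, and the norm bound would give
  \<open>card X * card Y \<le> 4 ^ card I\<close>. So density above \<open>(2/3) ^ card I\<close> is
  enough for both families.\<close>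

lemma both_parities:
  assumes "finite I" "X \<subseteq> PiE I (\<lambda>_. {..<3})" "Y \<subseteq> PiE I (\<lambda>_. {..<3})"
    and "2 ^ card I < card X" "2 ^ card I < card Y"
  shows "\<exists>f\<in>X. \<exists>h\<in>Y. even (ham I f h + q)"
proof (rule ccontr)
  assume neg: "\<not> ?thesis"
  let ?P = "PiE I (\<lambda>_. {..<3::nat})"
  have fin: "finite ?P" using assms(1) by (intro finite_PiE) auto
  define u where "u f = (if f \<in> X then 1 else 0 :: real)" for f
  define v where "v f = (if f \<in> Y then 1 else 0 :: real)" for f
  have su: "(\<Sum>f\<in>?P. u f) = real (card X)" "(\<Sum>f\<in>?P. v f) = real (card Y)"
    using fin assms(2,3) by (simp_all add: u_def v_def Int_absorb1 sum.If_cases)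
  have sq: "(u f)\<^sup>2 = u f" "(v f)\<^sup>2 = v f" for f by (auto simp: u_def v_def)
  \<comment> \<open>Failure means that on \<open>X\<close> and \<open>Y\<close> every sign is
    opposite to that of \<open>q\<close>.\<close>
  have "(\<Sum>f\<in>?P. \<Sum>h\<in>?P. u f * v h * (- 1) ^ ham I f h)
      = (\<Sum>f\<in>?P. \<Sum>h\<in>?P. u f * v h * (- 1) ^ Suc q)"
    using neg by (intro sum.cong refl) (auto simp: u_def v_def minus_one_power_iff)
  also have "\<dots> = real (card X) * real (card Y) * (- 1) ^ Suc q"
    unfolding su[symmetric] by (subst sum_product) (simp only: sum_distrib_right)
  finally have "(real (card X) * real (card Y) * (- 1) ^ Suc q)\<^sup>2 \<le> 4 ^ card I * (real (card X) * real (card Y))"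
    using parity_form_bound[OF assms(1), of u v] by (simp add: sq su)
  then have "(real (card X) * real (card Y)) * (real (card X) * real (card Y))
      \<le> 4 ^ card I * (real (card X) * real (card Y))"
    by (simp add: power_mult_distrib power2_eq_square minus_one_power_iff algebra_simps split: if_splits)
  moreover have "real (card X) * real (card Y) > 0" using assms(4,5) by simp
  ultimately have "real (card X) * real (card Y) \<le> 4 ^ card I" by (simp add: mult_le_cancel_right)
  moreover have "2 ^ card I * 2 ^ card I < card X * card Y" using assms(4,5) by (intro mult_strict_mono) auto
  then have "4 ^ card I < real (card X * card Y)"
    by (metis (mono_tags) of_nat_less_iff of_nat_numeral of_nat_power power_mult_distrib[of 2 2] mult_2 numeral_Bit0 one_add_one)
  ultimately show False by simp
qed

section \<open>Blocks with a common content\<close>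

lemma sum_Pow_Un:
  fixes F :: "'a set \<Rightarrow> 'b::comm_monoid_add"
  assumes "A \<inter> B = {}"
  shows "(\<Sum>u\<in>Pow (A \<union> B). F u) = (\<Sum>a\<in>Pow A. \<Sum>b\<in>Pow B. F (a \<union> b))"
proof -
  have "bij_betw (\<lambda>(a, b). a \<union> b) (Pow A \<times> Pow B) (Pow (A \<union> B))"
  proof (rule bij_betw_byWitness[where f' = "\<lambda>u. (u \<inter> A, u \<inter> B)"])
    show "\<forall>p\<in>Pow A \<times> Pow B. (\<lambda>u. (u \<inter> A, u \<inter> B)) ((\<lambda>(a, b). a \<union> b) p) = p" using assms by auto
  qed auto
  from sum.reindex_bij_betw[OF this, of F] show ?thesis
    by (simp add: sum.cartesian_product split_def)
qed

text \<open>The traces of a uniform subset of \<open>K\<close> on disjoint blocks are independent,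
  so the mean of the product factors.\<close>

lemma sum_prod_blocks:
  fixes \<phi> :: "nat \<Rightarrow> 'a set \<Rightarrow> real"
  assumes "finite K" "disjoint_family_on B {..<M}" "\<And>t. t < M \<Longrightarrow> B t \<subseteq> K"
  shows "(\<Sum>a\<in>Pow K. \<Prod>t<M. \<phi> t (a \<inter> B t))
    = 2 ^ card K * (\<Prod>t<M. (\<Sum>c\<in>Pow (B t). \<phi> t c) / 2 ^ card (B t))"
  using assms
proof (induction M arbitrary: K)
  case 0
  then show ?case by (simp add: card_Pow)
next
  case (Suc M)
  let ?A = "K - B M"
  have BK: "B M \<subseteq> K" using Suc.prems by simp
  have K: "K = ?A \<union> B M" using BK by auto
  have dis: "B t \<inter> B M = {}" if "t < M" for t
    using Suc.prems(2) that by (auto simp: disjoint_family_on_def)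
  have BA: "B t \<subseteq> ?A" if "t < M" for t using Suc.prems(3)[of t] dis[of t] that by auto
  have "(\<Sum>a\<in>Pow K. \<Prod>t<Suc M. \<phi> t (a \<inter> B t))
      = (\<Sum>a\<in>Pow ?A. \<Sum>b\<in>Pow (B M). \<Prod>t<Suc M. \<phi> t ((a \<union> b) \<inter> B t))"
    by (subst K, rule sum_Pow_Un) auto
  also have "\<dots> = (\<Sum>a\<in>Pow ?A. \<Sum>b\<in>Pow (B M). (\<Prod>t<M. \<phi> t (a \<inter> B t)) * \<phi> M b)"
  proof (intro sum.cong refl)
    fix a b assume ab: "a \<in> Pow ?A" "b \<in> Pow (B M)"
    have "(a \<union> b) \<inter> B t = a \<inter> B t" if "t < M" for t using ab dis[OF that] by auto
    moreover have "(a \<union> b) \<inter> B M = b" using ab by auto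
    ultimately show "(\<Prod>t<Suc M. \<phi> t ((a \<union> b) \<inter> B t)) = (\<Prod>t<M. \<phi> t (a \<inter> B t)) * \<phi> M b" by simp
  qed
  also have "\<dots> = (\<Sum>a\<in>Pow ?A. \<Prod>t<M. \<phi> t (a \<inter> B t)) * (\<Sum>c\<in>Pow (B M). \<phi> M c)"
    by (simp add: sum_product)
  also have "(\<Sum>a\<in>Pow ?A. \<Prod>t<M. \<phi> t (a \<inter> B t))
      = 2 ^ card ?A * (\<Prod>t<M. (\<Sum>c\<in>Pow (B t). \<phi> t c) / 2 ^ card (B t))"
    using Suc.prems BA by (intro Suc.IH) (auto simp: disjoint_family_on_def)
  also have "(2::real) ^ card K = 2 ^ card ?A * 2 ^ card (B M)"
  proof -
    have "card K = card ?A + card (B M)"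
      using Suc.prems(1) BK by (metis card_Diff_subset card_mono finite_subset le_add_diff_inverse2)
    then show ?thesis by (simp add: power_add)
  qed
  then have "2 ^ card ?A * (\<Prod>t<M. (\<Sum>c\<in>Pow (B t). \<phi> t c) / 2 ^ card (B t)) * (\<Sum>c\<in>Pow (B M). \<phi> M c)
      = 2 ^ card K * (\<Prod>t<Suc M. (\<Sum>c\<in>Pow (B t). \<phi> t c) / 2 ^ card (B t))"
    by simp
  finally show ?case .
qed

lemma ln_two_le: "ln (2::real) \<le> 7 / 10"
proof -
  have "(2::real) \<le> (1 + (7/10) / real 40) ^ 40" by (simp add: eval_nat_numeral)
  also have "\<dots> \<le> exp (7/10)" by (rule exp_ge_one_plus_x_over_n_power_n) auto
  finally show ?thesis by (metis ln_exp ln_le_cancel_iff exp_gt_zero zero_less_numeral)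
qed

text \<open>A content is bad when its fibre in \<open>U\<close> is below half the average. The
  number of blocks with bad content has mean \<open>S\<close>, the sum of the
  \<open>\<beta> t\<close>, over the cube, but at most \<open>S / 2\<close> over \<open>U\<close>.
  Compare the means of 2 to the power minus this number: over the cube independence gives at most
  \<open>exp (- S / 2)\<close>, over \<open>U\<close> convexity gives at least
  \<open>exp (- ln 2 * S / 2)\<close>. The ratio of the two limits the density of
  \<open>U\<close>.\<close>

lemma sparse_contents_sum:
  fixes B :: "nat \<Rightarrow> 'a set"
  assumes fin: "finite K" and dis: "disjoint_family_on B {..<M}" and BK: "\<And>t. t < M \<Longrightarrow> B t \<subseteq> K"
    and U: "U \<subseteq> Pow K" "0 < card U"
    and bad: "\<And>t. bad t = {c \<in> Pow (B t). real (card {a \<in> U. a \<inter> B t = c}) < real (card U) / (2 * 2 ^ card (B t))}"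
  shows "(\<Sum>t<M. real (card (bad t)) / 2 ^ card (B t)) * (3 / 20) \<le> ln (2 ^ card K / real (card U))"
proof -
  define \<beta> where "\<beta> t = real (card (bad t)) / 2 ^ card (B t)" for t
  \<comment> \<open>A factor \<open>1 / 2\<close> for every bad content makes the product over the
    blocks equal to \<open>(1 / 2) ^ k a\<close>.\<close>
  define \<phi> where "\<phi> t c = (if c \<in> bad t then 1 / 2 else 1 :: real)" for t c
  define k where "k a = card {t \<in> {..<M}. a \<inter> B t \<in> bad t}" for a
  define S where "S = (\<Sum>t<M. \<beta> t)"
  have finB: "finite (B t)" if "t < M" for t using BK[OF that] fin finite_subset by blast
  have finU: "finite U" using U(2) card_gt_0_iff by blast
  have finbad: "finite (bad t)" if "t < M" for t using finB[OF that] by (simp add: bad)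
  have avg: "(\<Sum>c\<in>Pow (B t). \<phi> t c) / 2 ^ card (B t) = 1 - \<beta> t / 2" if "t < M" for t
  proof -
    have "(\<Sum>c\<in>Pow (B t). \<phi> t c) = (\<Sum>c\<in>Pow (B t). 1 - (if c \<in> bad t then 1 / 2 else 0))"
      by (intro sum.cong) (auto simp: \<phi>_def)
    also have "\<dots> = 2 ^ card (B t) - (\<Sum>c\<in>Pow (B t). if c \<in> bad t then 1 / 2 else 0)"
      using finB[OF that] by (simp add: sum_subtractf card_Pow)
    also have "(\<Sum>c\<in>Pow (B t). if c \<in> bad t then 1 / 2 else 0) = (\<Sum>c\<in>bad t. 1 / 2 :: real)"
      using finB[OF that] by (intro sum.mono_neutral_cong_right) (auto simp: bad)
    finally show ?thesis by (simp add: \<beta>_def field_simps)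
  qed
  have prod: "(\<Prod>t<M. \<phi> t (a \<inter> B t)) = exp (- (ln 2 * real (k a)))" for a
  proof -
    have "(\<Prod>t<M. \<phi> t (a \<inter> B t)) = (\<Prod>t<M. if a \<inter> B t \<in> bad t then 1 / 2 else 1)"
      by (simp add: \<phi>_def)
    also have "\<dots> = (1 / 2) ^ k a"
      by (simp add: prod.If_cases k_def Int_def)
    also have "\<dots> = exp (- (ln 2 * real (k a)))"
      by (simp add: exp_minus exp_of_nat2_mult power_one_over inverse_eq_divide)
    finally show ?thesis .
  qed
  have ksum: "(\<Sum>a\<in>U. real (k a)) \<le> real (card U) * S / 2"
  proof -
    have "(\<Sum>a\<in>U. real (k a)) = (\<Sum>a\<in>U. \<Sum>t<M. if a \<inter> B t \<in> bad t then 1 else 0)"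
      by (simp add: k_def sum.If_cases Int_def)
    also have "\<dots> = (\<Sum>t<M. \<Sum>a\<in>U. if a \<inter> B t \<in> bad t then 1 else 0)" by (rule sum.swap)
    also have "\<dots> \<le> (\<Sum>t<M. real (card U) * \<beta> t / 2)"
    proof (rule sum_mono)
      fix t assume "t \<in> {..<M}"
      then have t: "t < M" by simp
      have "(\<Sum>a\<in>U. if a \<inter> B t \<in> bad t then 1 else 0 :: real) = real (card {a \<in> U. a \<inter> B t \<in> bad t})"
        using finU by (simp add: sum.If_cases Int_def)
      also have "{a \<in> U. a \<inter> B t \<in> bad t} = (\<Union>c\<in>bad t. {a \<in> U. a \<inter> B t = c})" by auto
      also have "real (card \<dots>) \<le> real (\<Sum>c\<in>bad t. card {a \<in> U. a \<inter> B t = c})"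
        by (intro of_nat_mono card_UN_le finbad[OF t])
      also have "\<dots> = (\<Sum>c\<in>bad t. real (card {a \<in> U. a \<inter> B t = c}))" by (rule of_nat_sum)
      also have "\<dots> \<le> (\<Sum>c\<in>bad t. real (card U) / (2 * 2 ^ card (B t)))"
        by (intro sum_mono) (auto simp: bad)
      also have "\<dots> = real (card U) * \<beta> t / 2" by (simp add: \<beta>_def field_simps)
      finally show "(\<Sum>a\<in>U. if a \<inter> B t \<in> bad t then 1 else 0 :: real) \<le> real (card U) * \<beta> t / 2" .
    qed
    also have "\<dots> = real (card U) * S / 2"
      by (simp add: S_def sum_distrib_left sum_divide_distrib)
    finally show ?thesis .
  qed
  define m where "m = - (ln 2 * S / 2)"
  \<comment> \<open>Jensen's inequality, through the tangent of \<open>exp\<close> at \<open>m\<close>.\<close>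
  have "real (card U) * exp m \<le> (\<Sum>a\<in>U. exp m * (1 + (- (ln 2 * real (k a)) - m)))"
  proof -
    have "(\<Sum>a\<in>U. exp m * (1 + (- (ln 2 * real (k a)) - m)))
        = exp m * (\<Sum>a\<in>U. (1 - m) - ln 2 * real (k a))"
      unfolding sum_distrib_left by (intro sum.cong refl) (simp add: algebra_simps)
    also have "(\<Sum>a\<in>U. (1 - m) - ln 2 * real (k a)) = real (card U) * (1 - m) - ln 2 * (\<Sum>a\<in>U. real (k a))"
      unfolding sum_subtractf sum_distrib_left[symmetric] by (simp add: algebra_simps)
    finally have eq: "(\<Sum>a\<in>U. exp m * (1 + (- (ln 2 * real (k a)) - m)))
        = exp m * (real (card U) * (1 - m) - ln 2 * (\<Sum>a\<in>U. real (k a)))" .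
    have "real (card U) = real (card U) * (1 - m) - ln 2 * (real (card U) * S / 2)"
      by (simp add: m_def algebra_simps)
    also have "\<dots> \<le> real (card U) * (1 - m) - ln 2 * (\<Sum>a\<in>U. real (k a))"
      using ksum by (intro mult_left_mono diff_left_mono) auto
    finally show ?thesis unfolding eq by (subst mult.commute) (rule mult_left_mono, auto)
  qed
  also have "\<dots> \<le> (\<Sum>a\<in>U. exp (- (ln 2 * real (k a))))"
  proof (rule sum_mono)
    fix a
    have "exp m * (1 + (- (ln 2 * real (k a)) - m)) \<le> exp m * exp (- (ln 2 * real (k a)) - m)"
      by (intro mult_left_mono exp_ge_add_one_self) auto
    then show "exp m * (1 + (- (ln 2 * real (k a)) - m)) \<le> exp (- (ln 2 * real (k a)))"
      by (simp flip: exp_add)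
  qed
  \<comment> \<open>Passing from \<open>U\<close> to the whole cube, where the blocks are
    independent, is the step that costs the density of \<open>U\<close>.\<close>
  also have "\<dots> \<le> (\<Sum>a\<in>Pow K. exp (- (ln 2 * real (k a))))"
    using U(1) fin by (intro sum_mono2) auto
  also have "\<dots> = 2 ^ card K * (\<Prod>t<M. (\<Sum>c\<in>Pow (B t). \<phi> t c) / 2 ^ card (B t))"
    unfolding prod[symmetric] by (rule sum_prod_blocks[OF fin dis BK])
  also have "(\<Prod>t<M. (\<Sum>c\<in>Pow (B t). \<phi> t c) / 2 ^ card (B t)) = (\<Prod>t<M. 1 - \<beta> t / 2)"
    by (intro prod.cong) (auto simp: avg)
  also have "2 ^ card K * \<dots> \<le> 2 ^ card K * (\<Prod>t<M. exp (- (\<beta> t / 2)))"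
  proof (intro mult_left_mono prod_mono conjI)
    fix t assume "t \<in> {..<M}"
    then have t: "t < M" by simp
    have "real (card (bad t)) \<le> real (card (Pow (B t)))"
      using finB[OF t] by (intro of_nat_mono card_mono) (auto simp: bad)
    then have "real (card (bad t)) \<le> 2 ^ card (B t)" using finB[OF t] by (simp add: card_Pow)
    then have "\<beta> t \<le> 1" by (simp add: \<beta>_def)
    then show "0 \<le> 1 - \<beta> t / 2" by simp
    show "1 - \<beta> t / 2 \<le> exp (- (\<beta> t / 2))" using exp_ge_add_one_self[of "- (\<beta> t / 2)"] by simp
  qed auto
  also have "(\<Prod>t<M. exp (- (\<beta> t / 2))) = exp (- (S / 2))"
    by (simp add: S_def sum_negf sum_divide_distrib flip: exp_sum)
  finally have "real (card U) * exp m \<le> 2 ^ card K * exp (- (S / 2))" .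
  then have "exp (S / 2) * exp m * real (card U) \<le> 2 ^ card K"
    by (simp add: exp_minus field_simps)
  then have "exp (S / 2 + m) \<le> 2 ^ card K / real (card U)"
    using U(2) by (subst pos_le_divide_eq) (simp_all add: exp_add)
  then have "S / 2 + m \<le> ln (2 ^ card K / real (card U))"
    using U(2) by (simp add: ln_ge_iff)
  \<comment> \<open>\<open>S / 2 + m = S * (1 - ln 2) / 2\<close>, and
    \<open>(1 - 7 / 10) / 2 = 3 / 20\<close>.\<close>
  moreover have "S * (3 / 20) \<le> S / 2 + m"
  proof -
    have "S \<ge> 0" by (auto simp: S_def \<beta>_def intro!: sum_nonneg)
    then have "ln 2 * S \<le> 7 / 10 * S" using ln_two_le by (intro mult_right_mono)
    then show ?thesis unfolding m_def by linarith
  qed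
  ultimately show ?thesis by (simp add: S_def \<beta>_def)
qed

text \<open>If no content of a block suits both families, the contents bad for \<open>U\<close> and
  those bad for \<open>V\<close> cover all contents, so their shares add up to at least 1. Failure
  in all blocks thus bounds \<open>M\<close> by \<open>2 * (20 / 3) * ln (1 / d)\<close>, and
  \<open>40 / 3 < 14\<close>.\<close>

lemma common_content:
  fixes B :: "nat \<Rightarrow> 'a set"
  assumes fin: "finite K" and dis: "disjoint_family_on B {..<M}" and BK: "\<And>t. t < M \<Longrightarrow> B t \<subseteq> K"
    and d: "0 < d" and M: "14 * ln (1 / d) < real M"
    and U: "U \<subseteq> Pow K" "d * 2 ^ card K \<le> real (card U)"
    and V: "V \<subseteq> Pow K" "d * 2 ^ card K \<le> real (card V)"
  shows "\<exists>t<M. \<exists>c\<subseteq>B t. real (card U) / (2 * 2 ^ card (B t)) \<le> real (card {a \<in> U. a \<inter> B t = c})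
    \<and> real (card V) / (2 * 2 ^ card (B t)) \<le> real (card {a \<in> V. a \<inter> B t = c})"
proof (rule ccontr)
  assume neg: "\<not> ?thesis"
  define bad where "bad W t = {c \<in> Pow (B t). real (card {a \<in> W. a \<inter> B t = c}) < real (card W) / (2 * 2 ^ card (B t))}"
    for W :: "'a set set" and t
  have pos: "0 < d * 2 ^ card K" using d by simp
  have bound: "(\<Sum>t<M. real (card (bad W t)) / 2 ^ card (B t)) * (3 / 20) \<le> ln (1 / d)"
    if W: "W \<subseteq> Pow K" "d * 2 ^ card K \<le> real (card W)" for W
  proof -
    have c: "0 < card W" using W(2) pos by (metis le_less_trans not_gr_zero of_nat_0 less_le_not_le)
    have "2 ^ card K / real (card W) \<le> 1 / d"
      using W(2) c d by (simp add: field_simps)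
    then have "ln (2 ^ card K / real (card W)) \<le> ln (1 / d)"
      using c d by simp
    then show ?thesis
      using sparse_contents_sum[OF fin dis BK W(1) c, of "bad W"] by (simp add: bad_def)
  qed
  have "real M = (\<Sum>t<M. 1)" by simp
  also have "\<dots> \<le> (\<Sum>t<M. real (card (bad U t)) / 2 ^ card (B t) + real (card (bad V t)) / 2 ^ card (B t))"
  proof (rule sum_mono)
    fix t assume "t \<in> {..<M}"
    then have t: "t < M" by simp
    have finB: "finite (B t)" using BK[OF t] fin finite_subset by blast
    have "Pow (B t) \<subseteq> bad U t \<union> bad V t"
    proof
      fix c assume c: "c \<in> Pow (B t)"
      show "c \<in> bad U t \<union> bad V t"
      proof (rule ccontr)
        assume "c \<notin> bad U t \<union> bad V t"
        then have "real (card U) / (2 * 2 ^ card (B t)) \<le> real (card {a \<in> U. a \<inter> B t = c})"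
          "real (card V) / (2 * 2 ^ card (B t)) \<le> real (card {a \<in> V. a \<inter> B t = c})"
          using c by (auto simp only: bad_def mem_Collect_eq Un_iff not_less de_Morgan_disj de_Morgan_conj)
        then show False using neg t c by blast
      qed
    qed
    then have "card (Pow (B t)) \<le> card (bad U t \<union> bad V t)"
      using finB by (intro card_mono) (auto simp: bad_def)
    also have "\<dots> \<le> card (bad U t) + card (bad V t)" by (rule card_Un_le)
    finally have "2 ^ card (B t) \<le> card (bad U t) + card (bad V t)" using finB by (simp add: card_Pow)
    then have "(2::real) ^ card (B t) \<le> real (card (bad U t) + card (bad V t))"
      by (metis of_nat_mono of_nat_numeral of_nat_power)
    then show "1 \<le> real (card (bad U t)) / 2 ^ card (B t) + real (card (bad V t)) / 2 ^ card (B t)"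
      by (simp flip: add_divide_distrib)
  qed
  finally have "real M * (3 / 20) \<le> 2 * ln (1 / d)"
    using bound[OF U] bound[OF V] by (simp add: sum.distrib)
  \<comment> \<open>Nonnegativity of the logarithm permits rounding \<open>40 / 3\<close> up to
    14.\<close>
  moreover have "0 \<le> ln (1 / d)" using bound[OF U] sum_nonneg[of "{..<M}" "\<lambda>t. real (card (bad U t)) / 2 ^ card (B t)"]
    by (smt (verit) divide_nonneg_nonneg of_nat_0_le_iff zero_le_power mult_nonneg_nonneg)
  ultimately show False using M by simp
qed

section \<open>Moves inside a family of the cube\<close>

lemma disjoint_subsets_of_size:
  assumes "finite B" "N * r \<le> card B"
  obtains E where "\<And>e. e < N \<Longrightarrow> E e \<subseteq> B \<and> card (E e) = r" "disjoint_family_on E {..<N}"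
proof -
  obtain h where h: "bij_betw h {0..<card B} B" using ex_bij_betw_nat_finite[OF assms(1)] by blast
  have sub: "{e * r..<e * r + r} \<subseteq> {0..<card B}" if "e < N" for e
  proof -
    have "Suc e * r \<le> N * r" using that by (intro mult_right_mono) auto
    then show ?thesis using assms(2) by auto
  qed
  have inj: "inj_on h {0..<card B}" using h by (simp add: bij_betw_def)
  show thesis
  proof
    fix e assume e: "e < N"
    have "h ` {e * r..<e * r + r} \<subseteq> B" using h sub[OF e] by (auto simp: bij_betw_def)
    moreover have "card (h ` {e * r..<e * r + r}) = r"
      using card_image[OF inj_on_subset[OF inj sub[OF e]]] by simp
    ultimately show "h ` {e * r..<e * r + r} \<subseteq> B \<and> card (h ` {e * r..<e * r + r}) = r" by simp
  next
    show "disjoint_family_on (\<lambda>e. h ` {e * r..<e * r + r}) {..<N}"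
      unfolding disjoint_family_on_def
    proof (intro ballI impI)
      fix e e' assume *: "e \<in> {..<N}" "e' \<in> {..<N}" "e \<noteq> e'"
      have "{e * r..<e * r + r} \<inter> {e' * r..<e' * r + r} = {}"
      proof -
        have "Suc i * r \<le> j * r" if "i < j" for i j using that by (intro mult_right_mono) auto
        then have "e * r + r \<le> e' * r \<or> e' * r + r \<le> e * r"
          using *(3) by (metis add.commute mult_Suc nat_neq_iff)
        then show ?thesis by auto
      qed
      moreover have "h ` {e * r..<e * r + r} \<inter> h ` {e' * r..<e' * r + r}
          = h ` ({e * r..<e * r + r} \<inter> {e' * r..<e' * r + r})"
        by (rule inj_on_image_Int[OF inj sub sub, symmetric]) (use * in auto)
      ultimately show "h ` {e * r..<e * r + r} \<inter> h ` {e' * r..<e' * r + r} = {}" by simp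
    qed
  qed
qed

text \<open>The translates of the set of immovable members by \<open>N\<close> disjoint \<open>r\<close>-sets are pairwise disjoint.\<close>
lemma immovable_sparse:
  assumes "finite K" "B \<subseteq> K" "N * r \<le> card B" "0 < r" "U \<subseteq> Pow K"
  shows "N * card {a \<in> U. \<not> (\<exists>E\<subseteq>B. card E = 2 * r \<and> sym_diff a E \<in> U)} \<le> 2 ^ card K"
proof -
  let ?W = "{a \<in> U. \<not> (\<exists>E\<subseteq>B. card E = 2 * r \<and> sym_diff a E \<in> U)}"
  have finB: "finite B" using assms(1,2) finite_subset by blast
  obtain E where E: "\<And>e. e < N \<Longrightarrow> E e \<subseteq> B \<and> card (E e) = r" "disjoint_family_on E {..<N}"
    using disjoint_subsets_of_size[OF finB assms(3)] by blast
  have inj: "inj_on (\<lambda>(e, a). sym_diff a (E e)) ({..<N} \<times> ?W)"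
  proof (rule inj_onI, clarify)
    fix e a e' a'
    assume *: "e < N" "e' < N" "a \<in> U" "\<nexists>E. E \<subseteq> B \<and> card E = 2 * r \<and> sym_diff a E \<in> U" "a' \<in> U"
      and eq: "sym_diff a (E e) = sym_diff a' (E e')"
    show "e = e' \<and> a = a'"
    proof (cases "e = e'")
      case True
      have "a = sym_diff (sym_diff a (E e)) (E e)" by blast
      also have "\<dots> = sym_diff (sym_diff a' (E e)) (E e)" using eq True by simp
      also have "\<dots> = a'" by blast
      finally show ?thesis using True by simp
    next
      case False
      have dis: "E e \<inter> E e' = {}" using E(2) False *(1,2) by (simp add: disjoint_family_on_def)
      \<comment> \<open>Coinciding translates would move \<open>a\<close> to \<open>a'\<close> along
        \<open>E e \<union> E e'\<close>, inside \<open>U\<close>. This set has size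
        \<open>2 * r\<close>, so the moves obtained are even.\<close>
      have "sym_diff a (E e \<union> E e') = sym_diff (sym_diff a (E e)) (E e')" using dis by blast
      also have "\<dots> = sym_diff (sym_diff a' (E e')) (E e')" using eq by simp
      also have "\<dots> = a'" by blast
      finally have "sym_diff a (E e \<union> E e') \<in> U" using *(5) by simp
      moreover have "card (E e \<union> E e') = 2 * r"
        using E(1)[OF *(1)] E(1)[OF *(2)] dis finB by (subst card_Un_disjoint) (auto intro: finite_subset)
      moreover have "E e \<union> E e' \<subseteq> B" using E(1)[OF *(1)] E(1)[OF *(2)] by auto
      ultimately show ?thesis using *(4) by blast
    qed
  qed
  have "(\<lambda>(e, a). sym_diff a (E e)) ` ({..<N} \<times> ?W) \<subseteq> Pow K"
    using E(1) assms(2,5) by fastforce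
  then have "card ({..<N} \<times> ?W) \<le> card (Pow K)"
    using assms(1) by (intro card_inj_on_le[OF inj]) auto
  then show ?thesis using assms(1) by (simp add: card_cartesian_product card_Pow)
qed

section \<open>Exact distances\<close>

lemma card_content_fibre:
  assumes "finite K" "B \<subseteq> K" "U \<subseteq> Pow K"
  shows "card {a \<in> Pow (K - B). a \<union> c \<in> U} \<ge> card {a \<in> U. a \<inter> B = c}"
proof (rule card_inj_on_le)
  show "inj_on (\<lambda>a. a - B) {a \<in> U. a \<inter> B = c}" by (auto simp: inj_on_def)
  show "(\<lambda>a. a - B) ` {a \<in> U. a \<inter> B = c} \<subseteq> {a \<in> Pow (K - B). a \<union> c \<in> U}"
  proof (rule image_subsetI)
    fix a assume "a \<in> {a \<in> U. a \<inter> B = c}"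
    then have a: "a \<in> U" "a \<inter> B = c" by simp_all
    have "a - B \<union> c = a" unfolding a(2)[symmetric] by blast
    moreover have "a - B \<subseteq> K - B" using a(1) assms(3) by blast
    ultimately show "a - B \<in> {a \<in> Pow (K - B). a \<union> c \<in> U}" using a(1) by simp
  qed
  show "finite {a \<in> Pow (K - B). a \<union> c \<in> U}" using assms(1) by simp
qed

lemma card_Un_Un_le:
  fixes W :: "nat \<Rightarrow> nat \<Rightarrow> 'b set"
  assumes "S \<subseteq> (\<Union>t<M. \<Union>r\<in>{1..g}. W t r)" "\<And>t r. t < M \<Longrightarrow> r \<in> {1..g} \<Longrightarrow> finite (W t r)"
    and "\<And>t r. t < M \<Longrightarrow> r \<in> {1..g} \<Longrightarrow> real (card (W t r)) \<le> w"
  shows "real (card S) \<le> real M * real g * w"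
proof -
  have "card S \<le> card (\<Union>t<M. \<Union>r\<in>{1..g}. W t r)"
    using assms(1,2) by (intro card_mono) auto
  also have "\<dots> \<le> (\<Sum>t<M. card (\<Union>r\<in>{1..g}. W t r))" by (rule card_UN_le) simp
  also have "\<dots> \<le> (\<Sum>t<M. \<Sum>r\<in>{1..g}. card (W t r))" by (intro sum_mono card_UN_le) simp
  finally have "real (card S) \<le> real (\<Sum>t<M. \<Sum>r\<in>{1..g}. card (W t r))" by (rule of_nat_mono)
  also have "\<dots> = (\<Sum>t<M. \<Sum>r\<in>{1..g}. real (card (W t r)))" by simp
  also have "\<dots> \<le> (\<Sum>t<M. \<Sum>r\<in>{1..g}. w)" by (intro sum_mono assms(3)) auto
  finally show ?thesis by (simp add: mult_ac)
qed

text \<open>Discard from \<open>U\<close> the members that some block cannot move by some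
  \<open>2 * r\<close> with \<open>1 \<le> r \<le> g\<close>, then take a block with a content dense
  both in the rest of \<open>U\<close> and in \<open>V\<close>. Outside this block \<open>y\<close>
  is approximated from below; inside it the two members agree, so moving one of them adds exactly
  the size of the move. The parity condition makes the shortfall even.\<close>

lemma exact_distance_low:
  fixes B :: "nat \<Rightarrow> 'a set"
  assumes fin: "finite K" and dis: "disjoint_family_on B {..<M}" and BK: "\<And>t. t < M \<Longrightarrow> B t \<subseteq> K"
    and d: "0 < d" and N: "0 < N" "\<And>t. t < M \<Longrightarrow> N * g \<le> card (B t)"
    and near: "\<And>t. t < M \<Longrightarrow> near (K - B t) d X (2 * g)"
    and M: "14 * ln (1 / (2 * d)) < real M"
    and U: "U \<subseteq> Pow K" "(2 * d + real M * real g / real N) * 2 ^ card K \<le> real (card U)"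
    and V: "V \<subseteq> Pow K" "2 * d * 2 ^ card K \<le> real (card V)"
    and par: "\<And>a b. a \<in> U \<Longrightarrow> b \<in> V \<Longrightarrow> even (sdist a b + y)" and y: "y \<in> X"
  shows "\<exists>a\<in>U. \<exists>b\<in>V. sdist a b = y"
proof -
  define mov where "mov t r a \<longleftrightarrow> (\<exists>E\<subseteq>B t. card E = 2 * r \<and> sym_diff a E \<in> U)" for t r a
  \<comment> \<open>Pruning runs over all blocks at once, because the block is chosen only
    afterwards and depends on the pruned family.\<close>
  define U' where "U' = {a \<in> U. \<forall>t<M. \<forall>r\<in>{1..g}. mov t r a}"
  have finU: "finite U" using U(1) fin by (meson finite_Pow_iff finite_subset)
  have "real (card (U - U')) \<le> real M * real g * (2 ^ card K / real N)"
  proof (rule card_Un_Un_le[where W = "\<lambda>t r. {a \<in> U. \<not> mov t r a}"])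
    show "U - U' \<subseteq> (\<Union>t<M. \<Union>r\<in>{1..g}. {a \<in> U. \<not> mov t r a})" by (auto simp: U'_def)
    fix t r assume t: "t < M" and r: "r \<in> {1..g}"
    show "finite {a \<in> U. \<not> mov t r a}" using finU by simp
    have "N * r \<le> N * g" using r by simp
    then have "N * r \<le> card (B t)" using N(2)[OF t] by linarith
    then have "N * card {a \<in> U. \<not> mov t r a} \<le> 2 ^ card K"
      unfolding mov_def using r by (intro immovable_sparse[OF fin BK[OF t] _ _ U(1)]) auto
    then have "real (N * card {a \<in> U. \<not> mov t r a}) \<le> real (2 ^ card K)" by (rule of_nat_mono)
    then show "real (card {a \<in> U. \<not> mov t r a}) \<le> 2 ^ card K / real N"
      using N(1) by (simp add: field_simps)
  qed
  moreover have "real (card (U - U')) = real (card U) - real (card U')"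
    using finU by (subst card_Diff_subset) (auto simp: U'_def card_mono of_nat_diff)
  moreover have "real M * real g * (2 ^ card K / real N) = real M * real g / real N * 2 ^ card K" by simp
  ultimately have U': "U' \<subseteq> Pow K" "2 * d * 2 ^ card K \<le> real (card U')"
    using U by (auto simp: algebra_simps U'_def)
  obtain t c where t: "t < M" and c: "c \<subseteq> B t"
    and cU: "real (card U') / (2 * 2 ^ card (B t)) \<le> real (card {a \<in> U'. a \<inter> B t = c})"
    and cV: "real (card V) / (2 * 2 ^ card (B t)) \<le> real (card {a \<in> V. a \<inter> B t = c})"
    using common_content[OF fin dis BK _ M U' V] d by auto
  let ?L = "K - B t"
  have finB: "finite (B t)" using BK[OF t] fin finite_subset by blast
  have cK: "card K = card ?L + card (B t)"
    using fin BK[OF t] finB by (metis card_Diff_subset card_mono le_add_diff_inverse2)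
  have dense: "d * 2 ^ card ?L \<le> real (card {a \<in> Pow ?L. a \<union> c \<in> W})"
    if W: "W \<subseteq> Pow K" "2 * d * 2 ^ card K \<le> real (card W)"
      "real (card W) / (2 * 2 ^ card (B t)) \<le> real (card {a \<in> W. a \<inter> B t = c})" for W
  proof -
    have "d * 2 ^ card ?L = (2 * d * 2 ^ card K) / (2 * 2 ^ card (B t))"
      by (simp add: cK power_add)
    also have "\<dots> \<le> real (card W) / (2 * 2 ^ card (B t))" using W(2) by (rule divide_right_mono) simp
    also have "\<dots> \<le> real (card {a \<in> W. a \<inter> B t = c})" by (rule W(3))
    also have "\<dots> \<le> real (card {a \<in> Pow ?L. a \<union> c \<in> W})"
      by (intro of_nat_mono card_content_fibre[OF fin BK[OF t] W(1)])
    finally show ?thesis .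
  qed
  from nearD[OF near[OF t] _ _ dense[OF U' cU] dense[OF V cV] y] obtain a b
    where ab: "a \<subseteq> ?L" "b \<subseteq> ?L" "a \<union> c \<in> U'" "b \<union> c \<in> V" "sdist a b \<le> y" "y \<le> sdist a b + 2 * g"
    by auto
  have disL: "?L \<inter> B t = {}" by auto
  have move: "sdist (a \<union> e) (b \<union> c) = sdist a b + sdist e c" if "e \<subseteq> B t" for e
    using fin finB disL ab(1,2) c that by (intro sdist_Un) auto
  have cc: "sdist c c = 0" by (simp add: sdist_def)
  have aU: "a \<union> c \<in> U" using ab(3) by (simp add: U'_def)
  have "even (sdist a b + y)" using par[OF aU ab(4)] move[OF c] cc by simp
  then have "even (y - sdist a b)" using ab(5) by (simp add: even_diff_nat)
  then obtain r where r: "y - sdist a b = 2 * r" by (rule evenE)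
  show ?thesis
  proof (cases "r = 0")
    case True
    then show ?thesis using r ab(4,5) aU move[OF c] cc by (intro bexI[of _ "a \<union> c"] bexI[of _ "b \<union> c"]) auto
  next
    case False
    then have "r \<in> {1..g}" using r ab(6) by auto
    then have "mov t r (a \<union> c)" using ab(3) t by (simp add: U'_def)
    then obtain E where E: "E \<subseteq> B t" "card E = 2 * r" "sym_diff (a \<union> c) E \<in> U" by (auto simp: mov_def)
    \<comment> \<open>The content is \<open>c\<close> on both sides, so flipping \<open>E\<close> in
      one of them raises the distance by \<open>card E\<close>. The moved set lies in
      \<open>U\<close>, not necessarily in \<open>U'\<close>.\<close>
    have eq: "sym_diff (a \<union> c) E = a \<union> sym_diff c E" using ab(1) E(1) by auto
    have "sdist (sym_diff c E) c = 2 * r"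
    proof -
      have "sym_diff (sym_diff c E) c = E" by blast
      then show ?thesis using E(2) by (simp add: sdist_def)
    qed
    moreover have "sym_diff c E \<subseteq> B t" using c E(1) by auto
    ultimately have "sdist (a \<union> sym_diff c E) (b \<union> c) = y" using move[of "sym_diff c E"] r ab(5) by simp
    then show ?thesis using E(3) ab(4) unfolding eq by blast
  qed
qed

lemma sdist_complement:
  assumes "finite K" "a \<subseteq> K" "b \<subseteq> K"
  shows "sdist a (K - b) = card K - sdist a b"
proof -
  have "sym_diff a (K - b) = K - sym_diff a b" using assms by auto
  moreover have "sym_diff a b \<subseteq> K" using assms by auto
  ultimately show ?thesis unfolding sdist_def using assms by (simp add: card_Diff_subset finite_subset)
qed

text \<open>Distances close to \<open>card K\<close> cannot be approximated outside a block on which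
  the members agree. Complementing the members of \<open>V\<close> turns the target \<open>y\<close>
  into \<open>card K - y\<close>.\<close>

lemma exact_distance:
  fixes B :: "nat \<Rightarrow> 'a set"
  assumes fin: "finite K" and dis: "disjoint_family_on B {..<M}" and BK: "\<And>t. t < M \<Longrightarrow> B t \<subseteq> K"
    and d: "0 < d" and N: "0 < N" "\<And>t. t < M \<Longrightarrow> N * g \<le> card (B t)"
    and near: "\<And>t. t < M \<Longrightarrow> near (K - B t) d X (2 * g)"
    and M: "14 * ln (1 / (2 * d)) < real M"
    and U: "U \<subseteq> Pow K" "(2 * d + real M * real g / real N) * 2 ^ card K \<le> real (card U)"
    and V: "V \<subseteq> Pow K" "(2 * d + real M * real g / real N) * 2 ^ card K \<le> real (card V)"
    and par: "\<And>a b. a \<in> U \<Longrightarrow> b \<in> V \<Longrightarrow> even (sdist a b + y)"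
    and y: "y \<le> card K" "y \<in> X \<or> card K - y \<in> X"
  shows "\<exists>a\<in>U. \<exists>b\<in>V. sdist a b = y"
proof -
  have "2 * d * 2 ^ card K \<le> (2 * d + real M * real g / real N) * 2 ^ card K"
    by (intro mult_right_mono) auto
  then have V2: "2 * d * 2 ^ card K \<le> real (card V)" using V(2) by linarith
  show ?thesis
  proof (cases "y \<in> X")
    case True
    then show ?thesis using exact_distance_low[OF fin dis BK d N near M U V(1) V2 par] by blast
  next
    case False
    define V' where "V' = (\<lambda>b. K - b) ` V"
    have "inj_on (\<lambda>b. K - b) V" using V(1) by (auto simp: inj_on_def)
    then have V': "V' \<subseteq> Pow K" "2 * d * 2 ^ card K \<le> real (card V')"
      using V2 by (auto simp: V'_def card_image)
    have sd: "sdist a (K - b) = card K - sdist a b" "sdist a b \<le> card K" if "a \<in> U" "b \<in> V" for a b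
      using sdist_complement[OF fin, of a b] sdist_le_card[OF fin, of a b] that U(1) V(1) by auto
    have "even (sdist a b + (card K - y))" if a: "a \<in> U" and b: "b \<in> V'" for a b
    proof -
      obtain b' where b': "b' \<in> V" "b = K - b'" using b unfolding V'_def by blast
      have "(card K - sdist a b') + (card K - y) + (sdist a b' + y) = 2 * card K"
        using sd(2)[OF a b'(1)] y(1) by simp
      then have "even ((card K - sdist a b') + (card K - y) + (sdist a b' + y))" by simp
      then have "even ((card K - sdist a b') + (card K - y))" using par[OF a b'(1)] by (metis even_add)
      then show ?thesis using sd(1)[OF a b'(1)] b'(2) by simp
    qed
    then obtain a b where ab: "a \<in> U" "b \<in> V'" "sdist a b = card K - y"
      using exact_distance_low[OF fin dis BK d N near M U V'] False y(2) by blast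
    then obtain b' where b': "b' \<in> V" "b = K - b'" by (auto simp: V'_def)
    have "sdist a b' = y" using sd[OF ab(1) b'(1)] ab(3) b'(2) y(1) by simp
    then show ?thesis using ab(1) b'(1) by blast
  qed
qed

text \<open>The exceptional set depends on one family only, since it is attached to a single
  layer and has to work for all other layers simultaneously.\<close>
definition separating :: "'o set \<Rightarrow> ('o \<Rightarrow> 'o \<Rightarrow> nat) \<Rightarrow> real \<Rightarrow> nat set \<Rightarrow> bool" where
  "separating \<Omega> \<delta> \<eta> X \<longleftrightarrow> (\<exists>exc. \<forall>U\<subseteq>\<Omega>. exc U \<subseteq> U \<and> real (card (exc U)) \<le> \<eta> * real (card \<Omega>) \<and>
     (\<forall>V\<subseteq>\<Omega>. \<forall>x\<in>X. \<forall>\<omega>\<in>U \<inter> V. \<omega> \<notin> exc U \<longrightarrow> \<omega> \<notin> exc V \<longrightarrow> (\<exists>a\<in>U. \<exists>b\<in>V. \<delta> a b = x)))"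

section \<open>Separating codes: cube times ternary words\<close>

definition code :: "'a set \<Rightarrow> 'i set \<Rightarrow> nat \<Rightarrow> ('a set \<times> ('i \<Rightarrow> nat)) set" where
  "code K I N = Pow K \<times> PiE I (\<lambda>_. {..<N})"

definition cdist :: "'i set \<Rightarrow> 'a set \<times> ('i \<Rightarrow> nat) \<Rightarrow> 'a set \<times> ('i \<Rightarrow> nat) \<Rightarrow> nat" where
  "cdist I p q = sdist (fst p) (fst q) + ham I (snd p) (snd q)"

lemma finite_code: "finite K \<Longrightarrow> finite I \<Longrightarrow> finite (code K I N)"
  by (simp add: code_def finite_PiE)

lemma card_code: "finite K \<Longrightarrow> finite I \<Longrightarrow> card (code K I N) = 2 ^ card K * N ^ card I"
  by (simp add: code_def card_cartesian_product card_Pow card_PiE)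

lemma card_code_fibres:
  assumes "finite K" "finite I" "U \<subseteq> code K I N"
  shows "card U = (\<Sum>f\<in>PiE I (\<lambda>_. {..<N}). card {a \<in> Pow K. (a, f) \<in> U})"
proof -
  let ?P = "PiE I (\<lambda>_. {..<N})"
  have "card U = card (SIGMA f:?P. {a \<in> Pow K. (a, f) \<in> U})"
  proof (rule bij_betw_same_card[of prod.swap])
    show "bij_betw prod.swap U (SIGMA f:?P. {a \<in> Pow K. (a, f) \<in> U})"
      using assms(3) by (intro bij_betw_byWitness[where f' = prod.swap]) (auto simp: code_def)
  qed
  also have "\<dots> = (\<Sum>f\<in>?P. card {a \<in> Pow K. (a, f) \<in> U})"
    using assms by (intro card_SigmaI finite_PiE) auto
  finally show ?thesis .
qed

lemma even_sdist:
  assumes "finite a" "finite b"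
  shows "even (sdist a b) \<longleftrightarrow> even (card a + card b)"
proof -
  have 1: "card a = card (a - b) + card (a \<inter> b)" using assms(1)
    by (metis Diff_disjoint Int_Diff Un_Diff_Int card_Un_disjoint finite_Diff finite_Int inf_commute)
  have 2: "card b = card (b - a) + card (a \<inter> b)" using assms(2)
    by (metis Diff_disjoint Int_Diff Un_Diff_Int card_Un_disjoint finite_Diff finite_Int inf_commute)
  have "sdist a b = card (a - b) + card (b - a)"
    unfolding sdist_def using assms by (intro card_Un_disjoint) auto
  then have "card a + card b = sdist a b + 2 * card (a \<inter> b)" using 1 2 by simp
  then show ?thesis by simp
qed

text \<open>One parity class of \<open>card a\<close> carries half of \<open>W\<close>; averaging
  splits \<open>\<epsilon> / 2\<close> into a share \<open>\<epsilon> / 4\<close> of the words and a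
  density \<open>\<epsilon> / 4\<close> above each of them. \<open>p\<close> stands for a residue
  modulo 2.\<close>

lemma dense_parity_class:
  assumes "finite K" "finite I" "W \<subseteq> code K I N" "0 < \<epsilon>" "\<epsilon> * real (card (code K I N)) \<le> real (card W)"
  shows "\<exists>p::nat. \<epsilon> / 4 * N ^ card I \<le> real (card {f \<in> PiE I (\<lambda>_. {..<N}).
    \<epsilon> / 4 * 2 ^ card K \<le> real (card {a \<in> Pow K. (a, f) \<in> W \<and> even (card a + p)})})"
proof -
  let ?P = "PiE I (\<lambda>_. {..<N})"
  define F where "F p f = {a \<in> Pow K. (a, f) \<in> W \<and> even (card a + p)}" for p f
  have finP: "finite ?P" using assms(2) by (intro finite_PiE) auto
  have fib: "card {a \<in> Pow K. (a, f) \<in> W} = card (F 0 f) + card (F 1 f)" for f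
  proof -
    have "{a \<in> Pow K. (a, f) \<in> W} = F 0 f \<union> F 1 f" by (auto simp: F_def)
    moreover have "F 0 f \<inter> F 1 f = {}" by (auto simp: F_def)
    ultimately show ?thesis using assms(1) by (simp add: card_Un_disjoint F_def)
  qed
  have "card W = (\<Sum>f\<in>?P. card (F 0 f)) + (\<Sum>f\<in>?P. card (F 1 f))"
    unfolding card_code_fibres[OF assms(1-3)] fib by (rule sum.distrib)
  then have sum: "\<epsilon> * real (card (code K I N))
      \<le> real (\<Sum>f\<in>?P. card (F 0 f)) + real (\<Sum>f\<in>?P. card (F 1 f))"
    using assms(5) by simp
  have "\<exists>p. \<epsilon> / 2 * real (card (code K I N)) \<le> real (\<Sum>f\<in>?P. card (F p f))"
  proof (cases "\<epsilon> / 2 * real (card (code K I N)) \<le> real (\<Sum>f\<in>?P. card (F 0 f))")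
    case False
    then have "\<epsilon> / 2 * real (card (code K I N)) \<le> real (\<Sum>f\<in>?P. card (F 1 f))"
      using sum by linarith
    then show ?thesis ..
  qed blast
  then obtain p where p: "\<epsilon> / 2 * real (card (code K I N)) \<le> real (\<Sum>f\<in>?P. card (F p f))" by blast
  have "\<epsilon> / 4 * real (card ?P) \<le> real (card {f \<in> ?P. \<epsilon> / 4 * 2 ^ card K \<le> real (card (F p f))})"
  proof (rule card_dense_fibres[OF finP])
    fix f
    have "real (card (F p f)) \<le> real (card (Pow K))"
      using assms(1) by (intro of_nat_mono card_mono) (auto simp: F_def)
    then show "real (card (F p f)) \<le> 2 ^ card K" using assms(1) by (simp add: card_Pow)
  next
    show "(\<epsilon> / 4 + \<epsilon> / 4) * 2 ^ card K * real (card ?P) \<le> real (\<Sum>f\<in>?P. card (F p f))"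
      using p assms(1,2) by (simp add: card_code card_PiE field_simps)
  qed (use assms(4) in auto)
  then show ?thesis using assms(2) by (auto simp: F_def card_PiE)
qed

text \<open>Fix in each family a dense parity class of the cube part. The words \<open>f\<close> and
  \<open>h\<close> are then chosen with the parity of their distance such that the remaining
  distance \<open>x - ham I f h\<close> has the parity forced between the two classes, as
  \<open>exact\<close> demands.\<close>

lemma separating_ternary:
  assumes fin: "finite K" "finite I" and \<epsilon>: "0 < \<epsilon>" "2 ^ card I < \<epsilon> / 4 * 3 ^ card I"
    and exact: "\<And>U V y. U \<subseteq> Pow K \<Longrightarrow> V \<subseteq> Pow K \<Longrightarrow> \<epsilon> / 4 * 2 ^ card K \<le> real (card U)
      \<Longrightarrow> \<epsilon> / 4 * 2 ^ card K \<le> real (card V) \<Longrightarrow> (\<And>a b. a \<in> U \<Longrightarrow> b \<in> V \<Longrightarrow> even (sdist a b + y))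
      \<Longrightarrow> y \<in> Y \<Longrightarrow> \<exists>a\<in>U. \<exists>b\<in>V. sdist a b = y"
    and X: "\<And>x h. x \<in> X \<Longrightarrow> h \<le> card I \<Longrightarrow> h \<le> x \<and> x - h \<in> Y"
  shows "separating (code K I 3) (cdist I) \<epsilon> X"
  unfolding separating_def
\<comment> \<open>A sparse family is exceptional as a whole, a dense one has no exceptional
  member.\<close>
proof (intro exI[of _ "\<lambda>U. if real (card U) < \<epsilon> * real (card (code K I 3)) then U else {}"] allI impI conjI ballI)
  fix U assume "U \<subseteq> code K I 3"
  show "(if real (card U) < \<epsilon> * real (card (code K I 3)) then U else {}) \<subseteq> U" by simp
  show "real (card (if real (card U) < \<epsilon> * real (card (code K I 3)) then U else {})) \<le> \<epsilon> * real (card (code K I 3))"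
    using \<epsilon> by simp
next
  fix U V x \<omega>
  assume U: "U \<subseteq> code K I 3" and V: "V \<subseteq> code K I 3" and x: "x \<in> X" and \<omega>: "\<omega> \<in> U \<inter> V"
    and "\<omega> \<notin> (if real (card U) < \<epsilon> * real (card (code K I 3)) then U else {})"
      "\<omega> \<notin> (if real (card V) < \<epsilon> * real (card (code K I 3)) then V else {})"
  then have dense: "\<epsilon> * real (card (code K I 3)) \<le> real (card U)" "\<epsilon> * real (card (code K I 3)) \<le> real (card V)"
    by (auto split: if_splits)
  define F where "F W p f = {a \<in> Pow K. (a, f) \<in> W \<and> even (card a + p)}"
    for W :: "('a set \<times> ('b \<Rightarrow> nat)) set" and p :: nat and f
  define G where "G W p = {f \<in> PiE I (\<lambda>_. {..<3}). \<epsilon> / 4 * 2 ^ card K \<le> real (card (F W p f))}" for W p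
  have G: "\<exists>p. 2 ^ card I < card (G W p)" if W: "W \<subseteq> code K I 3" "\<epsilon> * real (card (code K I 3)) \<le> real (card W)" for W
  proof -
    obtain p :: nat where "\<epsilon> / 4 * 3 ^ card I \<le> real (card (G W p))"
      using dense_parity_class[OF fin W(1) \<epsilon>(1) W(2)] by (auto simp: G_def F_def)
    then have "(2::real) ^ card I < real (card (G W p))" using \<epsilon>(2) by linarith
    then have "2 ^ card I < card (G W p)" by (metis of_nat_less_iff of_nat_numeral of_nat_power)
    then show ?thesis ..
  qed
  obtain p q where p: "2 ^ card I < card (G U p)" and q: "2 ^ card I < card (G V q)"
    using G[OF U dense(1)] G[OF V dense(2)] by blast
  obtain f h where f: "f \<in> G U p" and h: "h \<in> G V q" and even: "even (ham I f h + (p + q + x))"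
    using both_parities[OF fin(2) _ _ p q, of "p + q + x"] by (auto simp: G_def)
  have "ham I f h \<le> card I" unfolding ham_def using fin(2) by (intro card_mono) auto
  then have y: "ham I f h \<le> x" "x - ham I f h \<in> Y" using X[OF x] by auto
  have "\<exists>a\<in>F U p f. \<exists>b\<in>F V q h. sdist a b = x - ham I f h"
  proof (rule exact[OF _ _ _ _ _ y(2)])
    show "F U p f \<subseteq> Pow K" "F V q h \<subseteq> Pow K" by (auto simp: F_def)
    show "\<epsilon> / 4 * 2 ^ card K \<le> real (card (F U p f))" "\<epsilon> / 4 * 2 ^ card K \<le> real (card (F V q h))"
      using f h by (auto simp: G_def)
    fix a b assume ab: "a \<in> F U p f" "b \<in> F V q h"
    then have "finite a" "finite b" using fin(1) by (auto simp: F_def intro: finite_subset)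
    then have "even (sdist a b + (card a + card b))" using even_sdist[of a b] by simp
    moreover have "even (card a + p)" "even (card b + q)" using ab by (auto simp: F_def)
    moreover have "sdist a b + (x - ham I f h) + 2 * (ham I f h + card a + card b + p + q)
        = (sdist a b + (card a + card b)) + (card a + p) + (card b + q) + (ham I f h + (p + q + x))"
      using y(1) by simp
    ultimately show "even (sdist a b + (x - ham I f h))"
      using even by (metis dvd_add_right_iff dvd_add dvd_triv_left even_add)
  qed
  then obtain a b where "(a, f) \<in> U" "(b, h) \<in> V" "sdist a b = x - ham I f h" by (auto simp: F_def)
  then show "\<exists>a\<in>U. \<exists>b\<in>V. cdist I a b = x"
    using y(1) by (intro bexI[of _ "(a, f)"] bexI[of _ "(b, h)"]) (auto simp: cdist_def)
qed

section \<open>Moves by changing letters over a large alphabet\<close>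

text \<open>Adding \<open>c\<close> modulo \<open>N\<close> to the first \<open>r\<close> letters
  gives \<open>N\<close> translates of the set of immovable members. If translates for different
  \<open>c\<close> meet, the members involved share the cube part and differ in exactly the first
  \<open>r\<close> letters, so they are movable.\<close>

lemma immovable_words:
  assumes fin: "finite K" and U: "U \<subseteq> code K {..<g} N" and r: "r \<le> g"
  shows "N * card {p \<in> U. \<not> (\<exists>f\<in>PiE {..<g} (\<lambda>_. {..<N}). ham {..<g} f (snd p) = r \<and> (fst p, f) \<in> U)}
    \<le> card (code K {..<g} N)"
proof -
  let ?W = "{p \<in> U. \<not> (\<exists>f\<in>PiE {..<g} (\<lambda>_. {..<N}). ham {..<g} f (snd p) = r \<and> (fst p, f) \<in> U)}"
  define s where "s c f = (\<lambda>i\<in>{..<g}. if i < r then (f i + c) mod N else f i)" for c and f :: "nat \<Rightarrow> nat"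
  have inj: "inj_on (\<lambda>(c, p). (fst p, s c (snd p))) ({..<N} \<times> ?W)"
  proof (rule inj_onI, clarify)
    fix c a f c' a' f'
    assume c: "c < N" "c' < N" and p: "(a, f) \<in> U" "(a', f') \<in> U"
      and no: "\<not> (\<exists>h\<in>PiE {..<g} (\<lambda>_. {..<N}). ham {..<g} h (snd (a, f)) = r \<and> (fst (a, f), h) \<in> U)"
      and eq: "fst (a, f) = fst (a', f')" "s c (snd (a, f)) = s c' (snd (a', f'))"
    have f: "f \<in> PiE {..<g} (\<lambda>_. {..<N})" "f' \<in> PiE {..<g} (\<lambda>_. {..<N})"
      using p U by (auto simp: code_def)
    have low: "(f i + c) mod N = (f' i + c') mod N" if "i < r" for i
      using fun_cong[OF eq(2), of i] that r by (simp add: s_def)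
    have high: "f i = f' i" if "i < g" "\<not> i < r" for i
      using fun_cong[OF eq(2), of i] that by (simp add: s_def)
    have lt: "f i < N" "f' i < N" if "i < g" for i using f that by auto
    have cancel: "u = v" if "(u + w) mod N = (v + w) mod N" "u < N" "v < N" "w < N" for u v w
      using that by (auto simp: mod_if split: if_splits)
    show "c = c' \<and> (a, f) = (a', f')"
    proof (cases "c = c'")
      case True
      have "f i = f' i" if "i < g" for i
        using low[of i] high[of i] lt[OF that] that cancel[of "f i" c "f' i"] True c by blast
      then have "f = f'" using f by (intro PiE_ext) auto
      then show ?thesis using True eq by simp
    next
      case False
      have ne: "f' i \<noteq> f i" if "i < r" for i
        using low[OF that] cancel[of c "f i" c'] c False lt[of i] that r by (auto simp: add.commute)
      have "{i \<in> {..<g}. f' i \<noteq> f i} = {..<r}" using high ne r by force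
      then have "ham {..<g} f' f = r" by (simp add: ham_def)
      then show ?thesis using no f(2) p(2) eq(1) by auto
    qed
  qed
  have "(\<lambda>(c, p). (fst p, s c (snd p))) ` ({..<N} \<times> ?W) \<subseteq> code K {..<g} N"
    using U by (fastforce simp: code_def s_def PiE_iff)
  then have "card ({..<N} \<times> ?W) \<le> card (code K {..<g} N)"
    using fin by (intro card_inj_on_le[OF inj] finite_code) auto
  then show ?thesis by (simp add: card_cartesian_product)
qed

text \<open>Exceptional are the members that cannot change exactly \<open>r\<close> letters inside
  the family for some \<open>1 \<le> r \<le> g\<close>, at a cost \<open>g / N\<close>, and the
  movable ones whose word has few movable members above it, at a cost
  \<open>\<epsilon>\<close>.\<close>

lemma separating_moves:
  assumes fin: "finite K" and near: "near K \<epsilon> X g" and \<epsilon>: "0 < \<epsilon>" and N: "0 < N"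
  shows "separating (code K {..<g} N) (cdist {..<g}) (\<epsilon> + real g / real N) X"
proof -
  let ?P = "PiE {..<g} (\<lambda>_. {..<N})" and ?C = "code K {..<g} N"
  define mov where "mov U r p \<longleftrightarrow> (\<exists>f\<in>?P. ham {..<g} f (snd p) = r \<and> (fst p, f) \<in> U)"
    for U :: "('a set \<times> (nat \<Rightarrow> nat)) set" and r p
  define U' where "U' U = {p \<in> U. \<forall>r\<in>{1..g}. mov U r p}" for U
  define F where "F U f = {a \<in> Pow K. (a, f) \<in> U' U}" for U f
  define E where "E U = {p \<in> U' U. real (card (F U (snd p))) < \<epsilon> * 2 ^ card K}" for U
  have finC: "finite ?C" using fin by (simp add: finite_code)
  have "real (card ((U - U' U) \<union> E U)) \<le> (\<epsilon> + real g / real N) * real (card ?C)" if U: "U \<subseteq> ?C" for U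
  proof -
    have finU: "finite U" using U finC finite_subset by blast
    have "real (card (U - U' U)) \<le> real 1 * real g * (real (card ?C) / real N)"
    proof (rule card_Un_Un_le[where W = "\<lambda>t r. {p \<in> U. \<not> mov U r p}"])
      show "U - U' U \<subseteq> (\<Union>t<(1::nat). \<Union>r\<in>{1..g}. {p \<in> U. \<not> mov U r p})" by (auto simp: U'_def)
      fix r assume "r \<in> {1..g}"
      then have "N * card {p \<in> U. \<not> mov U r p} \<le> card ?C"
        unfolding mov_def by (intro immovable_words[OF fin U]) auto
      then have "real (N * card {p \<in> U. \<not> mov U r p}) \<le> real (card ?C)" by (rule of_nat_mono)
      then show "real (card {p \<in> U. \<not> mov U r p}) \<le> real (card ?C) / real N"
        using N by (simp add: field_simps)
    qed (use finU in auto)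
    moreover have "real (card (E U)) \<le> \<epsilon> * real (card ?C)"
    proof -
      have EU: "E U \<subseteq> ?C" using U by (auto simp: E_def U'_def)
      have "real (card (E U)) = (\<Sum>f\<in>?P. real (card {a \<in> Pow K. (a, f) \<in> E U}))"
        unfolding card_code_fibres[OF fin _ EU, simplified] by simp
      also have "\<dots> \<le> (\<Sum>f\<in>?P. \<epsilon> * 2 ^ card K)"
      proof (rule sum_mono)
        fix f
        show "real (card {a \<in> Pow K. (a, f) \<in> E U}) \<le> \<epsilon> * 2 ^ card K"
        proof (cases "real (card (F U f)) < \<epsilon> * 2 ^ card K")
          case True
          have "card {a \<in> Pow K. (a, f) \<in> E U} \<le> card (F U f)"
            using fin by (intro card_mono) (auto simp: E_def F_def)
          then show ?thesis using True by linarith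
        next
          case False
          then have "{a \<in> Pow K. (a, f) \<in> E U} = {}" by (auto simp: E_def)
          show ?thesis unfolding \<open>{a \<in> Pow K. (a, f) \<in> E U} = {}\<close> using \<epsilon> by simp
        qed
      qed
      also have "\<dots> = \<epsilon> * real (card ?C)" using fin by (simp add: card_code card_PiE)
      finally show ?thesis .
    qed
    moreover have "real (card ((U - U' U) \<union> E U)) \<le> real (card (U - U' U)) + real (card (E U))"
      using card_Un_le[of "U - U' U" "E U"] by linarith
    ultimately show ?thesis by (simp add: algebra_simps)
  qed
  moreover have "\<exists>p\<in>U. \<exists>q\<in>V. cdist {..<g} p q = x"
    if U: "U \<subseteq> ?C" and V: "V \<subseteq> ?C" and x: "x \<in> X" and w: "w \<in> U" "w \<in> V"
      "w \<notin> (U - U' U) \<union> E U" "w \<notin> (V - U' V) \<union> E V" for U V x w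
  proof -
    \<comment> \<open>\<open>w\<close> serves through its word: both families have dense movable
      fibres above the same \<open>f\<close>, so letters contribute nothing to the distance until
      \<open>r\<close> of them are changed to make up the shortfall.\<close>
    obtain a0 f where w0: "w = (a0, f)" by (cases w)
    have "\<epsilon> * 2 ^ card K \<le> real (card (F U f))" "\<epsilon> * 2 ^ card K \<le> real (card (F V f))"
      using w w0 by (auto simp: E_def)
    then obtain a b where ab: "a \<in> F U f" "b \<in> F V f" "sdist a b \<le> x" "x \<le> sdist a b + g"
      using nearD[OF near, of "F U f" "F V f" x] x by (auto simp: F_def)
    have aU: "(a, f) \<in> U' U" and bV: "(b, f) \<in> V" using ab by (auto simp: F_def U'_def)
    show ?thesis
    proof (cases "x = sdist a b")
      case True
      have "cdist {..<g} (a, f) (b, f) = x" by (simp add: True cdist_def ham_def)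
      then show ?thesis using aU bV by (auto simp: U'_def)
    next
      case False
      then have "x - sdist a b \<in> {1..g}" using ab by auto
      then have "mov U (x - sdist a b) (a, f)" using aU by (simp add: U'_def)
      then obtain f' where "ham {..<g} f' f = x - sdist a b" "(a, f') \<in> U" by (auto simp: mov_def)
      moreover from this have "cdist {..<g} (a, f') (b, f) = x" using ab(3) by (simp add: cdist_def)
      ultimately show ?thesis using bV by blast
    qed
  qed
  moreover have "(U - U' U) \<union> E U \<subseteq> U" for U by (auto simp: E_def U'_def)
  ultimately show ?thesis
    unfolding separating_def
    by (intro exI[of _ "\<lambda>U. (U - U' U) \<union> E U"] allI impI conjI ballI) (simp, simp, metis IntE)
qed

section \<open>Random chains and codes\<close>

lemma ex_permutes_image:
  assumes "finite S" "B \<subseteq> S" "B' \<subseteq> S" "card B = card B'"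
  shows "\<exists>p. p permutes S \<and> p ` B = B'"
proof -
  have fin: "finite B" "finite B'" using assms finite_subset by auto
  obtain f where f: "bij_betw f B B'" using finite_same_card_bij[OF fin assms(4)] by blast
  have "card (S - B) = card (S - B')" using assms fin by (simp add: card_Diff_subset)
  then obtain g where g: "bij_betw g (S - B) (S - B')"
    using finite_same_card_bij assms(1) by (metis finite_Diff)
  define p where "p x = (if x \<in> B then f x else if x \<in> S then g x else x)" for x
  have pB: "bij_betw p B B'" using f by (subst bij_betw_cong[of B p f]) (auto simp: p_def)
  have pC: "bij_betw p (S - B) (S - B')" using g by (subst bij_betw_cong[of _ p g]) (auto simp: p_def)
  have "bij_betw p (B \<union> (S - B)) (B' \<union> (S - B'))" by (rule bij_betw_combine[OF pB pC]) auto
  moreover have "B \<union> (S - B) = S" "B' \<union> (S - B') = S" using assms by auto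
  ultimately have "bij_betw p S S" by simp
  then have "p permutes S" using assms(2) by (intro bij_imp_permutes) (auto simp: p_def)
  then show ?thesis using pB by (auto simp: bij_betw_def)
qed

lemma card_permutes_compose:
  assumes "\<kappa> permutes S"
  shows "card {\<sigma>. \<sigma> permutes S \<and> P (\<sigma> \<circ> \<kappa>)} = card {\<sigma>. \<sigma> permutes S \<and> P \<sigma>}"
proof (rule bij_betw_same_card)
  have inv: "inv \<kappa> permutes S" using assms by (rule permutes_inv)
  have c: "\<sigma> \<circ> \<kappa> \<circ> inv \<kappa> = \<sigma>" "\<sigma> \<circ> inv \<kappa> \<circ> \<kappa> = \<sigma>" for \<sigma> :: "'a \<Rightarrow> 'b"
    using permutes_inv_o[OF assms] by (simp_all add: comp_assoc)
  show "bij_betw (\<lambda>\<sigma>. \<sigma> \<circ> \<kappa>) {\<sigma>. \<sigma> permutes S \<and> P (\<sigma> \<circ> \<kappa>)} {\<sigma>. \<sigma> permutes S \<and> P \<sigma>}"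
    using c by (intro bij_betw_byWitness[where f' = "\<lambda>\<sigma>. \<sigma> \<circ> inv \<kappa>"])
      (auto intro: permutes_compose[OF assms] permutes_compose[OF inv])
qed

lemma card_permutes_compose_left:
  assumes "\<kappa> permutes S"
  shows "card {\<sigma>. \<sigma> permutes S \<and> P (\<kappa> \<circ> \<sigma>)} = card {\<sigma>. \<sigma> permutes S \<and> P \<sigma>}"
proof (rule bij_betw_same_card)
  have inv: "inv \<kappa> permutes S" using assms by (rule permutes_inv)
  have c: "inv \<kappa> \<circ> (\<kappa> \<circ> \<sigma>) = \<sigma>" "\<kappa> \<circ> (inv \<kappa> \<circ> \<sigma>) = \<sigma>" for \<sigma> :: "'b \<Rightarrow> 'a"
    using permutes_inv_o[OF assms] by (simp_all add: o_assoc)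
  show "bij_betw (\<lambda>\<sigma>. \<kappa> \<circ> \<sigma>) {\<sigma>. \<sigma> permutes S \<and> P (\<kappa> \<circ> \<sigma>)} {\<sigma>. \<sigma> permutes S \<and> P \<sigma>}"
    using c by (intro bij_betw_byWitness[where f' = "\<lambda>\<sigma>. inv \<kappa> \<circ> \<sigma>"])
      (auto intro: permutes_compose[OF _ assms] permutes_compose[OF _ inv])
qed

text \<open>Composing with a permutation that takes \<open>{1..i}\<close> to \<open>B\<close> shows
  that every \<open>i\<close>-set arises from equally many permutations: the chain meets layer
  \<open>i\<close> in a uniform set.\<close>

lemma card_permutes_layer:
  fixes A :: "nat set set"
  assumes A: "A \<subseteq> Pow {1..n}" and i: "i \<le> n"
  shows "(n choose i) * card {\<sigma>. \<sigma> permutes {1..n} \<and> \<sigma> ` {1..i} \<in> A} = fact n * card {B \<in> A. card B = i}"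
proof -
  define c where "c B = card {\<sigma>. \<sigma> permutes {1..n} \<and> \<sigma> ` {1..i} = B}" for B
  define L where "L = {B. B \<subseteq> {1..n} \<and> card B = i}"
  have finp: "finite {\<sigma>. \<sigma> permutes {1..n} \<and> Q \<sigma>}" for Q
    by (rule finite_subset[OF _ finite_permutations[of "{1..n}"]]) auto
  have finL: "finite L" by (simp add: L_def)
  have cc: "c B = c {1..i}" if B: "B \<in> L" for B
  proof -
    obtain \<kappa> where \<kappa>: "\<kappa> permutes {1..n}" "\<kappa> ` {1..i} = B"
      using ex_permutes_image[of "{1..n}" "{1..i}" B] B i by (auto simp: L_def)
    have "c B = card {\<sigma>. \<sigma> permutes {1..n} \<and> (\<kappa> \<circ> \<sigma>) ` {1..i} = B}"
      unfolding c_def by (rule card_permutes_compose_left[OF \<kappa>(1), symmetric])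
    also have "{\<sigma>. \<sigma> permutes {1..n} \<and> (\<kappa> \<circ> \<sigma>) ` {1..i} = B} = {\<sigma>. \<sigma> permutes {1..n} \<and> \<sigma> ` {1..i} = {1..i}}"
      unfolding image_comp[symmetric] \<kappa>(2)[symmetric] using inj_image_eq_iff[OF permutes_inj[OF \<kappa>(1)]] by auto
    finally show ?thesis by (simp add: c_def)
  qed
  have count: "card {\<sigma>. \<sigma> permutes {1..n} \<and> \<sigma> ` {1..i} \<in> F} = card F * c {1..i}" if F: "F \<subseteq> L" for F
  proof -
    have "{\<sigma>. \<sigma> permutes {1..n} \<and> \<sigma> ` {1..i} \<in> F} = (\<Union>B\<in>F. {\<sigma>. \<sigma> permutes {1..n} \<and> \<sigma> ` {1..i} = B})"
      by auto
    also have "card \<dots> = (\<Sum>B\<in>F. c B)"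
      unfolding c_def using finite_subset[OF F finL] finp by (intro card_UN_disjoint) auto
    also have "\<dots> = (\<Sum>B\<in>F. c {1..i})" using cc F by (intro sum.cong) auto
    finally show ?thesis by simp
  qed
  have inL: "\<sigma> ` {1..i} \<in> L" if "\<sigma> permutes {1..n}" for \<sigma>
  proof -
    have "card (\<sigma> ` {1..i}) = i" using permutes_inj_on[OF that] by (subst card_image) auto
    moreover have "\<sigma> ` {1..i} \<subseteq> \<sigma> ` {1..n}" using i by (intro image_mono) auto
    ultimately show ?thesis using permutes_image[OF that] by (simp add: L_def)
  qed
  have "{\<sigma>. \<sigma> permutes {1..n} \<and> \<sigma> ` {1..i} \<in> L} = {\<sigma>. \<sigma> permutes {1..n}}" using inL by auto
  then have "card L * c {1..i} = fact n" using count[of L] by (simp add: card_permutations[of _ n])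
  moreover have "card L = n choose i" unfolding L_def by (simp add: n_subsets)
  ultimately have tot: "(n choose i) * c {1..i} = fact n" by simp
  have "{\<sigma>. \<sigma> permutes {1..n} \<and> \<sigma> ` {1..i} \<in> A}
      = {\<sigma>. \<sigma> permutes {1..n} \<and> \<sigma> ` {1..i} \<in> {B \<in> A. card B = i}}"
    using inL by (auto simp: L_def)
  then have "card {\<sigma>. \<sigma> permutes {1..n} \<and> \<sigma> ` {1..i} \<in> A} = card {B \<in> A. card B = i} * c {1..i}"
    using count[of "{B \<in> A. card B = i}"] A by (auto simp: L_def)
  then show ?thesis unfolding tot[symmetric] by (simp only: mult_ac)
qed

section \<open>Averaging over chains\<close>

text \<open>\<open>bad i\<close> collects the chains, given by permutations, that are exceptional at
  layer \<open>i\<close>. The cost gives layer \<open>i\<close> the weight \<open>n choose i\<close>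
  that it has in the averaging over chains; \<open>fact n\<close> clears the denominator of the
  probabilities.\<close>

definition layer_separating :: "nat \<Rightarrow> nat set set \<Rightarrow> nat set \<Rightarrow> real \<Rightarrow> nat set \<Rightarrow> bool" where
  "layer_separating n A L \<eta> X \<longleftrightarrow> (\<exists>bad.
     (\<Sum>i\<in>L. real (n choose i) * real (card {\<sigma>. \<sigma> permutes {1..n} \<and> \<sigma> \<in> bad i})) \<le> \<eta> * 2 ^ n * fact n \<and>
     (\<forall>\<sigma> i j x. \<sigma> permutes {1..n} \<longrightarrow> i \<in> L \<longrightarrow> j \<in> L \<longrightarrow> i < j \<longrightarrow> x \<in> X \<longrightarrow>
        \<sigma> \<notin> bad i \<longrightarrow> \<sigma> \<notin> bad j \<longrightarrow> \<sigma> ` {1..i} \<in> A \<longrightarrow> \<sigma> ` {1..j} \<in> A \<longrightarrow>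
        (\<exists>P\<in>A. \<exists>Q\<in>A. card P = i \<and> card Q = j \<and> card (P - Q) = x)))"

lemma layer_separating_Un:
  assumes "layer_separating n A L \<eta> X" "layer_separating n A L \<theta> Y"
  shows "layer_separating n A L (\<eta> + \<theta>) (X \<union> Y)"
proof -
  obtain b where b: "(\<Sum>i\<in>L. real (n choose i) * real (card {\<sigma>. \<sigma> permutes {1..n} \<and> \<sigma> \<in> b i})) \<le> \<eta> * 2 ^ n * fact n"
    "\<And>\<sigma> i j x. \<sigma> permutes {1..n} \<Longrightarrow> i \<in> L \<Longrightarrow> j \<in> L \<Longrightarrow> i < j \<Longrightarrow> x \<in> X \<Longrightarrow>
      \<sigma> \<notin> b i \<Longrightarrow> \<sigma> \<notin> b j \<Longrightarrow> \<sigma> ` {1..i} \<in> A \<Longrightarrow> \<sigma> ` {1..j} \<in> A \<Longrightarrow>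
      \<exists>P\<in>A. \<exists>Q\<in>A. card P = i \<and> card Q = j \<and> card (P - Q) = x"
    using assms(1) unfolding layer_separating_def by blast
  obtain c where c: "(\<Sum>i\<in>L. real (n choose i) * real (card {\<sigma>. \<sigma> permutes {1..n} \<and> \<sigma> \<in> c i})) \<le> \<theta> * 2 ^ n * fact n"
    "\<And>\<sigma> i j x. \<sigma> permutes {1..n} \<Longrightarrow> i \<in> L \<Longrightarrow> j \<in> L \<Longrightarrow> i < j \<Longrightarrow> x \<in> Y \<Longrightarrow>
      \<sigma> \<notin> c i \<Longrightarrow> \<sigma> \<notin> c j \<Longrightarrow> \<sigma> ` {1..i} \<in> A \<Longrightarrow> \<sigma> ` {1..j} \<in> A \<Longrightarrow>
      \<exists>P\<in>A. \<exists>Q\<in>A. card P = i \<and> card Q = j \<and> card (P - Q) = x"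
    using assms(2) unfolding layer_separating_def by blast
  have "(\<Sum>i\<in>L. real (n choose i) * real (card {\<sigma>. \<sigma> permutes {1..n} \<and> \<sigma> \<in> b i \<union> c i}))
      \<le> (\<Sum>i\<in>L. real (n choose i) * real (card {\<sigma>. \<sigma> permutes {1..n} \<and> \<sigma> \<in> b i})
        + real (n choose i) * real (card {\<sigma>. \<sigma> permutes {1..n} \<and> \<sigma> \<in> c i}))"
  proof (rule sum_mono)
    fix i
    have "{\<sigma>. \<sigma> permutes {1..n} \<and> \<sigma> \<in> b i \<union> c i}
        = {\<sigma>. \<sigma> permutes {1..n} \<and> \<sigma> \<in> b i} \<union> {\<sigma>. \<sigma> permutes {1..n} \<and> \<sigma> \<in> c i}" by auto
    then have "card {\<sigma>. \<sigma> permutes {1..n} \<and> \<sigma> \<in> b i \<union> c i}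
        \<le> card {\<sigma>. \<sigma> permutes {1..n} \<and> \<sigma> \<in> b i} + card {\<sigma>. \<sigma> permutes {1..n} \<and> \<sigma> \<in> c i}"
      by (simp only: card_Un_le)
    then have "real (card {\<sigma>. \<sigma> permutes {1..n} \<and> \<sigma> \<in> b i \<union> c i})
        \<le> real (card {\<sigma>. \<sigma> permutes {1..n} \<and> \<sigma> \<in> b i}) + real (card {\<sigma>. \<sigma> permutes {1..n} \<and> \<sigma> \<in> c i})"
      by linarith
    from mult_left_mono[OF this, of "real (n choose i)"]
    show "real (n choose i) * real (card {\<sigma>. \<sigma> permutes {1..n} \<and> \<sigma> \<in> b i \<union> c i})
      \<le> real (n choose i) * real (card {\<sigma>. \<sigma> permutes {1..n} \<and> \<sigma> \<in> b i})
        + real (n choose i) * real (card {\<sigma>. \<sigma> permutes {1..n} \<and> \<sigma> \<in> c i})"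
      by (simp add: distrib_left)
  qed
  also have "\<dots> \<le> (\<eta> + \<theta>) * 2 ^ n * fact n"
    using b(1) c(1) by (simp add: sum.distrib algebra_simps)
  finally have "(\<Sum>i\<in>L. real (n choose i) * real (card {\<sigma>. \<sigma> permutes {1..n} \<and> \<sigma> \<in> b i \<union> c i}))
      \<le> (\<eta> + \<theta>) * 2 ^ n * fact n" .
  moreover have "\<exists>P\<in>A. \<exists>Q\<in>A. card P = i \<and> card Q = j \<and> card (P - Q) = x"
    if "\<sigma> permutes {1..n}" "i \<in> L" "j \<in> L" "i < j" "x \<in> X \<union> Y" "\<sigma> \<notin> b i \<union> c i" "\<sigma> \<notin> b j \<union> c j"
      "\<sigma> ` {1..i} \<in> A" "\<sigma> ` {1..j} \<in> A" for \<sigma> i j x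
  proof (cases "x \<in> X")
    case True
    show ?thesis by (rule b(2)) (use that True in simp_all)
  next
    case False
    show ?thesis by (rule c(2)) (use that False in simp_all)
  qed
  ultimately show ?thesis
    unfolding layer_separating_def by (intro exI[of _ "\<lambda>i. b i \<union> c i"] conjI allI impI)
qed

lemma layer_separating_mono:
  assumes "layer_separating n A L \<eta> X" "L' \<subseteq> L" "finite L"
  shows "layer_separating n A L' \<eta> X"
proof -
  obtain b where b: "(\<Sum>i\<in>L. real (n choose i) * real (card {\<sigma>. \<sigma> permutes {1..n} \<and> \<sigma> \<in> b i})) \<le> \<eta> * 2 ^ n * fact n"
    "\<And>\<sigma> i j x. \<sigma> permutes {1..n} \<Longrightarrow> i \<in> L \<Longrightarrow> j \<in> L \<Longrightarrow> i < j \<Longrightarrow> x \<in> X \<Longrightarrow>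
      \<sigma> \<notin> b i \<Longrightarrow> \<sigma> \<notin> b j \<Longrightarrow> \<sigma> ` {1..i} \<in> A \<Longrightarrow> \<sigma> ` {1..j} \<in> A \<Longrightarrow>
      \<exists>P\<in>A. \<exists>Q\<in>A. card P = i \<and> card Q = j \<and> card (P - Q) = x"
    using assms(1) unfolding layer_separating_def by blast
  have "(\<Sum>i\<in>L'. real (n choose i) * real (card {\<sigma>. \<sigma> permutes {1..n} \<and> \<sigma> \<in> b i}))
      \<le> (\<Sum>i\<in>L. real (n choose i) * real (card {\<sigma>. \<sigma> permutes {1..n} \<and> \<sigma> \<in> b i}))"
    using assms(2,3) by (intro sum_mono2) auto
  moreover have "\<exists>P\<in>A. \<exists>Q\<in>A. card P = i \<and> card Q = j \<and> card (P - Q) = x"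
    if "\<sigma> permutes {1..n}" "i \<in> L'" "j \<in> L'" "i < j" "x \<in> X" "\<sigma> \<notin> b i" "\<sigma> \<notin> b j"
      "\<sigma> ` {1..i} \<in> A" "\<sigma> ` {1..j} \<in> A" for \<sigma> i j x
    by (rule b(2)) (use that assms(2) in auto)
  ultimately show ?thesis
    unfolding layer_separating_def using b(1) by (intro exI[of _ b] conjI allI impI) linarith
qed

lemma weight_ge:
  assumes "independent_set n E I"
  shows "(\<Sum>i\<in>I. n choose i) \<le> weight n E"
proof -
  have "{\<Sum>i\<in>I. n choose i | I. independent_set n E I} \<subseteq> (\<lambda>I. \<Sum>i\<in>I. n choose i) ` Pow {0..n}"
    by (auto simp: independent_set_def)
  then have "finite {\<Sum>i\<in>I. n choose i | I. independent_set n E I}"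
    by (rule finite_subset) simp
  then show ?thesis unfolding weight_def using assms by (intro Max_ge) auto
qed

text \<open>For each chain the layers of \<open>L\<close> where it meets \<open>A\<close> and is not
  bad form an independent set, since an edge between two of them would have its forbidden difference
  realised. Their weight is at most \<open>weight n E\<close>. In the average over permutations bad
  layers add \<open>\<eta> * 2 ^ n\<close>, and layers outside \<open>L\<close> add
  \<open>\<tau> * 2 ^ n\<close>.\<close>

lemma sperner_bound:
  assumes E: "is_graph_on n E" and A: "A \<subseteq> Pow {1..n}" and sp: "GX_sperner E x A"
    and L: "L \<subseteq> {0..n}" and sep: "layer_separating n A L \<eta> X"
    and X: "\<And>i j. E i j \<Longrightarrow> i < j \<Longrightarrow> i \<in> L \<Longrightarrow> j \<in> L \<Longrightarrow> x i j \<in> X"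
    and tail: "(\<Sum>i\<in>{0..n} - L. real (n choose i)) \<le> \<tau> * 2 ^ n"
  shows "real (card A) \<le> real (weight n E) + (\<eta> + \<tau>) * 2 ^ n"
proof -
  obtain bad where bad: "(\<Sum>i\<in>L. real (n choose i) * real (card {\<sigma>. \<sigma> permutes {1..n} \<and> \<sigma> \<in> bad i})) \<le> \<eta> * 2 ^ n * fact n"
    "\<And>\<sigma> i j x. \<sigma> permutes {1..n} \<Longrightarrow> i \<in> L \<Longrightarrow> j \<in> L \<Longrightarrow> i < j \<Longrightarrow> x \<in> X \<Longrightarrow>
      \<sigma> \<notin> bad i \<Longrightarrow> \<sigma> \<notin> bad j \<Longrightarrow> \<sigma> ` {1..i} \<in> A \<Longrightarrow> \<sigma> ` {1..j} \<in> A \<Longrightarrow>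
      \<exists>P\<in>A. \<exists>Q\<in>A. card P = i \<and> card Q = j \<and> card (P - Q) = x"
    using sep unfolding layer_separating_def by blast
  define S where "S = {\<sigma>. \<sigma> permutes {1..n}}"
  define I where "I \<sigma> = {i \<in> L. \<sigma> ` {1..i} \<in> A \<and> \<sigma> \<notin> bad i}" for \<sigma>
  have finS: "finite S" unfolding S_def by (rule finite_permutations) simp
  have cardS: "card S = fact n" unfolding S_def by (simp add: card_permutations[of _ n])
  have finL: "finite L" using L finite_subset by blast
  have ind: "independent_set n E (I \<sigma>)" if "\<sigma> \<in> S" for \<sigma>
  proof -
    have no: "\<not> E i j" if ij: "i \<in> I \<sigma>" "j \<in> I \<sigma>" "i < j" for i j
    proof
      assume e: "E i j"
      obtain P Q where "P \<in> A" "Q \<in> A" "card P = i" "card Q = j" "card (P - Q) = x i j"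
        using bad(2)[of \<sigma> i j "x i j"] X[OF e ij(3)] ij \<open>\<sigma> \<in> S\<close> by (auto simp: I_def S_def)
      then show False using sp e ij(3) unfolding GX_sperner_def by blast
    qed
    have "\<not> E i j" if "i \<in> I \<sigma>" "j \<in> I \<sigma>" for i j
      using no[of i j] no[of j i] that E unfolding is_graph_on_def by (metis linorder_neqE_nat)
    then show ?thesis using L by (auto simp: independent_set_def I_def)
  qed
  have finA: "finite A" using A by (rule finite_subset) simp
  have layer: "fact n * real (card {B \<in> A. card B = i})
      \<le> (\<Sum>\<sigma>\<in>S. if i \<in> I \<sigma> then real (n choose i) else 0)
        + real (n choose i) * real (card {\<sigma>. \<sigma> permutes {1..n} \<and> \<sigma> \<in> bad i})" if i: "i \<in> L" for i
  proof -
    have "i \<le> n" using i L by auto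
    have "fact n * real (card {B \<in> A. card B = i}) = real (fact n * card {B \<in> A. card B = i})" by simp
    also have "\<dots> = real ((n choose i) * card {\<sigma>. \<sigma> permutes {1..n} \<and> \<sigma> ` {1..i} \<in> A})"
      by (simp only: card_permutes_layer[OF A \<open>i \<le> n\<close>])
    also have "\<dots> = real (n choose i) * real (card {\<sigma> \<in> S. \<sigma> ` {1..i} \<in> A})" by (simp add: S_def)
    also have "\<dots> \<le> real (n choose i) * (real (card {\<sigma> \<in> S. i \<in> I \<sigma>}) + real (card {\<sigma>. \<sigma> permutes {1..n} \<and> \<sigma> \<in> bad i}))"
    proof (rule mult_left_mono)
      have "card {\<sigma> \<in> S. \<sigma> ` {1..i} \<in> A} \<le> card ({\<sigma> \<in> S. i \<in> I \<sigma>} \<union> {\<sigma> \<in> S. \<sigma> \<in> bad i})"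
        using finS i by (intro card_mono) (auto simp: I_def)
      also have "\<dots> \<le> card {\<sigma> \<in> S. i \<in> I \<sigma>} + card {\<sigma> \<in> S. \<sigma> \<in> bad i}" by (rule card_Un_le)
      finally show "real (card {\<sigma> \<in> S. \<sigma> ` {1..i} \<in> A})
          \<le> real (card {\<sigma> \<in> S. i \<in> I \<sigma>}) + real (card {\<sigma>. \<sigma> permutes {1..n} \<and> \<sigma> \<in> bad i})"
        by (simp add: S_def)
    qed simp
    also have "\<dots> = (\<Sum>\<sigma>\<in>S. if i \<in> I \<sigma> then real (n choose i) else 0)
        + real (n choose i) * real (card {\<sigma>. \<sigma> permutes {1..n} \<and> \<sigma> \<in> bad i})"
    proof -
      have "(\<Sum>\<sigma>\<in>S. if i \<in> I \<sigma> then real (n choose i) else 0) = (\<Sum>\<sigma>\<in>{\<sigma> \<in> S. i \<in> I \<sigma>}. real (n choose i))"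
        using finS by (intro sum.mono_neutral_cong_right) auto
      then show ?thesis by (simp add: algebra_simps)
    qed
    finally show ?thesis .
  qed
  have "fact n * (\<Sum>i\<in>L. real (card {B \<in> A. card B = i}))
      \<le> (\<Sum>i\<in>L. (\<Sum>\<sigma>\<in>S. if i \<in> I \<sigma> then real (n choose i) else 0)
        + real (n choose i) * real (card {\<sigma>. \<sigma> permutes {1..n} \<and> \<sigma> \<in> bad i}))"
    unfolding sum_distrib_left by (rule sum_mono) (rule layer)
  also have "\<dots> \<le> (\<Sum>i\<in>L. \<Sum>\<sigma>\<in>S. if i \<in> I \<sigma> then real (n choose i) else 0) + \<eta> * 2 ^ n * fact n"
    unfolding sum.distrib using bad(1) by (rule add_left_mono)
  \<comment> \<open>From here the count runs chain by chain instead of layer by layer.\<close>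
  also have "(\<Sum>i\<in>L. \<Sum>\<sigma>\<in>S. if i \<in> I \<sigma> then real (n choose i) else 0)
      = (\<Sum>\<sigma>\<in>S. \<Sum>i\<in>L. if i \<in> I \<sigma> then real (n choose i) else 0)" by (rule sum.swap)
  also have "\<dots> \<le> (\<Sum>\<sigma>\<in>S. real (weight n E))"
  proof (rule sum_mono)
    fix \<sigma> assume "\<sigma> \<in> S"
    have "(\<Sum>i\<in>L. if i \<in> I \<sigma> then real (n choose i) else 0) = (\<Sum>i\<in>I \<sigma>. real (n choose i))"
      using finL by (intro sum.mono_neutral_cong_right) (auto simp: I_def)
    also have "\<dots> = real (\<Sum>i\<in>I \<sigma>. n choose i)" by simp
    also have "\<dots> \<le> real (weight n E)" by (intro of_nat_mono weight_ge ind \<open>\<sigma> \<in> S\<close>)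
    finally show "(\<Sum>i\<in>L. if i \<in> I \<sigma> then real (n choose i) else 0) \<le> real (weight n E)" .
  qed
  also have "(\<Sum>\<sigma>\<in>S. real (weight n E)) = fact n * real (weight n E)" by (simp add: cardS)
  finally have "fact n * (\<Sum>i\<in>L. real (card {B \<in> A. card B = i}))
      \<le> fact n * (real (weight n E) + \<eta> * 2 ^ n)" by (simp add: algebra_simps)
  then have main: "(\<Sum>i\<in>L. real (card {B \<in> A. card B = i})) \<le> real (weight n E) + \<eta> * 2 ^ n"
    by (rule mult_left_le_imp_le) simp
  have small: "real (card {B \<in> A. card B = i}) \<le> real (n choose i)" for i
  proof -
    have "card {B \<in> A. card B = i} \<le> card {B. B \<subseteq> {1..n} \<and> card B = i}"
      using A by (intro card_mono) auto
    then show ?thesis by (simp add: n_subsets)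
  qed
  have "card B \<le> n" if "B \<in> A" for B
    using card_mono[of "{1..n}" B] A that by auto
  then have "(\<Union>i\<in>{0..n}. {B \<in> A. card B = i}) = A" by auto
  then have "card A = card (\<Union>i\<in>{0..n}. {B \<in> A. card B = i})" by simp
  also have "\<dots> = (\<Sum>i\<in>{0..n}. card {B \<in> A. card B = i})" using finA by (intro card_UN_disjoint) auto
  finally have "real (card A) = (\<Sum>i\<in>{0..n}. real (card {B \<in> A. card B = i}))" by simp
  also have "\<dots> = (\<Sum>i\<in>{0..n} - L. real (card {B \<in> A. card B = i})) + (\<Sum>i\<in>L. real (card {B \<in> A. card B = i}))"
    using L by (intro sum.subset_diff) auto
  also have "(\<Sum>i\<in>{0..n} - L. real (card {B \<in> A. card B = i})) \<le> (\<Sum>i\<in>{0..n} - L. real (n choose i))"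
    by (intro sum_mono small)
  finally show ?thesis using main tail by (simp add: algebra_simps)
qed

section \<open>Planting codes into chains\<close>

text \<open>A code with words of \<open>u\<close> points inside an \<open>m\<close>-point set is planted into
  the template \<open>{1..n}\<close>; layer \<open>i\<close> consists of the planted words together with
  the initial segment \<open>{u+1..i}\<close> of the remaining points. The permutation \<open>\<kappa>\<close>
  turns the set of layer \<open>i\<close> coming from one particular word into \<open>{1..i}\<close>.\<close>
lemma layer_separating_code:
  fixes w :: "'o \<Rightarrow> 'p set"
  assumes fin: "finite \<Omega>" "\<Omega> \<noteq> {}" and sep: "separating \<Omega> \<delta> \<eta> X"
    and T: "finite T" "card T = m" and w: "\<And>\<omega>. \<omega> \<in> \<Omega> \<Longrightarrow> w \<omega> \<subseteq> T \<and> card (w \<omega>) = u"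
    and \<delta>: "\<And>a b. a \<in> \<Omega> \<Longrightarrow> b \<in> \<Omega> \<Longrightarrow> card (w a - w b) = \<delta> a b"
    and mn: "m \<le> n" and \<eta>: "0 \<le> \<eta>"
  shows "layer_separating n A {u..n + u - m} \<eta> X"
proof -
  define v where "v = n + u - m"
  define S where "S = {\<sigma>. \<sigma> permutes {1..n}}"
  have um: "u \<le> m"
  proof -
    obtain \<omega> where "\<omega> \<in> \<Omega>" using fin(2) by blast
    then show ?thesis using w[of \<omega>] T card_mono[of T "w \<omega>"] by auto
  qed
  have uv: "u \<le> v" "v \<le> n" using um mn by (auto simp: v_def)
  \<comment> \<open>The gap \<open>{u+1..v}\<close> between the two pieces holds the growing
    segments; \<open>v\<close> is chosen so that \<open>T0\<close> has exactly \<open>m\<close>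
    points.\<close>
  define T0 where "T0 = {1..u} \<union> {v+1..n}"
  have T0: "finite T0" "card T0 = m" "T0 \<subseteq> {1..n}"
  proof -
    have "card T0 = card {1..u} + card {v+1..n}"
      unfolding T0_def using uv by (intro card_Un_disjoint) auto
    then show "card T0 = m" using um mn by (simp add: v_def)
  qed (use uv in \<open>auto simp: T0_def\<close>)
  obtain \<iota> where \<iota>: "bij_betw \<iota> T T0" using finite_same_card_bij[OF T(1) T0(1)] T(2) T0(2) by metis
  have inj: "inj_on \<iota> T" using \<iota> by (simp add: bij_betw_def)
  define \<tau> where "\<tau> \<omega> i = \<iota> ` w \<omega> \<union> {u+1..i}" for \<omega> i
  have \<iota>w: "\<iota> ` w \<omega> \<subseteq> T0" "card (\<iota> ` w \<omega>) = u" if "\<omega> \<in> \<Omega>" for \<omega>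
    using w[OF that] \<iota> card_image[OF inj_on_subset[OF inj]] by (auto simp: bij_betw_def)
  have dis: "T0 \<inter> {u+1..i} = {}" if "i \<le> v" for i using that by (auto simp: T0_def)
  have card\<tau>: "card (\<tau> \<omega> i) = i" if "\<omega> \<in> \<Omega>" "u \<le> i" "i \<le> v" for \<omega> i
  proof -
    have "card (\<tau> \<omega> i) = card (\<iota> ` w \<omega>) + card {u+1..i}"
      unfolding \<tau>_def using \<iota>w[OF that(1)] dis[OF that(3)] T0(1) finite_subset by (intro card_Un_disjoint) auto
    then show ?thesis using \<iota>w[OF that(1)] that by simp
  qed
  \<comment> \<open>Since \<open>i \<le> j\<close>, the segment of layer \<open>i\<close> lies
    inside that of layer \<open>j\<close> and drops out of the difference.\<close>
  have diff\<tau>: "card (\<tau> a i - \<tau> b j) = \<delta> a b" if "a \<in> \<Omega>" "b \<in> \<Omega>" "i \<le> j" "j \<le> v" for a b i j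
  proof -
    have "\<tau> a i - \<tau> b j = \<iota> ` w a - \<iota> ` w b"
      unfolding \<tau>_def using \<iota>w(1)[OF that(1)] dis[OF that(4)] that(3) by auto
    also have "\<dots> = \<iota> ` (w a - w b)"
      using w[OF that(1)] w[OF that(2)] by (intro inj_on_image_set_diff[OF inj, symmetric]) auto
    also have "card \<dots> = card (w a - w b)"
      using w[OF that(1)] by (intro card_image inj_on_subset[OF inj]) auto
    finally show ?thesis using \<delta>[OF that(1,2)] by simp
  qed
  obtain exc where exc: "\<And>U. U \<subseteq> \<Omega> \<Longrightarrow> exc U \<subseteq> U \<and> real (card (exc U)) \<le> \<eta> * real (card \<Omega>)"
    "\<And>U V x \<omega>. U \<subseteq> \<Omega> \<Longrightarrow> V \<subseteq> \<Omega> \<Longrightarrow> x \<in> X \<Longrightarrow> \<omega> \<in> U \<Longrightarrow> \<omega> \<in> V \<Longrightarrow> \<omega> \<notin> exc U \<Longrightarrow> \<omega> \<notin> exc V \<Longrightarrow>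
      \<exists>a\<in>U. \<exists>b\<in>V. \<delta> a b = x"
    using sep unfolding separating_def by (metis IntI)
  define U where "U i \<sigma> = {\<omega> \<in> \<Omega>. \<sigma> ` \<tau> \<omega> i \<in> A}" for i and \<sigma> :: "nat \<Rightarrow> nat"
  have UO: "U i \<sigma> \<subseteq> \<Omega>" for i \<sigma> by (auto simp: U_def)
  define c where "c i \<omega> = card {\<sigma>. \<sigma> permutes {1..n} \<and> \<omega> \<in> exc (U i \<sigma>)}" for i \<omega>
  have finS: "finite S" unfolding S_def by (rule finite_permutations) simp
  have cardS: "card S = fact n" unfolding S_def by (simp add: card_permutations[of _ n])
  \<comment> \<open>Double counting: each permutation makes at most
    \<open>\<eta> * card \<Omega>\<close> codewords exceptional.\<close>
  have csum: "(\<Sum>\<omega>\<in>\<Omega>. real (c i \<omega>)) \<le> fact n * (\<eta> * real (card \<Omega>))" for i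
  proof -
    have "(\<Sum>\<omega>\<in>\<Omega>. real (c i \<omega>)) = (\<Sum>\<omega>\<in>\<Omega>. \<Sum>\<sigma>\<in>S. if \<omega> \<in> exc (U i \<sigma>) then 1 else 0)"
    proof (rule sum.cong[OF refl])
      fix \<omega>
      have "(\<Sum>\<sigma>\<in>S. if \<omega> \<in> exc (U i \<sigma>) then 1 else 0 :: real) = (\<Sum>\<sigma>\<in>{\<sigma> \<in> S. \<omega> \<in> exc (U i \<sigma>)}. 1)"
        using finS by (intro sum.mono_neutral_cong_right) auto
      then show "real (c i \<omega>) = (\<Sum>\<sigma>\<in>S. if \<omega> \<in> exc (U i \<sigma>) then 1 else 0)"
        by (simp add: c_def S_def)
    qed
    also have "\<dots> = (\<Sum>\<sigma>\<in>S. \<Sum>\<omega>\<in>\<Omega>. if \<omega> \<in> exc (U i \<sigma>) then 1 else 0)" by (rule sum.swap)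
    also have "\<dots> \<le> (\<Sum>\<sigma>\<in>S. \<eta> * real (card \<Omega>))"
    proof (rule sum_mono)
      fix \<sigma>
      have "(\<Sum>\<omega>\<in>\<Omega>. if \<omega> \<in> exc (U i \<sigma>) then 1 else 0 :: real) = (\<Sum>\<omega>\<in>exc (U i \<sigma>). 1)"
        using fin(1) exc(1)[OF UO, of i \<sigma>] UO[of i \<sigma>] by (intro sum.mono_neutral_cong_right) auto
      then show "(\<Sum>\<omega>\<in>\<Omega>. if \<omega> \<in> exc (U i \<sigma>) then 1 else 0) \<le> \<eta> * real (card \<Omega>)"
        using exc(1)[OF UO, of i \<sigma>] by simp
    qed
    finally show ?thesis by (simp add: cardS)
  qed
  \<comment> \<open>A codeword whose total cost is at most the average. One \<open>\<omega>\<close>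
    must serve all layers, because their sets have to form a single chain.\<close>
  have "\<exists>\<omega>\<in>\<Omega>. (\<Sum>i\<in>{u..v}. real (n choose i) * real (c i \<omega>)) \<le> \<eta> * 2 ^ n * fact n"
  proof (rule ccontr)
    assume "\<not> ?thesis"
    then have "(\<Sum>\<omega>\<in>\<Omega>. \<eta> * 2 ^ n * fact n) < (\<Sum>\<omega>\<in>\<Omega>. \<Sum>i\<in>{u..v}. real (n choose i) * real (c i \<omega>))"
      using fin by (intro sum_strict_mono) (auto simp: not_le)
    also have "\<dots> = (\<Sum>i\<in>{u..v}. real (n choose i) * (\<Sum>\<omega>\<in>\<Omega>. real (c i \<omega>)))"
      unfolding sum_distrib_left by (rule sum.swap)
    also have "\<dots> \<le> (\<Sum>i\<in>{u..v}. real (n choose i) * (fact n * (\<eta> * real (card \<Omega>))))"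
      by (intro sum_mono mult_left_mono csum) auto
    also have "\<dots> = real (\<Sum>i\<in>{u..v}. n choose i) * (fact n * (\<eta> * real (card \<Omega>)))"
      by (simp add: sum_distrib_right)
    also have "\<dots> \<le> real (2 ^ n) * (fact n * (\<eta> * real (card \<Omega>)))"
    proof (intro mult_right_mono of_nat_mono)
      have "(\<Sum>i\<in>{u..v}. n choose i) \<le> (\<Sum>i\<le>n. n choose i)" using uv by (intro sum_mono2) auto
      then show "(\<Sum>i\<in>{u..v}. n choose i) \<le> 2 ^ n" by (simp add: choose_row_sum)
    qed (use \<eta> in auto)
    finally show False by (simp add: mult_ac)
  qed
  then obtain \<omega> where \<omega>: "\<omega> \<in> \<Omega>"
    "(\<Sum>i\<in>{u..v}. real (n choose i) * real (c i \<omega>)) \<le> \<eta> * 2 ^ n * fact n" by blast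
  obtain \<kappa> where \<kappa>: "\<kappa> permutes T0" "\<kappa> ` (\<iota> ` w \<omega>) = {1..u}"
    using ex_permutes_image[OF T0(1) \<iota>w(1)[OF \<omega>(1)], of "{1..u}"] \<iota>w(2)[OF \<omega>(1)] by (auto simp: T0_def)
  have \<kappa>n: "\<kappa> permutes {1..n}" using \<kappa>(1) T0(3) by (rule permutes_subset)
  have \<kappa>\<tau>: "\<kappa> ` \<tau> \<omega> i = {1..i}" if "u \<le> i" "i \<le> v" for i
  proof -
    have "\<kappa> x = x" if "x \<in> {u+1..i}" for x
      using permutes_not_in[OF \<kappa>(1)] dis[OF \<open>i \<le> v\<close>] that by blast
    then have "\<kappa> ` {u+1..i} = {u+1..i}" by simp
    then have "\<kappa> ` \<tau> \<omega> i = {1..u} \<union> {u+1..i}" by (simp only: \<tau>_def image_Un \<kappa>(2))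
    also have "\<dots> = {1..i}" using that by auto
    finally show ?thesis .
  qed
  \<comment> \<open>The code is planted by \<open>\<sigma> \<circ> \<kappa>\<close>, so that the set
    of \<open>\<omega>\<close> in layer \<open>i\<close> becomes the chain set of
    \<open>\<sigma>\<close>. Composition with \<open>\<kappa>\<close> only rearranges the
    permutations and preserves the count \<open>c i \<omega>\<close>.\<close>
  define bad where "bad i = {\<sigma>. \<omega> \<in> exc (U i (\<sigma> \<circ> \<kappa>))}" for i
  have "card {\<sigma>. \<sigma> permutes {1..n} \<and> \<sigma> \<in> bad i} = c i \<omega>" for i
    unfolding c_def bad_def mem_Collect_eq
    by (rule card_permutes_compose[OF \<kappa>n, of "\<lambda>\<sigma>. \<omega> \<in> exc (U i \<sigma>)"])
  then have "(\<Sum>i\<in>{u..v}. real (n choose i) * real (card {\<sigma>. \<sigma> permutes {1..n} \<and> \<sigma> \<in> bad i})) \<le> \<eta> * 2 ^ n * fact n"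
    using \<omega>(2) by simp
  moreover have "\<exists>P\<in>A. \<exists>Q\<in>A. card P = i \<and> card Q = j \<and> card (P - Q) = x"
    if *: "\<sigma> permutes {1..n}" "i \<in> {u..v}" "j \<in> {u..v}" "i < j" "x \<in> X" "\<sigma> \<notin> bad i" "\<sigma> \<notin> bad j"
      "\<sigma> ` {1..i} \<in> A" "\<sigma> ` {1..j} \<in> A" for \<sigma> i j x
  proof -
    let ?\<rho> = "\<sigma> \<circ> \<kappa>"
    have inj\<rho>: "inj ?\<rho>" using permutes_compose[OF \<kappa>n *(1)] by (rule permutes_inj)
    have "?\<rho> ` \<tau> \<omega> l = \<sigma> ` {1..l}" if "l \<in> {u..v}" for l
      unfolding image_comp[symmetric] using \<kappa>\<tau> that by simp
    then have "\<omega> \<in> U i ?\<rho>" "\<omega> \<in> U j ?\<rho>" using * \<omega>(1) by (simp_all only: U_def mem_Collect_eq)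
    moreover have "\<omega> \<notin> exc (U i ?\<rho>)" "\<omega> \<notin> exc (U j ?\<rho>)" using *(6,7) by (auto simp: bad_def)
    ultimately obtain a b where ab: "a \<in> U i ?\<rho>" "b \<in> U j ?\<rho>" "\<delta> a b = x"
      using exc(2)[OF UO UO *(5)] by blast
    have O: "a \<in> \<Omega>" "b \<in> \<Omega>" using ab UO by auto
    have ci: "card (?\<rho> ` Y) = card Y" for Y using inj\<rho> by (intro card_image inj_on_subset[OF inj\<rho>]) auto
    have "card (?\<rho> ` \<tau> a i - ?\<rho> ` \<tau> b j) = card (?\<rho> ` (\<tau> a i - \<tau> b j))"
      by (simp only: image_set_diff[OF inj\<rho>])
    also have "\<dots> = x" unfolding ci using diff\<tau>[OF O] * ab(3) by simp
    finally have "card (?\<rho> ` \<tau> a i - ?\<rho> ` \<tau> b j) = x" .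
    moreover have "card (?\<rho> ` \<tau> a i) = i" "card (?\<rho> ` \<tau> b j) = j"
      unfolding ci using card\<tau> O * by auto
    moreover have "?\<rho> ` \<tau> a i \<in> A" "?\<rho> ` \<tau> b j \<in> A" using ab by (auto simp: U_def)
    ultimately show ?thesis by blast
  qed
  ultimately show ?thesis
    unfolding layer_separating_def v_def[symmetric] by (intro exI[of _ bad] conjI allI impI)
qed

text \<open>The graph of a function: each cube coordinate is recorded by one of two points, each
  letter by one of \<open>N\<close>. Hence all words have the same size, and the points of one word
  missing from another count the disagreements.\<close>

definition word :: "'a set \<Rightarrow> 'i set \<Rightarrow> 'a set \<times> ('i \<Rightarrow> nat) \<Rightarrow> ('a \<times> bool + 'i \<times> nat) set" where
  "word K I p = (\<lambda>x. (x, x \<in> fst p)) ` K <+> (\<lambda>i. (i, snd p i)) ` I"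

lemma card_word: "finite K \<Longrightarrow> finite I \<Longrightarrow> card (word K I p) = card K + card I"
  by (simp add: word_def card_Plus card_image inj_on_def)

lemma card_word_diff:
  assumes fin: "finite K" "finite I" and p: "fst p \<subseteq> K" "fst q \<subseteq> K"
  shows "card (word K I p - word K I q) = cdist I p q"
proof -
  have "word K I p - word K I q = (\<lambda>x. (x, x \<in> fst p)) ` sym_diff (fst p) (fst q)
      <+> (\<lambda>i. (i, snd p i)) ` {i \<in> I. snd p i \<noteq> snd q i}"
    using p by (auto simp: word_def image_iff)
  also have "card \<dots> = card ((\<lambda>x. (x, x \<in> fst p)) ` sym_diff (fst p) (fst q))
      + card ((\<lambda>i. (i, snd p i)) ` {i \<in> I. snd p i \<noteq> snd q i})"
    using fin p by (intro card_Plus) (auto intro: finite_subset)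
  also have "\<dots> = cdist I p q"
    by (simp add: cdist_def sdist_def ham_def card_image inj_on_def)
  finally show ?thesis .
qed

text \<open>The template has \<open>2 * card K + N * card I\<close> points, of which a word takes
  \<open>card K + card I\<close>. The conditions on \<open>i\<close> say that an
  \<open>i\<close>-set has room for a word and its complement has room for the rest of the
  template.\<close>

lemma layer_separating_word_code:
  assumes fin: "finite K" "finite I" and N: "0 < N" and \<eta>: "0 \<le> \<eta>"
    and sep: "separating (code K I N) (cdist I) \<eta> X"
    and L: "finite L" "\<And>i. i \<in> L \<Longrightarrow> card K + card I \<le> i \<and> i + card K + (N - 1) * card I \<le> n"
  shows "layer_separating n A L \<eta> X"
proof (cases "L = {}")
  case True
  then show ?thesis using \<eta> by (simp add: layer_separating_def)
next
  case False
  define T :: "('a \<times> bool + 'b \<times> nat) set" where "T = K \<times> UNIV <+> I \<times> {..<N}"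
  have "finite T" using fin by (simp add: T_def)
  have m: "card T = 2 * card K + N * card I"
    using fin by (simp add: T_def card_Plus card_cartesian_product)
  have split: "N * card I = card I + (N - 1) * card I" using N by (cases N) auto
  obtain l where "l \<in> L" using False by blast
  then have mn: "card T \<le> n" using L(2)[of l] m split by linarith
  have "layer_separating n A {card K + card I..n + (card K + card I) - card T} \<eta> X"
  proof (rule layer_separating_code[OF finite_code[OF fin] _ sep \<open>finite T\<close> refl _ _ mn \<eta>])
    have "({}, \<lambda>i\<in>I. 0) \<in> code K I N" using N by (auto simp: code_def)
    then show "code K I N \<noteq> {}" by blast
    fix p assume p: "p \<in> code K I N"
    then have "snd p i < N" if "i \<in> I" for i using that by (auto simp: code_def)
    then show "word K I p \<subseteq> T \<and> card (word K I p) = card K + card I"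
      using card_word[OF fin] by (auto simp: word_def T_def)
  next
    fix p q assume "p \<in> code K I N" "q \<in> code K I N"
    then show "card (word K I p - word K I q) = cdist I p q"
      by (intro card_word_diff fin) (auto simp: code_def)
  qed
  then show ?thesis
  proof (rule layer_separating_mono)
    show "L \<subseteq> {card K + card I..n + (card K + card I) - card T}"
    proof
      fix i assume "i \<in> L"
      then have "card K + card I \<le> i" "i + card K + (N - 1) * card I \<le> n" using L(2) by auto
      then show "i \<in> {card K + card I..n + (card K + card I) - card T}" using m split by auto
    qed
  qed simp
qed

section \<open>Choice of parameters\<close>

lemma near_mono:
  assumes "near K d X g" "d \<le> d'" "X' \<subseteq> X"
  shows "near K d' X' g"
  unfolding near_def
proof (intro allI impI ballI)
  fix U V x
  assume *: "U \<subseteq> Pow K" "V \<subseteq> Pow K" "d' * 2 ^ card K \<le> real (card U)" "d' * 2 ^ card K \<le> real (card V)" "x \<in> X'"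
  have "d * 2 ^ card K \<le> d' * 2 ^ card K" using assms(2) by (intro mult_right_mono) auto
  then have "d * 2 ^ card K \<le> real (card U)" "d * 2 ^ card K \<le> real (card V)" using *(3,4) by linarith+
  then show "\<exists>a\<in>U. \<exists>b\<in>V. sdist a b \<le> x \<and> x \<le> sdist a b + g"
    using nearD[OF assms(1) *(1,2)] *(5) assms(3) by blast
qed

text \<open>\<open>\<kappa>\<close> bounds the dimension from above, so one radius serves all
  smaller cubes. Rounding down is harmless, as isoperimetry compares with
  \<open>(R + 1)^2\<close>.\<close>

lemma near_cube_floor:
  assumes "finite K" "real (card K) \<le> \<kappa>" "1 < n" "1 / real n \<le> d"
    and R: "R = nat \<lfloor>sqrt (4 * \<kappa> * ln (real n))\<rfloor>"
  shows "near K d {R..card K + R} (2 * R)"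
proof (rule near_cube[OF assms(1)])
  show d: "0 < d" using assms(3,4) by (meson divide_pos_pos less_le_trans of_nat_0_less_iff zero_less_one less_trans)
  have "1 / d \<le> real n" using d assms(3,4) by (simp add: field_simps)
  then have "ln (1 / d) \<le> ln (real n)" using d by (intro ln_mono) auto
  moreover have L: "0 \<le> ln (real n)" using assms(3) by simp
  ultimately have "4 * real (card K) * ln (1 / d) \<le> 4 * real (card K) * ln (real n)"
    by (intro mult_left_mono) auto
  also have "\<dots> \<le> 4 * \<kappa> * ln (real n)" using assms(2) L by (intro mult_right_mono) auto
  also have "\<dots> < (real (R + 1))\<^sup>2"
  proof -
    have z: "0 \<le> 4 * \<kappa> * ln (real n)" using L assms(2) by (intro mult_nonneg_nonneg) auto
    have "sqrt (4 * \<kappa> * ln (real n)) < real R + 1" unfolding R using z by simp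
    then have "(sqrt (4 * \<kappa> * ln (real n)))\<^sup>2 < (real R + 1)\<^sup>2" using z by (intro power_strict_mono) auto
    then show ?thesis using z by (simp add: add.commute)
  qed
  finally show "4 * real (card K) * ln (1 / d) < (real (R + 1))\<^sup>2" .
qed

section \<open>Binomial tails\<close>

lemma card_Pow_card_in:
  assumes "finite S"
  shows "card {a \<in> Pow {1..n}. card a \<in> S} = (\<Sum>i\<in>S. n choose i)"
proof -
  have "{a \<in> Pow {1..n}. card a \<in> S} = (\<Union>i\<in>S. {a. a \<subseteq> {1..n} \<and> card a = i})" by auto
  also have "card \<dots> = (\<Sum>i\<in>S. card {a. a \<subseteq> {1..n} \<and> card a = i})"
    using assms by (intro card_UN_disjoint) auto
  finally show ?thesis by (simp add: n_subsets)
qed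

text \<open>Sets with fewer than \<open>n / 2 - s\<close> points are at distance more than
  \<open>s\<close> from those with at least \<open>n / 2\<close> points. The latter make up at least
  half of the cube by complementation, so isoperimetry bounds the number of the former.\<close>

lemma binomial_lower_tail:
  assumes "1 \<le> n" "0 \<le> s"
  shows "(\<Sum>i\<in>{i \<in> {0..n}. real i < real n / 2 - s}. real (n choose i)) \<le> 2 * exp (- (s\<^sup>2 / (2 * real n))) * 2 ^ n"
proof -
  define Lo where "Lo = {i \<in> {0..n}. real i < real n / 2 - s}"
  define U where "U = {a \<in> Pow {1..n}. card a \<in> Lo}"
  define V where "V = {a \<in> Pow {1..n}. real n / 2 \<le> real (card a)}"
  have cU: "(\<Sum>i\<in>Lo. real (n choose i)) = real (card U)"
    unfolding U_def by (subst card_Pow_card_in) (auto simp: Lo_def)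
  have finV: "finite V" by (simp add: V_def)
  have "2 ^ n = card (Pow {1..n})" by (simp add: card_Pow)
  also have "\<dots> \<le> card (V \<union> (\<lambda>a. {1..n} - a) ` V)"
  proof (rule card_mono)
    show "Pow {1..n} \<subseteq> V \<union> (\<lambda>a. {1..n} - a) ` V"
    proof
      fix a assume a: "a \<in> Pow {1..n}"
      then have c: "card ({1..n} - a) = n - card a" "card a \<le> n"
        using card_mono[of "{1..n}" a] by (auto simp: card_Diff_subset finite_subset)
      show "a \<in> V \<union> (\<lambda>a. {1..n} - a) ` V"
      proof (cases "real n / 2 \<le> real (card a)")
        case False
        then have "real n / 2 \<le> real (card ({1..n} - a))" using c by (simp add: of_nat_diff)
        then have "{1..n} - a \<in> V" by (auto simp: V_def)
        moreover have "a = {1..n} - ({1..n} - a)" using a by auto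
        ultimately show ?thesis by blast
      qed (use a in \<open>auto simp: V_def\<close>)
    qed
  qed (use finV in auto)
  also have "\<dots> \<le> card V + card V"
    using card_Un_le[of V "(\<lambda>a. {1..n} - a) ` V"] card_image_le[OF finV, of "\<lambda>a. {1..n} - a"] by linarith
  finally have "real (2 ^ n) \<le> real (card V + card V)" by (rule of_nat_mono)
  then have V: "2 ^ n \<le> 2 * real (card V)" by simp
  define D where "D = nat \<lceil>s\<rceil>"
  have "D \<le> sdist a b" if ab: "a \<in> U" "b \<in> V" for a b
  proof -
    have fin: "finite a" "finite b" using ab by (auto simp: U_def V_def intro: finite_subset)
    have "card b \<le> card (a \<union> sym_diff a b)" using fin by (intro card_mono) auto
    also have "\<dots> \<le> card a + sdist a b" unfolding sdist_def by (rule card_Un_le)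
    finally have "real (card b) \<le> real (card a) + real (sdist a b)" by linarith
    moreover have "real (card a) < real n / 2 - s" "real n / 2 \<le> real (card b)"
      using ab by (auto simp: U_def V_def Lo_def)
    ultimately have "s < real (sdist a b)" by linarith
    then show ?thesis by (simp add: D_def ceiling_le_iff nat_le_iff)
  qed
  then have "real (card U) * real (card V) \<le> 4 ^ card {1..n} * exp (- ((real D)\<^sup>2 / (2 * real (card {1..n}))))"
    by (intro separated_families) (auto simp: U_def V_def)
  also have "\<dots> \<le> 4 ^ n * exp (- (s\<^sup>2 / (2 * real n)))"
  proof -
    have "s\<^sup>2 \<le> (real D)\<^sup>2" using assms(2) unfolding D_def by (intro power_mono) (auto simp: real_nat_ceiling_ge)
    then have "s\<^sup>2 / (2 * real n) \<le> (real D)\<^sup>2 / (2 * real n)" by (rule divide_right_mono) simp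
    then show ?thesis by simp
  qed
  finally have UV: "real (card U) * real (card V) \<le> 4 ^ n * exp (- (s\<^sup>2 / (2 * real n)))" .
  have "real (card U) * 2 ^ n \<le> real (card U) * (2 * real (card V))" using V by (intro mult_left_mono) auto
  also have "\<dots> \<le> 2 * (4 ^ n * exp (- (s\<^sup>2 / (2 * real n))))" using UV by simp
  also have "\<dots> = (2 * exp (- (s\<^sup>2 / (2 * real n))) * 2 ^ n) * 2 ^ n"
    by (simp flip: power_mult_distrib)
  finally have "real (card U) \<le> 2 * exp (- (s\<^sup>2 / (2 * real n))) * 2 ^ n"
    by (rule mult_right_le_imp_le) simp
  then show ?thesis unfolding Lo_def[symmetric] cU .
qed

lemma binomial_tails:
  assumes "1 \<le> n" "0 \<le> s"
  shows "(\<Sum>i\<in>{0..n} - {i. real n / 2 - s \<le> real i \<and> real i \<le> real n / 2 + s}. real (n choose i))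
    \<le> 4 * exp (- (s\<^sup>2 / (2 * real n))) * 2 ^ n"
proof -
  define Lo where "Lo = {i \<in> {0..n}. real i < real n / 2 - s}"
  have eq: "{0..n} - {i. real n / 2 - s \<le> real i \<and> real i \<le> real n / 2 + s} = Lo \<union> (\<lambda>i. n - i) ` Lo"
  proof (intro equalityI subsetI)
    fix i assume i: "i \<in> {0..n} - {i. real n / 2 - s \<le> real i \<and> real i \<le> real n / 2 + s}"
    show "i \<in> Lo \<union> (\<lambda>i. n - i) ` Lo"
    proof (cases "real i < real n / 2 - s")
      case False
      then have "n - i \<in> Lo" "i = n - (n - i)" using i by (auto simp: Lo_def of_nat_diff)
      then show ?thesis by blast
    qed (use i in \<open>auto simp: Lo_def\<close>)
  qed (use assms in \<open>auto simp: Lo_def of_nat_diff\<close>)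
  have "(\<Sum>i\<in>Lo \<union> (\<lambda>i. n - i) ` Lo. real (n choose i))
      \<le> (\<Sum>i\<in>Lo. real (n choose i)) + (\<Sum>i\<in>(\<lambda>i. n - i) ` Lo. real (n choose i))"
    by (subst sum_Un) (auto simp: Lo_def intro!: sum_nonneg)
  also have "(\<Sum>i\<in>(\<lambda>i. n - i) ` Lo. real (n choose i)) = (\<Sum>i\<in>Lo. real (n choose (n - i)))"
    by (subst sum.reindex) (auto simp: Lo_def inj_on_def)
  also have "\<dots> = (\<Sum>i\<in>Lo. real (n choose i))"
    by (intro sum.cong refl arg_cong[of _ _ real] binomial_symmetric[symmetric]) (simp add: Lo_def)
  finally show ?thesis
    using binomial_lower_tail[OF assms] unfolding eq Lo_def[symmetric] by simp
qed

text \<open>Upper bounds for the radii \<open>R1\<close>, \<open>R2\<close>, \<open>R3\<close>: each is the isoperimetric radius of a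
  cube whose dimension is four times the preceding radius.\<close>
definition lvl1 :: "real \<Rightarrow> real" where "lvl1 x = 2 * sqrt (x * ln x)"
definition lvl2 :: "real \<Rightarrow> real" where "lvl2 x = sqrt (16 * lvl1 x * ln x)"
definition lvl3 :: "real \<Rightarrow> real" where "lvl3 x = sqrt (16 * lvl2 x * ln x)"

text \<open>Up to logarithms the radii are \<open>n^(1/2)\<close>, \<open>n^(1/4)\<close>,
  \<open>n^(1/8)\<close>. A correction by about \<open>lvl3\<close> costs its size divided by the
  number of disjoint moves, up to logarithms \<open>lvl3^2 / n\<close>, that is
  \<open>n^(-3/4)\<close>, which is below \<open>n^(-2/3)\<close>; stopping at \<open>lvl2\<close>
  would give only \<open>n^(-1/2)\<close>. The local \<open>N\<close> is a lower bound for the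
  number of disjoint moves in one block.\<close>

definition large :: "nat \<Rightarrow> bool" where
  "large n \<longleftrightarrow> (let x = real n; s = sqrt (x * ln x); M = 14 * ln x + 2;
     N = (x / (16 * M) - 1) / (lvl3 x + 1) - 1 in
     100 \<le> x \<and> 1 \<le> ln x \<and> 64 * x powr (2/3) \<le> x \<and>
     4 * lvl1 x + 4 * lvl2 x + 2 * lvl3 x + 1 \<le> x / 32 \<and> 2 * s \<le> x / 32 \<and>
     2 * (3 * ln x + 1) + 1 + lvl1 x + lvl2 x + lvl3 x \<le> 7 * s \<and>
     3 * ln x + 1 \<le> 3 * (lvl1 x - 1) \<and> 3 * ln x + 1 \<le> x / 64 \<and>
     0 < x / (8 * (2 * lvl3 x + 1)) - 1 \<and>
     2 * lvl3 x \<le> x powr (-2/3) * (x / (8 * (2 * lvl3 x + 1)) - 1) \<and>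
     0 < N \<and> M * lvl3 x \<le> x powr (-2/3) / 8 * N)"

lemma eventually_large: "eventually large sequentially"
  unfolding large_def Let_def lvl3_def lvl2_def lvl1_def
  by (intro eventually_conj; real_asymp)

lemma separating_weaken:
  assumes "separating \<Omega> \<delta> \<eta> X" "\<eta> \<le> \<eta>'"
  shows "separating \<Omega> \<delta> \<eta>' X"
proof -
  have "\<eta> * real (card \<Omega>) \<le> \<eta>' * real (card \<Omega>)" using assms(2) by (rule mult_right_mono) simp
  then have le: "c \<le> \<eta>' * real (card \<Omega>)" if "c \<le> \<eta> * real (card \<Omega>)" for c using that by linarith
  show ?thesis
    using assms(1) unfolding separating_def
    by (elim ex_forward all_forward[where P' = "\<lambda>U. U \<subseteq> \<Omega> \<longrightarrow> _ U"] imp_forward[where P = "_ \<subseteq> \<Omega>"] conj_forward) (assumption | erule le)+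
qed

lemma real_div_minus_nat_div_le: "real m / real d - real (m div d) \<le> 1"
  using real_of_int_div3[of "int m" "int d"] by (simp flip: zdiv_int)

section \<open>Parameters for one large order\<close>

locale large_order =
  fixes n :: nat
  assumes large: "large n"
begin

definition s :: real where "s = sqrt (real n * ln (real n))"
definition \<epsilon> :: real where "\<epsilon> = real n powr (-2/3)"
definition R1 :: nat where "R1 = nat \<lfloor>sqrt (4 * real n * ln (real n))\<rfloor>"
text \<open>Four times the preceding radius lets the range of this cube absorb the preceding error
  \<open>2 * R1\<close> and, as \<open>g0 \<le> 3 * R1\<close>, reach up to where the range of the
  long code begins.\<close>

definition k2 :: nat where "k2 = 4 * R1"
definition R2 :: nat where "R2 = nat \<lfloor>sqrt (4 * real k2 * ln (real n))\<rfloor>"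
definition k3 :: nat where "k3 = 4 * R2"
definition R3 :: nat where "R3 = nat \<lfloor>sqrt (4 * real k3 * ln (real n))\<rfloor>"
definition layers :: "nat set" where
  "layers = {i. real n / 2 - 2 * s \<le> real i \<and> real i \<le> real n / 2 + 2 * s}"

lemma n_bounds: "100 \<le> real n" "1 \<le> ln (real n)" "64 * real n powr (2/3) \<le> real n" "0 < n"
  using large by (auto simp: large_def Let_def)

lemma s_pos: "0 < s"
  using n_bounds by (simp add: s_def)

lemma R_le: "real R1 \<le> lvl1 n" "real R2 \<le> lvl2 n" "real R3 \<le> lvl3 n" "lvl1 n - 1 \<le> real R1"
proof -
  have eq: "sqrt (4 * real n * ln (real n)) = lvl1 n"
    by (simp add: lvl1_def real_sqrt_mult)
  have fl: "real (nat \<lfloor>sqrt z\<rfloor>) \<le> sqrt z" if "0 \<le> z" for z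
    using that by simp
  have nn: "0 \<le> 4 * real n * ln (real n)" using n_bounds by (intro mult_nonneg_nonneg) auto
  show R1: "real R1 \<le> lvl1 n" unfolding R1_def eq[symmetric] using nn by (rule fl)
  show "lvl1 n - 1 \<le> real R1" unfolding R1_def eq using nn eq[symmetric] by simp
  have 2: "0 \<le> 4 * real k2 * ln (real n)" using n_bounds by (intro mult_nonneg_nonneg) auto
  have "4 * real k2 * ln (real n) \<le> 16 * lvl1 n * ln (real n)"
    using R1 n_bounds by (intro mult_right_mono) (auto simp: k2_def)
  then show R2: "real R2 \<le> lvl2 n"
    unfolding R2_def lvl2_def using fl[OF 2] real_sqrt_le_mono by (meson order_trans)
  have 3: "0 \<le> 4 * real k3 * ln (real n)" using n_bounds by (intro mult_nonneg_nonneg) auto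
  have "4 * real k3 * ln (real n) \<le> 16 * lvl2 n * ln (real n)"
    using R2 n_bounds by (intro mult_right_mono) (auto simp: k3_def)
  then show "real R3 \<le> lvl3 n"
    unfolding R3_def lvl3_def using fl[OF 3] real_sqrt_le_mono by (meson order_trans)
qed

lemma size_bounds: "real k2 + real k3 + 2 * real R3 + 1 \<le> real n / 32" "2 * s \<le> real n / 32"
proof -
  have "4 * lvl1 n + 4 * lvl2 n + 2 * lvl3 n + 1 \<le> real n / 32" "2 * s \<le> real n / 32"
    using large by (auto simp: large_def Let_def s_def)
  then show "real k2 + real k3 + 2 * real R3 + 1 \<le> real n / 32" "2 * s \<le> real n / 32"
    using R_le by (auto simp: k2_def k3_def)
qed

lemma eps: "0 < \<epsilon>" "64 / \<epsilon> \<le> real n" "1 / real n \<le> \<epsilon> / 64"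
proof -
  have e: "\<epsilon> = 1 / real n powr (2/3)" using powr_minus_divide[of "real n" "2/3"] by (simp add: \<epsilon>_def)
  show p: "0 < \<epsilon>" using n_bounds by (simp add: \<epsilon>_def)
  show 1: "64 / \<epsilon> \<le> real n" using n_bounds(3) by (simp add: e)
  then show "1 / real n \<le> \<epsilon> / 64" using p n_bounds by (simp add: field_simps)
qed

lemma near1: "finite K \<Longrightarrow> card K \<le> n \<Longrightarrow> 1 / real n \<le> d \<Longrightarrow> near K d {R1..card K + R1} (2 * R1)"
  using n_bounds by (intro near_cube_floor[of K "real n" n]) (auto simp: R1_def)

lemma near2: "finite K \<Longrightarrow> card K = k2 \<Longrightarrow> 1 / real n \<le> d \<Longrightarrow> near K d {R2..k2 + R2} (2 * R2)"
  using near_cube_floor[of K "real k2" n d R2] n_bounds by (auto simp: R2_def)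

lemma near3: "finite K \<Longrightarrow> card K = k3 \<Longrightarrow> 1 / real n \<le> d \<Longrightarrow> near K d {R3..k3 + R3} (2 * R3)"
  using near_cube_floor[of K "real k3" n d R3] n_bounds by (auto simp: R3_def)

lemma near23:
  assumes "finite A" "finite B" "A \<inter> B = {}" "card A = k2" "card B = k3" "1 / real n \<le> d"
  shows "near (A \<union> B) (2 * d) {R2 + R3..k2 + R2 + R3} (2 * R3)"
proof -
  have d: "0 < d" using assms(6) n_bounds by (smt (verit) divide_pos_pos)
  have "near (A \<union> B) (2 * d) ((\<lambda>x. x + R3) ` {R2..k2 + R2}) (2 * R3)"
    using assms by (intro near_Un[OF _ _ _ d near2 near3]) (auto simp: k3_def)
  then show ?thesis by simp
qed

text \<open>The error shrinks from \<open>2 * R1\<close> through \<open>2 * R2\<close> to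
  \<open>2 * R3\<close>, while the density threshold doubles at each of the two refinements.\<close>

lemma near123:
  assumes "finite A" "finite B" "finite C" "A \<inter> B = {}" "(A \<union> B) \<inter> C = {}"
    "card A \<le> n" "card B = k2" "card C = k3" "1 / real n \<le> d"
  shows "near (A \<union> B \<union> C) (4 * d) {R1 + R2 + R3..card A + R1 + R2 + R3} (2 * R3)"
proof -
  have d: "0 < d" "1 / real n \<le> 2 * d" using assms(9) n_bounds by (smt (verit) divide_pos_pos)+
  have "near (A \<union> B) (2 * d) ((\<lambda>x. x + R2) ` {R1..card A + R1}) (2 * R2)"
    using assms by (intro near_Un[OF _ _ _ d(1) near1 near2]) (auto simp: k2_def)
  then have "near (A \<union> B \<union> C) (2 * (2 * d)) ((\<lambda>x. x + R3) ` ((\<lambda>x. x + R2) ` {R1..card A + R1})) (2 * R3)"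
    using assms d by (intro near_Un[OF _ _ _ _ _ near3]) (auto simp: k3_def)
  then show ?thesis by simp
qed

lemma layers_finite: "finite layers" "layers \<subseteq> {0..n}"
proof -
  have "i \<le> n" if "i \<in> layers" for i using that size_bounds s_pos by (auto simp: layers_def)
  then show "layers \<subseteq> {0..n}" by auto
  then show "finite layers" by (rule finite_subset) simp
qed

lemma separating_short:
  fixes K :: "nat set"
  assumes "finite K" "card K \<le> k2 + k3" "near K \<epsilon> X (2 * R3)"
  shows "layer_separating n A layers (2 * \<epsilon>) X"
proof -
  \<comment> \<open>\<open>2 * R3\<close> letters can make up every shortfall. The divisor gives
    \<open>N * g \<le> n / 8\<close>, so the letters fit into layers near the middle, while
    \<open>g / N \<le> \<epsilon>\<close> still holds.\<close>
  define g N where "g = 2 * R3" and "N = n div (8 * (g + 1))"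
  have N1: "real n / (8 * (2 * lvl3 n + 1)) - 1 \<le> real N"
  proof -
    have "real n / (8 * (2 * lvl3 n + 1)) \<le> real n / real (8 * (g + 1))"
      using R_le(3) n_bounds by (intro divide_left_mono mult_pos_pos) (auto simp: g_def)
    moreover have "real n / real (8 * (g + 1)) - real N \<le> 1" unfolding N_def by (rule real_div_minus_nat_div_le)
    ultimately show ?thesis by linarith
  qed
  have big: "0 < real n / (8 * (2 * lvl3 n + 1)) - 1"
    "2 * lvl3 n \<le> \<epsilon> * (real n / (8 * (2 * lvl3 n + 1)) - 1)"
    using large by (auto simp: large_def Let_def \<epsilon>_def)
  then have N0: "0 < N" using N1 by (metis less_le_trans of_nat_0_less_iff)
  have "real g \<le> 2 * lvl3 n" using R_le(3) by (simp add: g_def)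
  also have "\<dots> \<le> \<epsilon> * real N" using big(2) mult_left_mono[OF N1, of \<epsilon>] eps(1) by linarith
  finally have "real g / real N \<le> \<epsilon>" using N0 by (simp add: field_simps)
  then have \<eta>: "\<epsilon> + real g / real N \<le> 2 * \<epsilon>" by simp
  have "8 * (N * g) \<le> N * (8 * (g + 1))" by simp
  also have "\<dots> \<le> n" unfolding N_def by (rule div_times_less_eq_dividend)
  finally have "real (8 * (N * g)) \<le> real n" by (rule of_nat_mono)
  then have Ng: "real (N * g) \<le> real n / 8" by simp
  have "separating (code K {..<g} N) (cdist {..<g}) (\<epsilon> + real g / real N) X"
    using assms(3) by (intro separating_moves assms(1) eps N0) (simp add: g_def)
  then have sep: "separating (code K {..<g} N) (cdist {..<g}) (2 * \<epsilon>) X"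
    using \<eta> by (rule separating_weaken)
  show ?thesis
  proof (rule layer_separating_word_code[OF assms(1) _ N0 _ sep])
    fix i assume i: "i \<in> layers"
    have small: "real (card K) + real g \<le> real n / 32"
      using assms(2) size_bounds(1) by (simp add: g_def)
    have "real (card K + card {..<g}) \<le> real i"
      using i small size_bounds(2) n_bounds by (simp add: layers_def)
    moreover have "(N - 1) * card {..<g} \<le> N * g" by simp
    then have "real ((N - 1) * card {..<g}) \<le> real n / 8" using Ng by linarith
    then have "real (i + card K + (N - 1) * card {..<g}) \<le> real n"
      using i small size_bounds(2) n_bounds by (simp add: layers_def)
    ultimately show "card K + card {..<g} \<le> i \<and> i + card K + (N - 1) * card {..<g} \<le> n"
      by (simp only: of_nat_le_iff)
  qed (use eps layers_finite in auto)
qed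

definition g0 :: nat where "g0 = nat \<lceil>3 * ln (real n)\<rceil>"
text \<open>The longest cube that fits beside \<open>g0\<close> ternary letters: a layer of size up
  to \<open>n / 2 + 2 * s\<close> must leave \<open>k + 2 * g0\<close> points outside.\<close>

definition k :: nat where "k = nat \<lfloor>real n / 2 - 2 * s\<rfloor> - 2 * g0"
definition M :: nat where "M = nat \<lceil>14 * ln (real n)\<rceil> + 1"
text \<open>\<open>M\<close> blocks of this size fill at most a quarter of the cube, and each has
  room for \<open>N0\<close> disjoint sets of size \<open>R3\<close>.\<close>

definition b :: nat where "b = k div (4 * M)"
definition N0 :: nat where "N0 = b div (R3 + 1)"

lemma g0_bounds: "3 * ln (real n) \<le> real g0" "real g0 \<le> 3 * ln (real n) + 1" "real g0 \<le> real n / 64"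
  "g0 \<le> 3 * R1" "2 * real g0 + 1 + real R1 + real R2 + real R3 \<le> 7 * s"
proof -
  have L: "0 \<le> 3 * ln (real n)" using n_bounds by simp
  show "3 * ln (real n) \<le> real g0" unfolding g0_def by (rule real_nat_ceiling_ge)
  show g: "real g0 \<le> 3 * ln (real n) + 1" unfolding g0_def using L by simp
  have big: "2 * (3 * ln (real n) + 1) + 1 + lvl1 n + lvl2 n + lvl3 n \<le> 7 * s"
    "3 * ln (real n) + 1 \<le> 3 * (lvl1 n - 1)" "3 * ln (real n) + 1 \<le> real n / 64"
    using large by (auto simp: large_def Let_def s_def)
  show "real g0 \<le> real n / 64" using g big(3) by linarith
  have "real g0 \<le> real (3 * R1)" using g big(2) R_le(4) by simp
  then show "g0 \<le> 3 * R1" by (simp only: of_nat_le_iff)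
  have "2 * real g0 + 1 + real R1 + real R2 + real R3 \<le> 2 * (3 * ln (real n) + 1) + 1 + lvl1 n + lvl2 n + lvl3 n"
    by (intro add_mono mult_left_mono g R_le) auto
  also note big(1)
  finally show "2 * real g0 + 1 + real R1 + real R2 + real R3 \<le> 7 * s" .
qed

lemma k_bounds: "real k + 2 * real g0 \<le> real n / 2 - 2 * s" "real n / 2 - 2 * s - 1 \<le> real k + 2 * real g0"
  "real n / 4 \<le> real k"
proof -
  define f where "f = nat \<lfloor>real n / 2 - 2 * s\<rfloor>"
  have f: "real f \<le> real n / 2 - 2 * s" "real n / 2 - 2 * s - 1 \<le> real f"
    using size_bounds(2) n_bounds(1) unfolding f_def by linarith+
  have "2 * real g0 \<le> real f" using f(2) g0_bounds(3) size_bounds(2) n_bounds(1) by linarith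
  then have "2 * g0 \<le> f" by linarith
  then have "real k + 2 * real g0 = real f" by (simp add: k_def f_def of_nat_diff)
  then show "real k + 2 * real g0 \<le> real n / 2 - 2 * s" "real n / 2 - 2 * s - 1 \<le> real k + 2 * real g0"
    "real n / 4 \<le> real k"
    using f g0_bounds(3) size_bounds(2) n_bounds(1) by linarith+
qed

lemma block_bounds: "0 < M" "14 * ln (real n) < real M" "4 * (M * b) \<le> k" "8 * (k2 + k3) \<le> k" "4 * b \<le> k"
  "0 < N0" "N0 * R3 \<le> b" "real M * real R3 / real N0 \<le> \<epsilon> / 8"
proof -
  show M0: "0 < M" by (simp add: M_def)
  have "14 * ln (real n) \<le> real (nat \<lceil>14 * ln (real n)\<rceil>)" by (rule real_nat_ceiling_ge)
  then show "14 * ln (real n) < real M" by (simp add: M_def)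
  have "real (nat \<lceil>14 * ln (real n)\<rceil>) \<le> 14 * ln (real n) + 1" using n_bounds(2) by linarith
  then have Mx: "real M \<le> 14 * ln (real n) + 2" by (simp add: M_def)
  have "b * (4 * M) \<le> k" unfolding b_def by (rule div_times_less_eq_dividend)
  then show Mb: "4 * (M * b) \<le> k" by (simp add: mult_ac)
  have "b \<le> M * b" using M0 by simp
  then show "4 * b \<le> k" using Mb by linarith
  have "real (8 * (k2 + k3)) \<le> real k" using size_bounds(1) k_bounds(3) by simp
  then show "8 * (k2 + k3) \<le> k" by (simp only: of_nat_le_iff)
  define bx where "bx = real n / (16 * (14 * ln (real n) + 2)) - 1"
  define Nx where "Nx = bx / (lvl3 n + 1) - 1"
  have big: "0 < Nx" "(14 * ln (real n) + 2) * lvl3 n \<le> \<epsilon> / 8 * Nx"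
    using large by (auto simp: large_def Let_def \<epsilon>_def Nx_def bx_def)
  have l3: "0 \<le> lvl3 n" using R_le(3) by linarith
  have bx0: "0 < bx"
  proof -
    have "0 < bx / (lvl3 n + 1)" using big(1) by (simp add: Nx_def)
    then show ?thesis using l3 by (simp add: zero_less_divide_iff)
  qed
  have bge: "bx \<le> real b"
  proof -
    have "real n / (16 * (14 * ln (real n) + 2)) \<le> real n / (16 * real M)"
      using Mx M0 n_bounds by (intro divide_left_mono mult_pos_pos) auto
    also have "\<dots> = real n / 4 / real (4 * M)" by simp
    also have "\<dots> \<le> real k / real (4 * M)" using k_bounds(3) by (rule divide_right_mono) simp
    also have "\<dots> \<le> real b + 1" using real_div_minus_nat_div_le[of k "4 * M"] unfolding b_def by linarith
    finally show ?thesis by (simp add: bx_def)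
  qed
  have Nge: "Nx \<le> real N0"
  proof -
    have "bx / (lvl3 n + 1) \<le> real b / (real R3 + 1)"
      using bge bx0 R_le(3) by (intro frac_le) auto
    also have "\<dots> \<le> real N0 + 1" using real_div_minus_nat_div_le[of b "R3 + 1"] unfolding N0_def by (simp add: add.commute)
    finally show ?thesis by (simp add: Nx_def)
  qed
  then show N0: "0 < N0" using big(1) by (metis less_le_trans of_nat_0_less_iff)
  have "N0 * R3 \<le> N0 * (R3 + 1)" by simp
  also have "\<dots> \<le> b" unfolding N0_def by (rule div_times_less_eq_dividend)
  finally show "N0 * R3 \<le> b" .
  have "real M * real R3 \<le> (14 * ln (real n) + 2) * lvl3 n" using Mx R_le(3) by (intro mult_mono) auto
  also have "\<dots> \<le> \<epsilon> / 8 * real N0" using big(2) mult_left_mono[OF Nge, of "\<epsilon> / 8"] eps(1) by linarith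
  finally show "real M * real R3 / real N0 \<le> \<epsilon> / 8" using N0 by (subst pos_divide_le_eq) auto
qed
text \<open>Layout of the cube: \<open>k2\<close> coordinates, then \<open>k3\<close>, then
  \<open>M\<close> consecutive blocks of length \<open>b\<close>, then a remainder. With one block
  set aside for the exact correction, the other blocks and the remainder form the large first cube
  \<open>A\<close> of a three-stage approximation.\<close>

lemma exact_distance_cube:
  assumes U: "U \<subseteq> Pow {..<k}" "\<epsilon> / 4 * 2 ^ card {..<k} \<le> real (card U)"
    and V: "V \<subseteq> Pow {..<k}" "\<epsilon> / 4 * 2 ^ card {..<k} \<le> real (card V)"
    and par: "\<And>a b. a \<in> U \<Longrightarrow> b \<in> V \<Longrightarrow> even (sdist a b + y)"
    and y: "y \<in> {R1 + R2 + R3..k - (R1 + R2 + R3)}"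
  shows "\<exists>a\<in>U. \<exists>b\<in>V. sdist a b = y"
proof -
  define B where "B t = {k2 + k3 + t * b..<k2 + k3 + Suc t * b}" for t
  have top: "k2 + k3 + Suc t * b \<le> k" if "t < M" for t
  proof -
    have "Suc t * b \<le> M * b" using that by (intro mult_right_mono) auto
    moreover have "c + q \<le> l" if "q \<le> p" "4 * p \<le> l" "8 * c \<le> l" for c p q l :: nat
      using that by linarith
    ultimately show ?thesis using block_bounds(3,4) by blast
  qed
  have BK: "B t \<subseteq> {..<k}" if "t < M" for t using top[OF that] by (auto simp: B_def)
  have cB: "card (B t) = b" for t by (simp add: B_def)
  have dis: "disjoint_family_on B {..<M}"
    unfolding disjoint_family_on_def
  proof (intro ballI impI)
    fix t u :: nat assume "t \<noteq> u"
    moreover have "Suc i * b \<le> j * b" if "i < j" for i j using that by (intro mult_right_mono) auto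
    ultimately have "Suc t * b \<le> u * b \<or> Suc u * b \<le> t * b" by (metis nat_neq_iff)
    then show "B t \<inter> B u = {}" by (auto simp: B_def)
  qed
  let ?Y = "R1 + R2 + R3"
  \<comment> \<open>Targets up to half of \<open>k\<close>, rounded up, suffice because larger ones
    are complemented. \<open>k2 + k3 \<le> k / 8\<close> and \<open>b \<le> k / 4\<close> leave
    \<open>A\<close> large enough for them.\<close>
  have near: "near ({..<k} - B t) (\<epsilon> / 16) {?Y..k - k div 2} (2 * R3)" if t: "t < M" for t
  proof -
    define A where "A = {k2 + k3..<k} - B t"
    have cA: "card A = k - (k2 + k3) - b"
      unfolding A_def using top[OF t] cB[of t] by (subst card_Diff_subset) (auto simp: B_def)
    have "A \<union> {..<k2} \<union> {k2..<k2 + k3} = {..<k} - B t"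
      using block_bounds(4) by (auto simp: A_def B_def)
    moreover have "near (A \<union> {..<k2} \<union> {k2..<k2 + k3}) (4 * (\<epsilon> / 64))
        {R1 + R2 + R3..card A + R1 + R2 + R3} (2 * R3)"
    proof (rule near123[OF _ _ _ _ _ _ _ _ eps(3)])
      have "real k \<le> real n" using k_bounds(1) s_pos by linarith
      then show "card A \<le> n" using cA by linarith
    qed (auto simp: A_def)
    ultimately have "near ({..<k} - B t) (\<epsilon> / 16) {R1 + R2 + R3..card A + R1 + R2 + R3} (2 * R3)"
      by simp
    moreover have "k - k div 2 \<le> card A + R1 + R2 + R3"
    proof -
      have "l - l div 2 \<le> l - c - d + p + q + r" if "8 * c \<le> l" "4 * d \<le> l" for c d p q r l :: nat
        using that by linarith
      then show ?thesis unfolding cA using block_bounds(4,5) by blast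
    qed
    ultimately show ?thesis by (auto intro: near_mono[OF _ order_refl])
  qed
  \<comment> \<open>Density budget: \<open>\<epsilon> / 64\<close> at the base becomes
    \<open>\<epsilon> / 16\<close> after two refinements and doubles for the common content;
    immovable members take the other \<open>\<epsilon> / 8\<close>.\<close>
  have dens: "2 * (\<epsilon> / 16) + real M * real R3 / real N0 \<le> \<epsilon> / 4" using block_bounds(8) by linarith
  have dense: "(2 * (\<epsilon> / 16) + real M * real R3 / real N0) * 2 ^ card {..<k} \<le> real (card W)"
    if "\<epsilon> / 4 * 2 ^ card {..<k} \<le> real (card W)" for W :: "nat set set"
    by (rule order_trans[OF mult_right_mono[OF dens] that]) simp
  have M: "14 * ln (1 / (2 * (\<epsilon> / 16))) < real M"
  proof -
    have "1 / (2 * (\<epsilon> / 16)) \<le> real n" using eps(1,2) by (simp add: field_simps)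
    then have "ln (1 / (2 * (\<epsilon> / 16))) \<le> ln (real n)" using eps(1) by (intro ln_mono) auto
    then show ?thesis using block_bounds(2) by linarith
  qed
  show ?thesis
  proof (rule exact_distance[OF _ dis BK _ block_bounds(6) _ near M U(1) dense[OF U(2)] V(1) dense[OF V(2)] par])
    have "y \<le> l \<and> (y \<in> {q..l - l div 2} \<or> l - y \<in> {q..l - l div 2})" if "y \<in> {q..l - q}" for y q l :: nat
      using that by auto
    from this[OF y] show "y \<le> card {..<k}" "y \<in> {?Y..k - k div 2} \<or> card {..<k} - y \<in> {?Y..k - k div 2}"
      by simp_all
  qed (use eps(1) block_bounds(7) cB in auto)
qed

lemma separating_long:
  "layer_separating n A layers \<epsilon> {R1 + R2 + R3 + g0..k - (R1 + R2 + R3)}"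
proof (rule layer_separating_word_code[where K = "{..<k}" and I = "{..<g0}" and N = 3])
  show "separating (code {..<k} {..<g0} 3) (cdist {..<g0}) \<epsilon> {R1 + R2 + R3 + g0..k - (R1 + R2 + R3)}"
  proof (rule separating_ternary[where Y = "{R1 + R2 + R3..k - (R1 + R2 + R3)}"])
    show "0 < \<epsilon>" by (rule eps)
    \<comment> \<open>Turns \<open>g0 \<ge> 3 * ln n\<close> into
      \<open>(3/2) ^ g0 \<ge> n > 4 / \<epsilon>\<close>, the density that the parity adjustment
      requires.\<close>
    have e: "exp (1/3) \<le> (3/2 :: real)"
      using exp_bound[of "1/3 :: real"] by (simp add: power2_eq_square)
    have "real n = exp (ln (real n))" using n_bounds by simp
    also have "\<dots> \<le> exp (real g0 * (1/3))" using g0_bounds(1) by simp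
    also have "\<dots> = exp (1/3) ^ g0" by (rule exp_of_nat_mult)
    also have "\<dots> \<le> (3/2) ^ g0" using e by (intro power_mono) auto
    finally have "real n \<le> (3/2) ^ g0" .
    moreover have "4 / \<epsilon> < real n"
    proof -
      have "4 / \<epsilon> < 64 / \<epsilon>" using eps(1) by (intro divide_strict_right_mono) auto
      then show ?thesis using eps(2) by linarith
    qed
    ultimately have "4 / \<epsilon> < 3 ^ g0 / 2 ^ g0" by (simp add: power_divide)
    then show "2 ^ card {..<g0} < \<epsilon> / 4 * 3 ^ card {..<g0}" using eps(1) by (simp add: field_simps)
    show "\<exists>a\<in>U. \<exists>b\<in>V. sdist a b = y"
      if "U \<subseteq> Pow {..<k}" "V \<subseteq> Pow {..<k}" "\<epsilon> / 4 * 2 ^ card {..<k} \<le> real (card U)"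
        "\<epsilon> / 4 * 2 ^ card {..<k} \<le> real (card V)" "\<And>a b. a \<in> U \<Longrightarrow> b \<in> V \<Longrightarrow> even (sdist a b + y)"
        "y \<in> {R1 + R2 + R3..k - (R1 + R2 + R3)}" for U V y
      by (rule exact_distance_cube[OF that(1,3,2,4,5,6)])
  qed auto
  fix i assume i: "i \<in> layers"
  have "real (k + g0) \<le> real i" "real (i + k + 2 * g0) \<le> real n"
    using i k_bounds(1) by (auto simp: layers_def)
  then show "card {..<k} + card {..<g0} \<le> i \<and> i + card {..<k} + (3 - 1) * card {..<g0} \<le> n"
    by (simp only: of_nat_le_iff card_lessThan) simp
qed (use eps layers_finite in auto)

section \<open>Assembling the codes\<close>

lemma sperner_bound_large:
  assumes E: "is_graph_on n E" and A: "A \<subseteq> Pow {1..n}" and sp: "GX_sperner E x A"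
    and x: "\<And>i j. E i j \<Longrightarrow> i < j \<Longrightarrow> real (x i j) \<le> real n / 2 - 9 * s"
  shows "real (card A) \<le> real (weight n E) + 11 * \<epsilon> * 2 ^ n"
proof -
  have 0: "layer_separating n A layers (2 * \<epsilon>) {..2 * R3}"
    using near_empty[OF eps(1), of "2 * R3", where ?'a = nat] by (intro separating_short[of "{}"]) auto
  have inv: "1 / real n \<le> \<epsilon>" "1 / real n \<le> \<epsilon> / 2" using eps by linarith+
  have 1: "layer_separating n A layers (2 * \<epsilon>) {R3..k3 + R3}"
    by (rule separating_short[of "{..<k3}"]) (auto intro!: near3 inv)
  have "near ({..<k2} \<union> {k2..<k2 + k3}) (2 * (\<epsilon> / 2)) {R2 + R3..k2 + R2 + R3} (2 * R3)"
    by (rule near23[OF _ _ _ _ _ inv(2)]) auto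
  then have 2: "layer_separating n A layers (2 * \<epsilon>) {R2 + R3..k2 + R2 + R3}"
    by (intro separating_short[of "{..<k2} \<union> {k2..<k2 + k3}"] order_trans[OF card_Un_le]) auto
  let ?Y = "R1 + R2 + R3"
  \<comment> \<open>Four codes cover all differences: letters alone, then cubes of dimension
    \<open>k3\<close>, \<open>k2 + k3\<close> and \<open>k\<close>. Consecutive ranges leave no
    gap.\<close>
  let ?X = "({..2 * R3} \<union> {R3..k3 + R3}) \<union> ({R2 + R3..k2 + R2 + R3} \<union> {?Y + g0..k - ?Y})"
  have sep: "layer_separating n A layers ((2 * \<epsilon> + 2 * \<epsilon>) + (2 * \<epsilon> + \<epsilon>)) ?X"
    by (intro layer_separating_Un 0 1 2 separating_long)
  have X: "x i j \<in> ?X" if e: "E i j" "i < j" for i j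
  proof -
    \<comment> \<open>Of the margin \<open>9 * s\<close>, the layer window takes
      \<open>2 * s\<close> through \<open>k\<close>; the radii, the ternary letters and the rounding
      fit into \<open>7 * s\<close>.\<close>
    have "real (x i j) + real ?Y \<le> real k"
      using x[OF e] k_bounds(2) g0_bounds(5) by simp
    then have "x i j \<le> k - ?Y" by linarith
    moreover have "k3 = 4 * R2" "k2 = 4 * R1" "g0 \<le> 3 * R1" by (simp_all add: k2_def k3_def g0_bounds)
    ultimately show ?thesis by auto
  qed
  have "(\<Sum>i\<in>{0..n} - layers. real (n choose i)) \<le> 4 * exp (- ((2 * s)\<^sup>2 / (2 * real n))) * 2 ^ n"
    unfolding layers_def using binomial_tails[of n "2 * s"] s_pos n_bounds by simp
  \<comment> \<open>The window \<open>2 * s\<close> makes the tails at most \<open>4 / n^2\<close>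
    of the cube, well below \<open>4 * \<epsilon>\<close>.\<close>
  also have "(2 * s)\<^sup>2 / (2 * real n) = 2 * ln (real n)"
    using n_bounds by (simp add: s_def power_mult_distrib)
  also have "4 * exp (- (2 * ln (real n))) * 2 ^ n \<le> 4 * \<epsilon> * 2 ^ n"
    using n_bounds by (auto simp: \<epsilon>_def powr_def)
  finally have tail: "(\<Sum>i\<in>{0..n} - layers. real (n choose i)) \<le> 4 * \<epsilon> * 2 ^ n" .
  have "real (card A) \<le> real (weight n E) + (((2 * \<epsilon> + 2 * \<epsilon>) + (2 * \<epsilon> + \<epsilon>)) + 4 * \<epsilon>) * 2 ^ n"
    by (rule sperner_bound[OF E A sp layers_finite(2) sep X tail])
  then show ?thesis by (simp add: algebra_simps)
qed
end

section \<open>The bound for all orders\<close>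

theorem theorem2:
  shows "\<exists>C::real. C > 0 \<and>
    (\<forall>(n::nat) (E::nat \<Rightarrow> nat \<Rightarrow> bool) (x::nat \<Rightarrow> nat \<Rightarrow> nat) (\<A>::nat set set).
       n \<ge> 1 \<longrightarrow> is_graph_on n E \<longrightarrow>
       (\<forall>i j. E i j \<and> i < j \<longrightarrow> real (x i j) \<le> real n / 2 - 9 * sqrt (real n * ln (real n))) \<longrightarrow>
       \<A> \<subseteq> Pow {1..n} \<longrightarrow> GX_sperner E x \<A> \<longrightarrow>
       real (card \<A>) \<le> real (weight n E) + C / real n powr (2/3) * 2 ^ n)"
proof -
  obtain n0 where n0: "\<And>n. n0 \<le> n \<Longrightarrow> large n"
    using eventually_large by (auto simp: eventually_sequentially)
  \<comment> \<open>11 is the total cost of codes and tails for large \<open>n\<close>. The summand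
    \<open>n0\<close> covers \<open>n < n0\<close>, where
    \<open>n powr (2/3) \<le> n \<le> C\<close> makes the trivial bound \<open>2 ^ n\<close>
    sufficient.\<close>
  define C where "C = 11 + real n0"
  have "real (card A) \<le> real (weight n E) + C / real n powr (2/3) * 2 ^ n"
    if n: "n \<ge> 1" and E: "is_graph_on n E"
      and x: "\<forall>i j. E i j \<and> i < j \<longrightarrow> real (x i j) \<le> real n / 2 - 9 * sqrt (real n * ln (real n))"
      and A: "A \<subseteq> Pow {1..n}" and sp: "GX_sperner E x A" for n E x A
  proof (cases "n0 \<le> n")
    case True
    then interpret large_order n by unfold_locales (rule n0)
    have "real (card A) \<le> real (weight n E) + 11 * \<epsilon> * 2 ^ n"
      using x by (intro sperner_bound_large[OF E A sp]) (simp add: s_def)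
    also have "11 * \<epsilon> * 2 ^ n = 11 / real n powr (2/3) * 2 ^ n"
      using powr_minus_divide[of "real n" "2/3"] by (simp add: \<epsilon>_def)
    also have "\<dots> \<le> C / real n powr (2/3) * 2 ^ n"
      by (intro mult_right_mono divide_right_mono) (auto simp: C_def)
    finally show ?thesis by simp
  next
    case False
    have "card A \<le> card (Pow {1..n})" using A by (intro card_mono) auto
    then have "real (card A) \<le> real (card (Pow {1..n}))" by (rule of_nat_mono)
    then have "real (card A) \<le> 1 * 2 ^ n" by (simp add: card_Pow)
    also have "\<dots> \<le> C / real n powr (2/3) * 2 ^ n"
    proof (rule mult_right_mono)
      have "real n powr (2/3) \<le> real n powr 1" using n by (intro powr_mono) auto
      also have "\<dots> \<le> C" using False n by (simp add: C_def)
      finally show "1 \<le> C / real n powr (2/3)" using n by (simp add: le_divide_eq)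
    qed simp
    finally show ?thesis by simp
  qed
  moreover have "C > 0" by (simp add: C_def)
  ultimately show ?thesis by blast
qed

end
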